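(* Let $s,l,n$ be positive integers. There is a unique homomorphism of $\mathrm{U}_q(\mathfrak{q}_n)$-supermodules $$\bar\Theta:\bar{\mathsf{A}}_{l,n}\otimes\bar{\mathsf{A}}_{s,n}\rightarrow\bar{\mathsf{A}}_{s,n}\otimes\bar{\mathsf{A}}_{l,n}$$ such that, with $\mathrm{mul}$ denoting multiplication, $$\bar\Theta\circ(1\otimes\mathrm{mul})=(\mathrm{mul}\otimes1)\circ(1\otimes\bar\Theta)\circ(\bar\Theta\otimes1)\ \text{ on }\ \bar{\mathsf{A}}_{l,n}\otimes\bar{\mathsf{A}}_{s,n}\otimes\bar{\mathsf{A}}_{s,n},$$ $$\bar\Theta\circ(\mathrm{mul}\otimes1)=(1\otimes\mathrm{mul})\circ(\bar\Theta\otimes1)\circ(1\otimes\bar\Theta)\ \text{ on }\ \bar{\mathsf{A}}_{l,n}\otimes\bar{\mathsf{A}}_{l,n}\otimes\bar{\mathsf{A}}_{s,n},$$ and such that $$\bar\Theta(1\otimes\bar x)=\bar x\otimes1\ (\bar x\in\bar{\mathsf{A}}_{s,n}),\qquad\bar\Theta(\bar y\otimes1)=1\otimes\bar y\ (\bar y\in\bar{\mathsf{A}}_{l,n}),\qquad\bar\Theta\bigl(\bar T_l^{1[3]}\bar T_s^{2[4]}\bigr)=S^{12}\bar T_s^{2[3]}\bar T_l^{1[4]},$$ where $\bar T_l=\sum_{\beta=-l}^{-1}\sum_{b\in I_{n|n}}E_{b\beta}\otimes\bar t_{\beta b}$ and $\bar T_s=\sum_{\alpha=-s}^{-1}\sum_{a\in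 I_{n|n}}E_{a\alpha}\otimes\bar t_{\alpha a}$ are the generator matrices of $\bar{\mathsf{A}}_{l,n}$ and $\bar{\mathsf{A}}_{s,n}$.
   Context: **Conventions.** The base field is $\mathbb{C}(q)$. Tensor products of superalgebras use the Koszul sign rule $(x\otimes y)(x'\otimes y')=(-1)^{|y||x'|}xx'\otimes yy'$. For $N\ge1$, $I_{N|N}=\{-N,\dots,-1,1,\dots,N\}$, with $|i|=\bar0$ if $i>0$ and $|i|=\bar1$ if $i<0$. Matrix units $E_{ij}$ (possibly rectangular) have parity $|i|+|j|$. $\delta_{a<b}$ is $1$ if $a<b$ and $0$ otherwise; $\xi=q-q^{-1}$; $\varphi(i,j)=(-1)^{|j|}(\delta_{ij}+\delta_{i,-j})$. $V_q$ is the superspace with basis $v_i$, $i\in I_{n|n}$, $|v_i|=|i|$, and $$S=\sum_{i,j\in I_{n|n}}q^{\varphi(i,j)}E_{ii}\otimes E_{jj}+\xi\sum_{i<j}(-1)^{|i|}(E_{ji}+E_{-j,-i})\otimes E_{ij}\in\mathrm{End}(V_q)^{\otimes2},$$ with inverse $S^{-1}=\sum_{i,j\in I_{n|n}}q^{-\varphi(i,j)}E_{ii}\otimes E_{jj}-\xi\sum_{i<j}(-1)^{|i|}(E_{ji}+E_{-j,-i})\otimes E_{ij}$. Superscripts indicate tensor positions, and a bracketed position is the one occupied by entries in a superalgebra other than a matrix superalgebra, e.g. $\bar T_l^{1[3]}=\sum E_{b\beta}\otimes1\otimes\bar t_{\beta b}\otimes1$. In the last condition $\bar\Theta$ is applied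 to tensor positions 3 and 4; in components the condition reads $$\bar\Theta(\bar t_{\beta b}\otimes\bar t_{\alpha a})=(-1)^{(|a|+1)(|b|+1)}q^{\varphi(b,a)}\bar t_{\alpha a}\otimes\bar t_{\beta b}-\delta_{a<b}\xi\,\bar t_{\alpha b}\otimes\bar t_{\beta a}-(-1)^{|b|}\delta_{a<-b}\xi\,\bar t_{\alpha,-b}\otimes\bar t_{\beta,-a}.$$ **$\mathrm{U}_q(\mathfrak{q}_n)$** is the unital associative superalgebra generated by $L_{ij}$ of parity $|i|+|j|$, $i,j\in I_{n|n}$, $i\le j$, with relations $L_{ii}L_{-i,-i}=1=L_{-i,-i}L_{ii}$ and $L^{[1]2}L^{[1]3}S^{23}=S^{23}L^{[1]3}L^{[1]2}$, where $L=\sum_{i\le j}L_{ij}\otimes E_{ij}$ (put $L_{ij}=0$ for $i>j$). It is a Hopf superalgebra with $\Delta(L)=L\otimes L$, i.e. $\Delta(L_{ij})=\sum_k(-1)^{(|i|+|k|)(|k|+|j|)}L_{ik}\otimes L_{kj}$, $\varepsilon(L)=1$, antipode $L\mapsto L^{-1}$; it acts on tensor products through $\Delta$. A $\mathrm{U}_q(\mathfrak{q}_n)$-supermodule superalgebra is a unital associative superalgebra $B$ that is a $\mathrm{U}_q(\mathfrak{q}_n)$-supermodule with $u.(ab)=\sum_{(u)}(-1)^{|u_{(2)}||a|}(u_{(1)}.a)(u_{(2)}.b)$ and $u.1=\varepsilon(u)1$. **Dual quantum coordinate superalgebra $\bar{\mathsf{A}}_{s,n}$.** Unital associative superalgebra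 generated by $\bar t_{\alpha b}$ of parity $|\alpha|+|b|$, $\alpha\in I_{s|s}$, $b\in I_{n|n}$, with relations $\bar t_{\alpha b}=(-1)^{|\alpha|+|b|}\bar t_{-\alpha,-b}$ and $\bar T^{1[3]}\bar T^{2[3]}S^{12}=S^{12}\bar T^{2[3]}\bar T^{1[3]}$, where $\bar T=\sum(-1)^{|b|(|\alpha|+|b|)}E_{b\alpha}\otimes\bar t_{\alpha b}$ (the left-hand $S$ is the matrix of the same form with indices in $I_{s|s}$). It is equivalently presented by generators $\bar t_{\alpha b}$, $\alpha=-1,\dots,-s$, $b\in I_{n|n}$, with relations $$q^{-\delta_{\alpha\beta}}\bar t_{\alpha a}\bar t_{\beta b}-(-1)^{(|a|+1)(|b|+1)}q^{\varphi(a,b)}\bar t_{\beta b}\bar t_{\alpha a}=\xi(\delta_{\alpha<\beta}-\delta_{b<a})\bar t_{\beta a}\bar t_{\alpha b}-(-1)^{|a|}\xi\,\delta_{b<-a}\,\bar t_{\beta,-a}\bar t_{\alpha,-b}.$$ It is a $\mathrm{U}_q(\mathfrak{q}_n)$-supermodule superalgebra with action $\bar\Phi$ determined by $L^{[2]3}\cdot_{\bar\Phi}\bar T^{1[2]}=(S^{-1})^{13}\bar T^{1[2]}$, where for a matrix $M=\sum E_{c\alpha}\otimes m_{c\alpha}$, $L^{[2]3}\cdot M^{1[2]}:=\sum(-1)^{(|a|+|b|)|m_{c\alpha}|}E_{c\alpha}\otimes(L_{ab}.m_{c\alpha})\otimes E_{ab}$. *)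

theory Defs
  imports
    "HOL-Computational_Algebra.Polynomial"
    "HOL-Computational_Algebra.Fraction_Field"
    "HOL-Library.Poly_Mapping"
    "HOL-Library.Cardinality"
begin

section \<open>The base field\<close>

type_synonym cq = "complex poly fract"

definition q :: cq where
  "q = Fract [:0, 1:] 1"

definition xi :: cq  (\<open>\<xi>\<close>) where
  "\<xi> = q - inverse q"

section \<open>Superspaces and superalgebras over the base field\<close>

text \<open>
  Parities are booleans, \<^term>\<open>True\<close> being odd; the sum of two parities is \<^term>\<open>p \<noteq> r\<close>
  and their product is \<^term>\<open>p \<and> r\<close>.
\<close>

definition sg :: "bool \<Rightarrow> cq" where
  "sg p = (if p then - 1 else 1)"

class qspace = ab_group_add +
  fixes scale :: "cq \<Rightarrow> 'a \<Rightarrow> 'a"  (infixr \<open>*\<^sub>q\<close> 75)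
  assumes scale_right_distrib: "c *\<^sub>q (x + y) = c *\<^sub>q x + c *\<^sub>q y"
    and scale_left_distrib: "(c + d) *\<^sub>q x = c *\<^sub>q x + d *\<^sub>q x"
    and scale_scale: "c *\<^sub>q d *\<^sub>q x = (c * d) *\<^sub>q x"
    and scale_one: "1 *\<^sub>q x = x"

text \<open>
  A superspace is given by the projections \<open>part p\<close> onto its homogeneous components;
  the component of parity \<open>p\<close> is \<^term>\<open>{x. part p x = x}\<close>.
\<close>

class superspace = qspace +
  fixes part :: "bool \<Rightarrow> 'a \<Rightarrow> 'a"
  assumes part_add: "part p (x + y) = part p x + part p y"
    and part_scale: "part p (c *\<^sub>q x) = c *\<^sub>q part p x"
    and part_part: "part p (part r x) = (if p = r then part r x else 0)"
    and part_decompose: "part False x + part True x = x"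

text \<open>No condition \<^term>\<open>0 \<noteq> 1\<close> is imposed on unital algebras.\<close>

class superalgebra = superspace + ring + monoid_mult +
  assumes scale_mult_left: "(c *\<^sub>q x) * y = c *\<^sub>q (x * y)"
    and scale_mult_right: "x * (c *\<^sub>q y) = c *\<^sub>q (x * y)"
    and part_one: "part False 1 = 1"
    and part_mult: "part (p \<noteq> r) (part p x * part r y) = part p x * part r y"

abbreviation qlinear :: "('a::qspace \<Rightarrow> 'b::qspace) \<Rightarrow> bool" where
  "qlinear \<equiv> Vector_Spaces.linear scale scale"

definition even_map :: "('a::superspace \<Rightarrow> 'b::superspace) \<Rightarrow> bool" where
  "even_map f \<longleftrightarrow> (\<forall>p x. f (part p x) = part p (f x))"

text \<open>The Koszul sign acquired by an element when something of parity \<open>p\<close> is moved past it.\<close>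

definition twist :: "bool \<Rightarrow> 'a::superspace \<Rightarrow> 'a" where
  "twist p x = part False x + sg p *\<^sub>q part True x"

definition superalg_hom :: "('a::superalgebra \<Rightarrow> 'b::superalgebra) \<Rightarrow> bool" where
  "superalg_hom f \<longleftrightarrow>
     qlinear f \<and> even_map f \<and> f 1 = 1 \<and> (\<forall>x y. f (x * y) = f x * f y)"

lemma qspace_vector_space: "vector_space (scale :: cq \<Rightarrow> 'a::qspace \<Rightarrow> 'a)"
  by unfold_locales (simp_all add: scale_right_distrib scale_left_distrib scale_scale scale_one)

lemma qlinear_iff:
  "qlinear f \<longleftrightarrow> (\<forall>x y. f (x + y) = f x + f y) \<and> (\<forall>c x. f (c *\<^sub>q x) = c *\<^sub>q f x)"
  by (simp add: Vector_Spaces.linear_iff qspace_vector_space)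

lemma scale_zero_right [simp]: "c *\<^sub>q (0 :: 'a::qspace) = 0"
  using scale_right_distrib[of c 0 0] by simp

lemma scale_zero_left [simp]: "0 *\<^sub>q (x :: 'a::qspace) = 0"
  using scale_left_distrib[of 0 0 x] by simp

lemma scale_minus_right: "c *\<^sub>q (- x) = - (c *\<^sub>q (x :: 'a::qspace))"
  using scale_right_distrib[of c x "- x"] by (simp add: eq_neg_iff_add_eq_0 add.commute)

lemma scale_minus_left: "(- c) *\<^sub>q x = - (c *\<^sub>q (x :: 'a::qspace))"
  using scale_left_distrib[of c "- c" x] by (simp add: eq_neg_iff_add_eq_0 add.commute)

lemma scale_diff_right: "c *\<^sub>q (x - y) = c *\<^sub>q x - c *\<^sub>q (y :: 'a::qspace)"
  using scale_right_distrib[of c "x - y" y] by (simp add: algebra_simps)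

lemma scale_sum: "c *\<^sub>q (sum f A) = (\<Sum>a\<in>A. c *\<^sub>q (f a :: 'a::qspace))"
  by (induction A rule: infinite_finite_induct) (simp_all add: scale_right_distrib)

lemma part_zero [simp]: "part p (0 :: 'a::superspace) = 0"
  using part_add[of p 0 0] by simp

lemma part_minus: "part p (- x) = - part p (x :: 'a::superspace)"
  using part_add[of p x "- x"] by (simp add: eq_neg_iff_add_eq_0 add.commute)

lemma part_diff: "part p (x - y) = part p x - part p (y :: 'a::superspace)"
  using part_add[of p "x - y" y] by (simp add: algebra_simps)

lemma part_sum: "part p (sum f A) = (\<Sum>a\<in>A. part p (f a :: 'a::superspace))"
  by (induction A rule: infinite_finite_induct) (simp_all add: part_add)

lifting_forget fract.lifting
lifting_forget poly.lifting

section \<open>Free superalgebras\<close>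

class graded =
  fixes par :: "'a \<Rightarrow> bool"

datatype 'g word = Word (letters: "'g list")

instantiation word :: (type) monoid_add
begin
definition zero_word :: "'a word" where "0 = Word []"
definition plus_word :: "'a word \<Rightarrow> 'a word \<Rightarrow> 'a word" where
  "v + w = Word (letters v @ letters w)"
instance by standard (simp_all add: zero_word_def plus_word_def)
end

definition word_parity :: "('g \<Rightarrow> bool) \<Rightarrow> 'g word \<Rightarrow> bool" where
  "word_parity f w \<longleftrightarrow> odd (length (filter f (letters w)))"

lemma word_parity_add: "word_parity f (v + w) = (word_parity f v \<noteq> word_parity f w)"
  by (auto simp: word_parity_def plus_word_def)

lemma word_parity_0: "\<not> word_parity f 0"
  by (simp add: word_parity_def zero_word_def)

text \<open>The multiplication of \<^typ>\<open>'g word \<Rightarrow>\<^sub>0 cq\<close> is convolution, i.e. concatenation of words.\<close>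

typedef 'g free = "UNIV :: ('g word \<Rightarrow>\<^sub>0 cq) set" by simp

setup_lifting type_definition_free

text \<open>
  The parity of the generators is an explicit argument, because the axioms of the class
  \<open>presented\<close> below have to refer to it for a type not yet known to be graded.
\<close>

lift_definition free_part :: "('g \<Rightarrow> bool) \<Rightarrow> bool \<Rightarrow> 'g free \<Rightarrow> 'g free" is
  "\<lambda>f p x. Poly_Mapping.mapp (\<lambda>(w :: 'g word) (c :: cq). c when word_parity f w = p) x" .

instantiation free :: (graded) superalgebra
begin

lift_definition zero_free :: "'a free" is 0 .
lift_definition one_free :: "'a free" is 1 .
lift_definition plus_free :: "'a free \<Rightarrow> 'a free \<Rightarrow> 'a free" is "(+)" .
lift_definition minus_free :: "'a free \<Rightarrow> 'a free \<Rightarrow> 'a free" is "(-)" .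
lift_definition uminus_free :: "'a free \<Rightarrow> 'a free" is uminus .
lift_definition times_free :: "'a free \<Rightarrow> 'a free \<Rightarrow> 'a free" is "(*)" .
lift_definition scale_free :: "cq \<Rightarrow> 'a free \<Rightarrow> 'a free" is
  "\<lambda>c x. Poly_Mapping.map ((*) c) x" .
definition part_free :: "bool \<Rightarrow> 'a free \<Rightarrow> 'a free" where
  "part = free_part par"

instance
proof
  fix x y z :: "'a free" and c d :: cq and p r :: bool
  have L: "Poly_Mapping.lookup (Poly_Mapping.map ((*) c) u) k = c * Poly_Mapping.lookup u k" for c and u :: "'a word \<Rightarrow>\<^sub>0 cq" and k
    by (simp add: Poly_Mapping.map.rep_eq when_def)
  have M: "Poly_Mapping.lookup (Poly_Mapping.mapp (\<lambda>w c. c when word_parity par w = p) u) k = (if word_parity par k = p then Poly_Mapping.lookup u k else 0)"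
    for p and u :: "'a word \<Rightarrow>\<^sub>0 cq" and k
    by (simp add: mapp.rep_eq in_keys_iff)
  show "x + y + z = x + (y + z)" by transfer (simp add: add.assoc)
  show "x + y = y + x" by transfer (simp add: add.commute)
  show "0 + x = x" by transfer simp
  show "- x + x = 0" by transfer simp
  show "x - y = x + - y" by transfer simp
  show "x * y * z = x * (y * z)" by transfer (simp add: mult.assoc)
  show "(x + y) * z = x * z + y * z" by transfer (simp add: algebra_simps)
  show "x * (y + z) = x * y + x * z" by transfer (simp add: algebra_simps)
  show "1 * x = x" by transfer simp
  show "x * 1 = x" by transfer simp
  show "c *\<^sub>q (x + y) = c *\<^sub>q x + c *\<^sub>q y"
    by transfer (rule poly_mapping_eqI, simp add: L lookup_add algebra_simps)
  show "(c + d) *\<^sub>q x = c *\<^sub>q x + d *\<^sub>q x"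
    by transfer (rule poly_mapping_eqI, simp add: L lookup_add algebra_simps)
  show "c *\<^sub>q d *\<^sub>q x = (c * d) *\<^sub>q x"
    by transfer (rule poly_mapping_eqI, simp add: L algebra_simps)
  show "1 *\<^sub>q x = x"
    by transfer (rule poly_mapping_eqI, simp add: L)
  show "part p (x + y) = part p x + part p y"
    unfolding part_free_def by transfer (rule poly_mapping_eqI, simp add: M lookup_add)
  show "part p (c *\<^sub>q x) = c *\<^sub>q part p x"
    unfolding part_free_def by transfer (rule poly_mapping_eqI, simp add: M L)
  show "part p (part r x) = (if p = r then part r x else 0)"
    unfolding part_free_def by transfer (auto intro!: poly_mapping_eqI simp add: M)
  show "part False x + part True x = x"
    unfolding part_free_def
    by transfer (rule poly_mapping_eqI, simp add: M[where p = True, simplified]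
        M[where p = False, simplified] lookup_add)
  have S: "Poly_Mapping.map ((*) c) u = Poly_Mapping.single 0 c * u" for c and u :: "'a word \<Rightarrow>\<^sub>0 cq"
  proof (rule poly_mapping_eqI)
    fix k
    have "Poly_Mapping.lookup (Poly_Mapping.single 0 c * u) k = c * Poly_Mapping.lookup u k"
      by (simp add: lookup_mult lookup_single when_mult)
    then show "Poly_Mapping.lookup (Poly_Mapping.map ((*) c) u) k = Poly_Mapping.lookup (Poly_Mapping.single 0 c * u) k"
      by (simp add: L)
  qed
  have S': "Poly_Mapping.map ((*) c) u = u * Poly_Mapping.single 0 c" for c and u :: "'a word \<Rightarrow>\<^sub>0 cq"
  proof (rule poly_mapping_eqI)
    fix k
    have "(\<Sum>l. Poly_Mapping.lookup u l * (\<Sum>v. Poly_Mapping.lookup (Poly_Mapping.single 0 c) v when k = l + v))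
        = (\<Sum>l. Poly_Mapping.lookup u l * c when l = k)"
    proof (rule Sum_any.cong)
      fix l
      have "(\<Sum>v. Poly_Mapping.lookup (Poly_Mapping.single 0 c) v when k = l + v)
          = (\<Sum>v::'a word. (c when k = l) when v = 0)"
        by (rule Sum_any.cong) (auto simp: lookup_single when_def)
      then show "Poly_Mapping.lookup u l * (\<Sum>v. Poly_Mapping.lookup (Poly_Mapping.single 0 c) v when k = l + v)
          = (Poly_Mapping.lookup u l * c when l = k)"
        by (auto simp: when_def)
    qed
    then have "Poly_Mapping.lookup (u * Poly_Mapping.single 0 c) k = c * Poly_Mapping.lookup u k"
      by (simp add: lookup_mult mult.commute)
    then show "Poly_Mapping.lookup (Poly_Mapping.map ((*) c) u) k = Poly_Mapping.lookup (u * Poly_Mapping.single 0 c) k"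
      by (simp add: L)
  qed
  show "(c *\<^sub>q x) * y = c *\<^sub>q (x * y)"
    by transfer (simp add: S mult.assoc)
  show "x * (c *\<^sub>q y) = c *\<^sub>q (x * y)"
  proof transfer
    fix u v :: "'a word \<Rightarrow>\<^sub>0 cq" and c
    have "u * Poly_Mapping.map ((*) c) v = u * (v * Poly_Mapping.single 0 c)" by (simp add: S')
    also have "\<dots> = Poly_Mapping.map ((*) c) (u * v)" by (simp add: S' mult.assoc)
    finally show "u * Poly_Mapping.map ((*) c) v = Poly_Mapping.map ((*) c) (u * v)" .
  qed
  show "part False (1 :: 'a free) = 1"
    unfolding part_free_def
  proof (transfer, rule poly_mapping_eqI)
    fix k :: "'a word"
    show "Poly_Mapping.lookup (Poly_Mapping.mapp (\<lambda>w c. c when word_parity par w = False) 1) k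
        = Poly_Mapping.lookup (1 :: 'a word \<Rightarrow>\<^sub>0 cq) k"
      unfolding M by (cases "k = 0") (simp_all add: lookup_one word_parity_0)
  qed
  show "part (p \<noteq> r) (part p x * part r y) = part p x * part r y"
    unfolding part_free_def
  proof transfer
    fix p r and u v :: "'a word \<Rightarrow>\<^sub>0 cq"
    let ?u = "Poly_Mapping.mapp (\<lambda>w c. c when word_parity par w = p) u" and ?v = "Poly_Mapping.mapp (\<lambda>w c. c when word_parity par w = r) v"
    have nz: "word_parity par k = (p \<noteq> r)" if "Poly_Mapping.lookup (?u * ?v) k \<noteq> 0" for k
    proof -
      from that have "k \<in> Poly_Mapping.keys (?u * ?v)" by (simp add: in_keys_iff)
      then obtain a b where k: "k = a + b" and a: "a \<in> Poly_Mapping.keys ?u"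
          and b: "b \<in> Poly_Mapping.keys ?v"
        using keys_mult[of ?u ?v] by blast
      have pa: "word_parity par a = p"
        using a unfolding in_keys_iff M by (cases "word_parity par a = p") simp_all
      have pb: "word_parity par b = r"
        using b unfolding in_keys_iff M by (cases "word_parity par b = r") simp_all
      show ?thesis unfolding k word_parity_add pa pb ..
    qed
    have "(if word_parity par k = (p \<noteq> r) then Poly_Mapping.lookup (?u * ?v) k else 0)
        = Poly_Mapping.lookup (?u * ?v) k" for k
    proof (cases "word_parity par k = (p \<noteq> r)")
      case True
      show ?thesis by (rule if_P[OF True])
    next
      case False
      then have "Poly_Mapping.lookup (?u * ?v) k = 0" using nz[of k] by argo
      then show ?thesis by (simp only: if_cancel)
    qed
    then show "Poly_Mapping.mapp (\<lambda>w c. c when word_parity par w = (p \<noteq> r)) (?u * ?v) = ?u * ?v"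
      by (intro poly_mapping_eqI) (simp only: M)
  qed
qed

end

lift_definition gen :: "'g \<Rightarrow> 'g free" is "\<lambda>g. Poly_Mapping.single (Word [g]) 1" .

lemma part_gen: "part (par g) (gen g) = (gen g :: 'g::graded free)"
  unfolding part_free_def
  by transfer
     (auto intro!: poly_mapping_eqI simp: mapp.rep_eq in_keys_iff lookup_single when_def word_parity_def)

section \<open>Superalgebras given by generators and relations\<close>

text \<open>Since scalars lie in the algebra, a set closed under these rules is a two-sided ideal and a subspace.\<close>

inductive_set ideal_gen :: "'a::superalgebra set \<Rightarrow> 'a set" for R where
  ideal_zero: "0 \<in> ideal_gen R"
| ideal_base: "r \<in> R \<Longrightarrow> a * r * b \<in> ideal_gen R"
| ideal_add: "x \<in> ideal_gen R \<Longrightarrow> y \<in> ideal_gen R \<Longrightarrow> x + y \<in> ideal_gen R"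

lemma ideal_scale: "x \<in> ideal_gen R \<Longrightarrow> c *\<^sub>q x \<in> ideal_gen R"
proof (induction rule: ideal_gen.induct)
  case (ideal_base r a b)
  then have "(c *\<^sub>q a) * r * b \<in> ideal_gen R" by (rule ideal_gen.ideal_base)
  then show ?case by (simp add: scale_mult_left)
qed (auto simp: scale_right_distrib intro: ideal_gen.intros)

lemma ideal_minus: "x \<in> ideal_gen R \<Longrightarrow> - x \<in> ideal_gen R"
  using ideal_scale[of x R "- 1"] by (simp add: scale_minus_left scale_one)

lemma ideal_mult_left: "x \<in> ideal_gen R \<Longrightarrow> a * x \<in> ideal_gen R"
proof (induction rule: ideal_gen.induct)
  case (ideal_base r a' b)
  then have "(a * a') * r * b \<in> ideal_gen R" by (rule ideal_gen.ideal_base)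
  then show ?case by (simp add: mult.assoc)
qed (auto simp: distrib_left intro: ideal_gen.intros)

lemma ideal_mult_right: "x \<in> ideal_gen R \<Longrightarrow> x * b \<in> ideal_gen R"
proof (induction rule: ideal_gen.induct)
  case (ideal_base r a b')
  then have "a * r * (b' * b) \<in> ideal_gen R" by (rule ideal_gen.ideal_base)
  then show ?case by (simp add: mult.assoc)
qed (auto simp: distrib_right intro: ideal_gen.intros)

lemma ideal_diff: "x \<in> ideal_gen R \<Longrightarrow> y \<in> ideal_gen R \<Longrightarrow> x - y \<in> ideal_gen R"
  using ideal_add[OF _ ideal_minus, of x R y] by simp

lemma part_mult_eq:
  "part t (part p x * part r y) = (if t = (p \<noteq> r) then part p x * part r (y::'a::superalgebra) else 0)"
  using part_part[of t "p \<noteq> r" "part p x * part r y"] unfolding part_mult .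

lemma ideal_part:
  assumes hom: "\<And>r. r \<in> R \<Longrightarrow> \<exists>p. part p r = r" and "x \<in> ideal_gen R"
  shows "part t x \<in> ideal_gen R"
  using assms(2)
proof (induction rule: ideal_gen.induct)
  case (ideal_base r a b)
  obtain p where p: "part p r = r" using hom ideal_base by blast
  have *: "part t (part u a * r * part v b) \<in> ideal_gen R" for u v
  proof -
    let ?z = "part u a * r * part v b"
    have A: "part (u \<noteq> p) (part u a * r) = part u a * r"
      using part_mult[of u p a r] p by simp
    have "part t ?z = (if t = ((u \<noteq> p) \<noteq> v) then ?z else 0)"
      using part_mult_eq[of t "u \<noteq> p" "part u a * r" v b] unfolding A .
    moreover have "?z \<in> ideal_gen R" using ideal_base by (rule ideal_gen.ideal_base)
    ultimately show ?thesis by (metis (full_types) ideal_zero)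
  qed
  have "a * r * b = (part False a + part True a) * r * (part False b + part True b)"
    by (simp add: part_decompose)
  also have "\<dots> = part False a * r * part False b + part False a * r * part True b
      + (part True a * r * part False b + part True a * r * part True b)"
    by (simp add: algebra_simps)
  finally show ?case using * by (simp add: part_add ideal_add)
qed (auto simp: part_add intro: ideal_gen.intros)

class presented = graded +
  fixes relators :: "'a free set"
  assumes relators_homogeneous: "r \<in> relators \<Longrightarrow> \<exists>p. free_part par p r = r"

quotient_type (overloaded) 'g presented_algebra =
  "'g::presented free" / "\<lambda>x y. x - y \<in> ideal_gen (relators :: 'g free set)"
proof (rule equivpI)
  show "reflp (\<lambda>x y. x - y \<in> ideal_gen (relators :: 'g free set))"
    by (rule reflpI) (simp add: ideal_zero)
  show "symp (\<lambda>x y. x - y \<in> ideal_gen (relators :: 'g free set))"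
    by (rule sympI, drule ideal_minus) simp
  show "transp (\<lambda>x y. x - y \<in> ideal_gen (relators :: 'g free set))"
    by (rule transpI, drule (1) ideal_add) simp
qed

instantiation presented_algebra :: (presented) superalgebra
begin

lift_definition zero_presented_algebra :: "'a presented_algebra" is 0 .
lift_definition one_presented_algebra :: "'a presented_algebra" is 1 .
lift_definition plus_presented_algebra ::
  "'a presented_algebra \<Rightarrow> 'a presented_algebra \<Rightarrow> 'a presented_algebra" is "(+)"
  by (drule (1) ideal_add) (simp add: algebra_simps)
lift_definition minus_presented_algebra ::
  "'a presented_algebra \<Rightarrow> 'a presented_algebra \<Rightarrow> 'a presented_algebra" is "(-)"
  by (drule (1) ideal_diff) (simp add: algebra_simps)
lift_definition uminus_presented_algebra ::
  "'a presented_algebra \<Rightarrow> 'a presented_algebra" is uminus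
  by (drule ideal_minus) (simp add: algebra_simps)
lift_definition times_presented_algebra ::
  "'a presented_algebra \<Rightarrow> 'a presented_algebra \<Rightarrow> 'a presented_algebra" is "(*)"
proof -
  fix x x' y y' :: "'a free"
  assume "x - x' \<in> ideal_gen relators" "y - y' \<in> ideal_gen relators"
  then have "(x - x') * y + x' * (y - y') \<in> ideal_gen relators"
    by (intro ideal_add ideal_mult_left ideal_mult_right)
  then show "x * y - x' * y' \<in> ideal_gen relators" by (simp add: algebra_simps)
qed
lift_definition scale_presented_algebra ::
  "cq \<Rightarrow> 'a presented_algebra \<Rightarrow> 'a presented_algebra" is "(*\<^sub>q)"
  by (drule ideal_scale) (simp add: scale_diff_right)
lift_definition part_presented_algebra ::
  "bool \<Rightarrow> 'a presented_algebra \<Rightarrow> 'a presented_algebra" is part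
proof -
  fix p and x y :: "'a free"
  assume "x - y \<in> ideal_gen relators"
  then have "part p (x - y) \<in> ideal_gen relators"
    by (rule ideal_part[rotated]) (simp add: part_free_def relators_homogeneous)
  then show "part p x - part p y \<in> ideal_gen relators" by (simp add: part_diff)
qed

instance
proof
  fix x y z :: "'a presented_algebra" and c d :: cq and p r :: bool
  have e: "u - v \<in> ideal_gen relators" if "u = v" for u v :: "'a free"
    using that by (simp add: ideal_zero)
  show "x + y + z = x + (y + z)" by transfer (rule e, simp add: algebra_simps)
  show "x + y = y + x" by transfer (rule e, simp add: algebra_simps)
  show "0 + x = x" by transfer (rule e, simp)
  show "- x + x = 0" by transfer (rule e, simp)
  show "x - y = x + - y" by transfer (rule e, simp)
  show "x * y * z = x * (y * z)" by transfer (rule e, simp add: mult.assoc)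
  show "(x + y) * z = x * z + y * z" by transfer (rule e, simp add: distrib_right)
  show "x * (y + z) = x * y + x * z" by transfer (rule e, simp add: distrib_left)
  show "1 * x = x" by transfer (rule e, simp)
  show "x * 1 = x" by transfer (rule e, simp)
  show "c *\<^sub>q (x + y) = c *\<^sub>q x + c *\<^sub>q y" by transfer (rule e, rule scale_right_distrib)
  show "(c + d) *\<^sub>q x = c *\<^sub>q x + d *\<^sub>q x" by transfer (rule e, rule scale_left_distrib)
  show "c *\<^sub>q d *\<^sub>q x = (c * d) *\<^sub>q x" by transfer (rule e, rule scale_scale)
  show "1 *\<^sub>q x = x" by transfer (rule e, rule scale_one)
  show "part p (x + y) = part p x + part p y" by transfer (rule e, rule part_add)
  show "part p (c *\<^sub>q x) = c *\<^sub>q part p x" by transfer (rule e, rule part_scale)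
  show "part p (part r x) = (if p = r then part r x else 0)"
    by (cases "p = r") (simp_all, (transfer, rule e, simp add: part_part)+)
  show "part False x + part True x = x" by transfer (rule e, rule part_decompose)
  show "(c *\<^sub>q x) * y = c *\<^sub>q (x * y)" by transfer (rule e, rule scale_mult_left)
  show "x * (c *\<^sub>q y) = c *\<^sub>q (x * y)" by transfer (rule e, rule scale_mult_right)
  show "part False (1 :: 'a presented_algebra) = 1" by transfer (rule e, rule part_one)
  show "part (p \<noteq> r) (part p x * part r y) = part p x * part r y"
    by transfer (rule e, rule part_mult)
qed

end

lift_definition pgen :: "'g::presented \<Rightarrow> 'g presented_algebra" is gen .

section \<open>Tensor products\<close>

text \<open>
  The tensor product is the free vector space on pairs modulo the subspace spanned by the
  bilinearity relations; the arbitrary coefficients \<open>c\<close> below make the inductive set closed under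
  scalars.
\<close>

abbreviation (input) single :: "'k \<Rightarrow> cq \<Rightarrow> 'k \<Rightarrow>\<^sub>0 cq" where
  "single \<equiv> Poly_Mapping.single"

inductive_set bilinearity :: "(('a::qspace \<times> 'b::qspace) \<Rightarrow>\<^sub>0 cq) set" where
  "0 \<in> bilinearity"
| "x \<in> bilinearity \<Longrightarrow> y \<in> bilinearity \<Longrightarrow> x + y \<in> bilinearity"
| "single (a + a', b) c - single (a, b) c - single (a', b) c \<in> bilinearity"
| "single (a, b + b') c - single (a, b) c - single (a, b') c \<in> bilinearity"
| "single (d *\<^sub>q a, b) c - single (a, b) (c * d) \<in> bilinearity"
| "single (a, d *\<^sub>q b) c - single (a, b) (c * d) \<in> bilinearity"

definition pscale :: "cq \<Rightarrow> ('k \<Rightarrow>\<^sub>0 cq) \<Rightarrow> 'k \<Rightarrow>\<^sub>0 cq" where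
  "pscale c x = Poly_Mapping.map ((*) c) x"

lemma lookup_pscale [simp]: "Poly_Mapping.lookup (pscale c x) k = c * Poly_Mapping.lookup x k"
  by (simp add: pscale_def Poly_Mapping.map.rep_eq when_def)

lemma pscale_simps:
  "pscale c (x + y) = pscale c x + pscale c y"
  "pscale c (x - y) = pscale c x - pscale c y"
  "pscale c (single k e) = single k (c * e)"
  "pscale c 0 = 0"
  "pscale (c + d) x = pscale c x + pscale d x"
  "pscale c (pscale d x) = pscale (c * d) x"
  "pscale 1 x = x"
  "pscale (- 1) x = - x"
  by (rule poly_mapping_eqI;
      simp add: lookup_add lookup_minus lookup_single algebra_simps when_def)+

lemma bilinearity_pscale: "x \<in> bilinearity \<Longrightarrow> pscale c x \<in> bilinearity"
  by (induction rule: bilinearity.induct)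
     (auto simp: pscale_simps mult.assoc[symmetric] intro: bilinearity.intros)

lemma bilinearity_minus: "x \<in> bilinearity \<Longrightarrow> - x \<in> bilinearity"
  using bilinearity_pscale[of x "- 1"] by (simp add: pscale_simps)

lemma bilinearity_diff: "x \<in> bilinearity \<Longrightarrow> y \<in> bilinearity \<Longrightarrow> x - y \<in> bilinearity"
  using bilinearity.intros(2)[OF _ bilinearity_minus, of x y] by simp

quotient_type (overloaded) ('a, 'b) tensor =
  "('a::qspace \<times> 'b::qspace) \<Rightarrow>\<^sub>0 cq" / "\<lambda>x y. x - y \<in> bilinearity"
proof (rule equivpI)
  show "reflp (\<lambda>x y. x - y \<in> (bilinearity :: (('a \<times> 'b) \<Rightarrow>\<^sub>0 cq) set))"
    by (rule reflpI) (simp add: bilinearity.intros)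
  show "symp (\<lambda>x y. x - y \<in> (bilinearity :: (('a \<times> 'b) \<Rightarrow>\<^sub>0 cq) set))"
    by (rule sympI, drule bilinearity_minus) simp
  show "transp (\<lambda>x y. x - y \<in> (bilinearity :: (('a \<times> 'b) \<Rightarrow>\<^sub>0 cq) set))"
    by (rule transpI, drule (1) bilinearity.intros(2)) simp
qed

lift_definition tens :: "'a::qspace \<Rightarrow> 'b::qspace \<Rightarrow> ('a, 'b) tensor"  (infixr \<open>\<otimes>\<close> 70) is
  "\<lambda>a b. single (a, b) 1" .

text \<open>
  The linear map on the tensor product induced by a bilinear map \<open>f\<close>; its value on
  \<^term>\<open>a \<otimes> b\<close> is \<^term>\<open>f a b\<close>, see \<open>tlift_tens\<close> below.
\<close>

definition plift :: "('a \<Rightarrow> 'b \<Rightarrow> 'c::qspace) \<Rightarrow> (('a \<times> 'b) \<Rightarrow>\<^sub>0 cq) \<Rightarrow> 'c" where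
  "plift f x = (\<Sum>(a, b)\<in>Poly_Mapping.keys x. Poly_Mapping.lookup x (a, b) *\<^sub>q f a b)"

definition tlift :: "('a::qspace \<Rightarrow> 'b::qspace \<Rightarrow> 'c::qspace) \<Rightarrow> ('a, 'b) tensor \<Rightarrow> 'c" where
  "tlift f z = plift f (rep_tensor z)"

definition qbilinear :: "('a::qspace \<Rightarrow> 'b::qspace \<Rightarrow> 'c::qspace) \<Rightarrow> bool" where
  "qbilinear f \<longleftrightarrow> (\<forall>a. qlinear (f a)) \<and> (\<forall>b. qlinear (\<lambda>a. f a b))"

instantiation tensor :: (qspace, qspace) qspace
begin

lift_definition zero_tensor :: "('a, 'b) tensor" is 0 .
lift_definition plus_tensor :: "('a, 'b) tensor \<Rightarrow> ('a, 'b) tensor \<Rightarrow> ('a, 'b) tensor" is "(+)"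
  by (drule (1) bilinearity.intros(2)) (simp add: algebra_simps)
lift_definition minus_tensor :: "('a, 'b) tensor \<Rightarrow> ('a, 'b) tensor \<Rightarrow> ('a, 'b) tensor" is "(-)"
  by (drule (1) bilinearity_diff) (simp add: algebra_simps)
lift_definition uminus_tensor :: "('a, 'b) tensor \<Rightarrow> ('a, 'b) tensor" is uminus
  by (drule bilinearity_minus) (simp add: algebra_simps)
lift_definition scale_tensor :: "cq \<Rightarrow> ('a, 'b) tensor \<Rightarrow> ('a, 'b) tensor" is pscale
  by (drule bilinearity_pscale) (simp add: pscale_simps)

instance
proof
  fix x y z :: "('a, 'b) tensor" and c d :: cq
  have e: "u - v \<in> bilinearity" if "u = v" for u v :: "('a \<times> 'b) \<Rightarrow>\<^sub>0 cq"
    using that by (simp add: bilinearity.intros)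
  show "x + y + z = x + (y + z)" by transfer (rule e, simp add: algebra_simps)
  show "x + y = y + x" by transfer (rule e, simp add: algebra_simps)
  show "0 + x = x" by transfer (rule e, simp)
  show "- x + x = 0" by transfer (rule e, simp)
  show "x - y = x + - y" by transfer (rule e, simp)
  show "c *\<^sub>q (x + y) = c *\<^sub>q x + c *\<^sub>q y" by transfer (rule e, rule pscale_simps)
  show "(c + d) *\<^sub>q x = c *\<^sub>q x + d *\<^sub>q x" by transfer (rule e, rule pscale_simps)
  show "c *\<^sub>q d *\<^sub>q x = (c * d) *\<^sub>q x" by transfer (rule e, rule pscale_simps)
  show "1 *\<^sub>q x = x" by transfer (rule e, rule pscale_simps)
qed

end

lemma plift_superset:
  assumes "finite A" "Poly_Mapping.keys x \<subseteq> A"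
  shows "plift f x = (\<Sum>k\<in>A. Poly_Mapping.lookup x k *\<^sub>q f (fst k) (snd k))"
  unfolding plift_def case_prod_unfold
  using assms by (intro sum.mono_neutral_cong_left) (auto simp: in_keys_iff)

lemma plift_add: "plift f (x + y) = plift f x + plift f y"
proof -
  let ?A = "Poly_Mapping.keys x \<union> Poly_Mapping.keys y"
  have "Poly_Mapping.keys (x + y) \<subseteq> ?A" by (rule keys_add)
  then show ?thesis
    by (simp add: plift_superset[of ?A] lookup_add scale_left_distrib sum.distrib)
qed

lemma plift_pscale: "plift f (pscale c x) = c *\<^sub>q plift f x"
proof -
  have "Poly_Mapping.keys (pscale c x) \<subseteq> Poly_Mapping.keys x"
    by (auto simp: in_keys_iff)
  then show ?thesis
    by (simp add: plift_superset[of "Poly_Mapping.keys x"] scale_sum scale_scale)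
qed

lemma plift_zero [simp]: "plift f 0 = 0"
  by (simp add: plift_def)

lemma plift_diff: "plift f (x - y) = plift f x - plift f y"
  using plift_add[of f "x - y" y] by (simp add: algebra_simps)

lemma plift_single: "plift f (single (a, b) c) = c *\<^sub>q f a b"
  by (simp add: plift_superset[of "{(a, b)}"])

lemma qbilinear_simps:
  assumes "qbilinear f"
  shows "f (a + a') b = f a b + f a' b" "f a (b + b') = f a b + f a b'"
    "f (c *\<^sub>q a) b = c *\<^sub>q f a b" "f a (c *\<^sub>q b) = c *\<^sub>q f a b"
  using assms by (simp_all add: qbilinear_def qlinear_iff)

lemma plift_bilinearity:
  assumes "qbilinear f" "x \<in> bilinearity"
  shows "plift f x = 0"
  using assms(2)
  by (induction rule: bilinearity.induct)
     (simp_all add: plift_add plift_diff plift_single qbilinear_simps(1,2)[OF assms(1)]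
       qbilinear_simps(3,4)[OF assms(1)] scale_right_distrib scale_scale)

lemma tlift_abs:
  assumes "qbilinear f"
  shows "tlift f (abs_tensor x) = plift f x"
proof -
  have "rep_tensor (abs_tensor x) - x \<in> bilinearity"
    by (rule Quotient3_rep_abs[OF Quotient3_tensor]) (simp add: bilinearity.intros)
  from plift_bilinearity[OF assms this] show ?thesis
    by (simp add: tlift_def plift_diff)
qed

lemma tensor_cases: obtains x where "z = abs_tensor x"
  by (rule that[of "rep_tensor z"]) (simp only: Quotient3_abs_rep[OF Quotient3_tensor])

lemma tlift_add: "qbilinear f \<Longrightarrow> tlift f (x + y) = tlift f x + tlift f y"
  by (cases x rule: tensor_cases, cases y rule: tensor_cases)
     (simp add: tlift_abs plift_add plus_tensor.abs_eq)

lemma tlift_scale: "qbilinear f \<Longrightarrow> tlift f (c *\<^sub>q x) = c *\<^sub>q tlift f x"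
  by (cases x rule: tensor_cases) (simp add: tlift_abs plift_pscale scale_tensor.abs_eq)

lemma tlift_tens: "qbilinear f \<Longrightarrow> tlift f (a \<otimes> b) = f a b"
  by (simp add: tens.abs_eq tlift_abs plift_single scale_one)

lemma tens_add_left: "(a + a') \<otimes> b = a \<otimes> b + a' \<otimes> b"
proof transfer
  fix a a' :: 'a and b :: 'b
  show "single (a + a', b) 1 - (single (a, b) 1 + single (a', b) 1) \<in> bilinearity"
    using bilinearity.intros(3)[of a a' b 1] by (simp add: diff_diff_eq)
qed

lemma tens_add_right: "a \<otimes> (b + b') = a \<otimes> b + a \<otimes> b'"
proof transfer
  fix a :: 'a and b b' :: 'b
  show "single (a, b + b') 1 - (single (a, b) 1 + single (a, b') 1) \<in> bilinearity"
    using bilinearity.intros(4)[of a b b' 1] by (simp add: diff_diff_eq)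
qed

lemma tens_scale_left: "(c *\<^sub>q a) \<otimes> b = c *\<^sub>q (a \<otimes> b)"
proof transfer
  fix a :: 'a and b :: 'b and c
  show "single (c *\<^sub>q a, b) 1 - pscale c (single (a, b) 1) \<in> bilinearity"
    using bilinearity.intros(5)[of c a b 1] by (simp add: pscale_simps)
qed

lemma tens_scale_right: "a \<otimes> (c *\<^sub>q b) = c *\<^sub>q (a \<otimes> b)"
proof transfer
  fix a :: 'a and b :: 'b and c
  show "single (a, c *\<^sub>q b) 1 - pscale c (single (a, b) 1) \<in> bilinearity"
    using bilinearity.intros(6)[of a c b 1] by (simp add: pscale_simps)
qed

lemmas tens_simps = tens_add_left tens_add_right tens_scale_left tens_scale_right

lemma tensor_induct [case_names tens add scale]:
  assumes tens: "\<And>a b. P (a \<otimes> b)"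
    and add: "\<And>x y. P x \<Longrightarrow> P y \<Longrightarrow> P (x + y)"
    and scale: "\<And>c x. P x \<Longrightarrow> P (c *\<^sub>q x)"
  shows "P (z :: ('a::qspace, 'b::qspace) tensor)"
proof -
  have single: "P (abs_tensor (single k v))" for k :: "'a \<times> 'b" and v
  proof -
    have "abs_tensor (single k v) = v *\<^sub>q (fst k \<otimes> snd k)"
      by (simp add: tens.abs_eq scale_tensor.abs_eq pscale_simps)
    then show ?thesis using tens scale by simp
  qed
  have "P (abs_tensor x)" for x :: "('a \<times> 'b) \<Rightarrow>\<^sub>0 cq"
  proof (induction x rule: update_induct)
    case const
    show ?case using single[of undefined 0] by simp
  next
    case (update f k v)
    have "Poly_Mapping.update k v f = f + single k v"
      by (rule poly_mapping_eqI)
         (use update in \<open>auto simp: update.rep_eq lookup_add lookup_single when_def in_keys_iff\<close>)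
    then show ?case using update add single by (simp flip: plus_tensor.abs_eq)
  qed
  then show ?thesis by (cases z rule: tensor_cases) simp
qed

instantiation tensor :: (superspace, superspace) superspace
begin

definition part_tensor :: "bool \<Rightarrow> ('a, 'b) tensor \<Rightarrow> ('a, 'b) tensor" where
  "part p = tlift (\<lambda>a b. part False a \<otimes> part p b + part True a \<otimes> part (\<not> p) b)"

lemma part_tensor_bilinear:
  "qbilinear (\<lambda>a (b::'b). part False (a::'a) \<otimes> part p b + part True a \<otimes> part (\<not> p) b)"
  by (simp add: qbilinear_def qlinear_iff tens_simps part_add part_scale scale_right_distrib)

lemma part_tens:
  "part p ((a::'a) \<otimes> (b::'b)) = part False a \<otimes> part p b + part True a \<otimes> part (\<not> p) b"
  by (simp add: part_tensor_def tlift_tens part_tensor_bilinear)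

instance
proof
  fix x y :: "('a, 'b) tensor" and c and p r :: bool
  show pa: "part p (x + y) = part p x + part p y" for p and x y :: "('a, 'b) tensor"
    by (simp add: part_tensor_def tlift_add part_tensor_bilinear)
  show ps: "part p (c *\<^sub>q x) = c *\<^sub>q part p x" for p c and x :: "('a, 'b) tensor"
    by (simp add: part_tensor_def tlift_scale part_tensor_bilinear)
  have z [simp]: "0 \<otimes> b = 0" "a \<otimes> 0 = 0" for a :: 'a and b :: 'b
    using tens_simps(3)[of 0 0 b] tens_simps(4)[of a 0 0] by simp_all
  show "part p (part r x) = (if p = r then part r x else 0)"
  proof (induction x rule: tensor_induct)
    case (tens a b)
    show ?case by (cases p; cases r) (simp_all add: part_tens pa part_part)
  next
    case (add x y)
    then show ?case by (simp only: pa) simp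
  next
    case (scale c x)
    then show ?case by (simp only: ps) simp
  qed
  show "part False x + part True x = x"
  proof (induction x rule: tensor_induct)
    case (tens a b)
    have "part False (a \<otimes> b) + part True (a \<otimes> b)
        = (part False a + part True a) \<otimes> (part False b + part True b)"
      by (simp add: part_tens tens_simps add_ac)
    then show ?case by (simp add: part_decompose)
  next
    case (add x y)
    have "part False (x + y) + part True (x + y)
        = (part False x + part True x) + (part False y + part True y)"
      by (simp add: pa add_ac)
    then show ?case using add by simp
  next
    case (scale c x)
    have "part False (c *\<^sub>q x) + part True (c *\<^sub>q x) = c *\<^sub>q (part False x + part True x)"
      by (simp only: ps scale_right_distrib)
    then show ?case using scale by simp
  qed
qed

end

lemma tens_zero [simp]: "0 \<otimes> b = 0" "a \<otimes> 0 = 0"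
  using tens_scale_left[of 0 0 b] tens_scale_right[of a 0 0] by simp_all

lemma part_hom: "part u a = a \<Longrightarrow> part p a = (if p = u then a else (0 :: 'a::superspace))"
  by (metis part_part)

lemma part_tens_hom:
  assumes "part u a = a" "part v b = b"
  shows "part p (a \<otimes> b) = (if p = (u \<noteq> v) then a \<otimes> b else 0)"
  unfolding part_tens part_hom[OF assms(1), of True] part_hom[OF assms(1), of False]
    part_hom[OF assms(2), of p] part_hom[OF assms(2), of "\<not> p"]
  by (cases p; cases u; cases v) simp_all

lemma tensor_induct_hom [case_names tens add scale]:
  assumes tens: "\<And>u v a b. part u a = a \<Longrightarrow> part v b = b \<Longrightarrow> P (a \<otimes> b)"
    and add: "\<And>x y. P x \<Longrightarrow> P y \<Longrightarrow> P (x + y)"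
    and scale: "\<And>c x. P x \<Longrightarrow> P (c *\<^sub>q x)"
  shows "P (z :: ('a::superspace, 'b::superspace) tensor)"
proof (induction z rule: tensor_induct)
  case (tens a b)
  have h: "P (part u a \<otimes> part v b)" for u v
    by (rule assms(1)[of u _ v]) (simp_all add: part_part)
  have "a \<otimes> b = (part False a + part True a) \<otimes> (part False b + part True b)"
    by (simp only: part_decompose)
  also have "\<dots> = (part False a \<otimes> part False b + part False a \<otimes> part True b)
      + (part True a \<otimes> part False b + part True a \<otimes> part True b)"
    by (simp only: tens_simps add_ac)
  finally show ?case using h add by simp
qed (use assms in auto)

lemma twist_add: "twist p (x + y) = twist p x + twist p y"
  by (simp add: twist_def part_add scale_right_distrib add_ac)

lemma twist_scale: "twist p (c *\<^sub>q x) = c *\<^sub>q twist p x"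
  by (simp add: twist_def part_scale scale_right_distrib scale_scale mult.commute)

lemma twist_hom: "part u x = x \<Longrightarrow> twist p x = sg (p \<and> u) *\<^sub>q x"
  using part_hom[of u x True] part_hom[of u x False]
  by (cases u; cases p) (simp_all add: twist_def sg_def scale_one)

lemma twist_False: "twist False x = x"
  by (simp add: twist_def sg_def scale_one part_decompose)

lemma mult_hom:
  assumes "part u x = x" "part v y = y"
  shows "part (u \<noteq> v) (x * y) = x * (y :: 'a::superalgebra)"
  using part_mult[of u v x y] unfolding assms .

lemma twist_mult: "twist p (x * y) = twist p x * twist p (y :: 'a::superalgebra)"
proof -
  have h: "twist p (part u x * part v y) = twist p (part u x) * twist p (part v y)" for u v
  proof -
    have U: "part u (part u x) = part u x" and V: "part v (part v y) = part v y"
      by (simp_all add: part_part)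
    have "sg (p \<and> (u \<noteq> v)) = sg (p \<and> u) * sg (p \<and> v)"
      by (simp add: sg_def)
    then show ?thesis
      unfolding twist_hom[OF U] twist_hom[OF V] twist_hom[OF mult_hom[OF U V]]
      by (simp add: scale_mult_left scale_mult_right scale_scale mult.commute)
  qed
  have "twist p (x * y) = twist p ((part False x + part True x) * (part False y + part True y))"
    by (simp add: part_decompose)
  also have "\<dots> = (twist p (part False x) + twist p (part True x))
      * (twist p (part False y) + twist p (part True y))"
    by (simp add: distrib_left distrib_right twist_add h)
  also have "\<dots> = twist p x * twist p y"
    by (simp add: part_decompose flip: twist_add)
  finally show ?thesis .
qed

lemma twist_twist: "twist p (twist r x) = twist (p \<noteq> r) x"
  by (cases p; cases r)
     (simp_all add: twist_def sg_def part_add part_scale part_part scale_scale scale_one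
       part_decompose)

text \<open>
  The product of \<^term>\<open>a \<otimes> b\<close> and \<^term>\<open>a' \<otimes> b'\<close>, with \<open>a'\<close> split into its homogeneous
  components \<^term>\<open>part p a'\<close>, each of which is moved past \<open>b\<close>.
\<close>

definition koszul_mult :: "'a::superalgebra \<Rightarrow> 'b::superalgebra \<Rightarrow> 'a \<Rightarrow> 'b \<Rightarrow> ('a, 'b) tensor" where
  "koszul_mult a b a' b' = (\<Sum>p\<in>UNIV. (a * part p a') \<otimes> (twist p b * b'))"

lemma koszul_mult_hom: "part p a' = a' \<Longrightarrow> koszul_mult a b a' b' = (a * a') \<otimes> (twist p b * b')"
  using part_hom[of p a' True] part_hom[of p a' False]
  by (cases p) (simp_all add: koszul_mult_def UNIV_bool)

lemma koszul_mult_bilinear: "qbilinear (koszul_mult a b)"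
  by (simp add: qbilinear_def qlinear_iff koszul_mult_def UNIV_bool part_add part_scale
      distrib_left scale_mult_right tens_simps scale_right_distrib add_ac)

lemma koszul_mult_bilinear': "qbilinear (\<lambda>a b. tlift (koszul_mult a b) w)"
proof -
  have "tlift (koszul_mult (a + a') b) w = tlift (koszul_mult a b) w + tlift (koszul_mult a' b) w"
    "tlift (koszul_mult a (b + b')) w = tlift (koszul_mult a b) w + tlift (koszul_mult a b') w"
    "tlift (koszul_mult (c *\<^sub>q a) b) w = c *\<^sub>q tlift (koszul_mult a b) w"
    "tlift (koszul_mult a (c *\<^sub>q b)) w = c *\<^sub>q tlift (koszul_mult a b) w" for a a' b b' c
    by (induction w rule: tensor_induct)
       (simp_all add: tlift_add tlift_scale tlift_tens koszul_mult_bilinear koszul_mult_def UNIV_bool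
         twist_add twist_scale distrib_right scale_mult_left tens_simps scale_right_distrib
         add_ac scale_scale mult.commute)
  then show ?thesis by (simp add: qbilinear_def qlinear_iff)
qed

instantiation tensor :: (superalgebra, superalgebra) superalgebra
begin

definition one_tensor :: "('a, 'b) tensor" where
  "1 = 1 \<otimes> 1"

definition times_tensor :: "('a, 'b) tensor \<Rightarrow> ('a, 'b) tensor \<Rightarrow> ('a, 'b) tensor" where
  "z * w = tlift (\<lambda>a b. tlift (koszul_mult a b) w) z"

lemma tens_mult: "(a \<otimes> b) * w = tlift (koszul_mult (a :: 'a) (b :: 'b)) w"
  unfolding times_tensor_def by (rule tlift_tens[OF koszul_mult_bilinear'])

lemma tensor_mult_hom:
  assumes "part p (a' :: 'a) = a'"
  shows "(a \<otimes> b) * (a' \<otimes> b') = (a * a') \<otimes> (twist p b * (b' :: 'b))"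
  by (simp only: tens_mult tlift_tens[OF koszul_mult_bilinear] koszul_mult_hom[OF assms])

lemma tensor_distrib:
  fixes x y z :: "('a, 'b) tensor"
  shows "(x + y) * z = x * z + y * z" "x * (y + z) = x * y + x * z"
    "(c *\<^sub>q x) * z = c *\<^sub>q (x * z)" "x * (c *\<^sub>q z) = c *\<^sub>q (x * z)"
proof -
  show D: "(x + y) * z = x * z + y * z" for x y z :: "('a, 'b) tensor"
    by (simp add: times_tensor_def tlift_add koszul_mult_bilinear')
  show S: "(c *\<^sub>q x) * z = c *\<^sub>q (x * z)" for c and x z :: "('a, 'b) tensor"
    by (simp add: times_tensor_def tlift_scale koszul_mult_bilinear')
  show "x * (y + z) = x * y + x * z"
    by (induction x rule: tensor_induct)
       (simp_all add: D S tens_mult tlift_add koszul_mult_bilinear scale_right_distrib add_ac)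
  show "x * (c *\<^sub>q z) = c *\<^sub>q (x * z)"
    by (induction x rule: tensor_induct)
       (simp_all add: D S tens_mult tlift_scale koszul_mult_bilinear scale_right_distrib scale_scale
         mult.commute)
qed

instance
proof
  fix x y z :: "('a, 'b) tensor" and c :: cq and p r :: bool
  show "(x + y) * z = x * z + y * z" "x * (y + z) = x * y + x * z"
    "(c *\<^sub>q x) * z = c *\<^sub>q (x * z)" "x * (c *\<^sub>q z) = c *\<^sub>q (x * z)"
    by (rule tensor_distrib)+
  have one: "part False (1 :: 'a) = 1" "part False (1 :: 'b) = 1"
    by (rule part_one)+
  have twist_one: "twist p (1 :: 'b) = 1" for p
    using twist_hom[OF one(2), of p] by (simp add: sg_def scale_one)
  show "x * y * z = x * (y * z)"
  proof (induction x rule: tensor_induct_hom)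
    case (tens u v a b)
    show ?case
    proof (induction y rule: tensor_induct_hom)
      case (tens u' v' a' b')
      show ?case
      proof (induction z rule: tensor_induct_hom)
        case (tens u'' v'' a'' b'')
        have "(a \<otimes> b) * (a' \<otimes> b') * (a'' \<otimes> b'')
            = (a * a' * a'') \<otimes> (twist u'' (twist u' b * b') * b'')"
          by (simp add: tensor_mult_hom[OF tens(1)]
              tensor_mult_hom[OF \<open>part u' a' = a'\<close>])
        also have "\<dots> = (a * (a' * a'')) \<otimes> (twist (u' \<noteq> u'') b * (twist u'' b' * b''))"
          by (simp only: twist_mult twist_twist mult.assoc) (simp add: eq_commute)
        also have "\<dots> = (a \<otimes> b) * ((a' \<otimes> b') * (a'' \<otimes> b''))"
          unfolding tensor_mult_hom[OF tens(1)]
            tensor_mult_hom[OF mult_hom[OF \<open>part u' a' = a'\<close> tens(1)]] ..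
        finally show ?case .
      qed (simp_all add: tensor_distrib)
    qed (simp_all add: tensor_distrib)
  qed (simp_all add: tensor_distrib)
  show "1 * x = x"
  proof (induction x rule: tensor_induct_hom)
    case (tens u v a b)
    show ?case by (simp add: one_tensor_def tensor_mult_hom[OF tens(1)] twist_one)
  qed (simp_all add: tensor_distrib)
  show "x * 1 = x"
  proof (induction x rule: tensor_induct_hom)
    case (tens u v a b)
    show ?case by (simp add: one_tensor_def tensor_mult_hom[OF one(1)] twist_False)
  qed (simp_all add: tensor_distrib)
  show "part False (1 :: ('a, 'b) tensor) = 1"
    unfolding one_tensor_def part_tens_hom[OF one] by simp
  show "part (p \<noteq> r) (part p x * part r y) = part p x * part r y"
  proof (induction x rule: tensor_induct_hom)
    case (tens u v a b)
    note x = tens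
    show ?case
    proof (induction y rule: tensor_induct_hom)
      case (tens u' v' a' b')
      have B: "part v (twist u' b) = twist u' b"
        unfolding twist_hom[OF x(2)] part_scale x(2) ..
      have zero: "0 * z = 0" "z * 0 = 0" for z :: "('a, 'b) tensor"
        using tensor_distrib(3)[of 0 0 z] tensor_distrib(4)[of z 0 0] by simp_all
      have h: "part t ((a \<otimes> b) * (a' \<otimes> b'))
          = (if t = ((u \<noteq> u') \<noteq> (v \<noteq> v')) then (a \<otimes> b) * (a' \<otimes> b') else 0)" for t
        unfolding tensor_mult_hom[OF tens(1)]
        by (rule part_tens_hom[OF mult_hom[OF x(1) tens(1)] mult_hom[OF B tens(2)]])
      show ?case
        unfolding part_tens_hom[OF x] part_tens_hom[OF tens] using h[of "p \<noteq> r"]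
        by (cases p; cases r; cases u; cases v; cases u'; cases v') (simp_all add: zero)
    qed (simp_all add: tensor_distrib part_add part_scale)
  qed (simp_all add: tensor_distrib part_add part_scale)
qed

end

section \<open>Linear maps on tensor products\<close>

definition tmap :: "('a::qspace \<Rightarrow> 'c::qspace) \<Rightarrow> ('b::qspace \<Rightarrow> 'd::qspace)
    \<Rightarrow> ('a, 'b) tensor \<Rightarrow> ('c, 'd) tensor" where
  "tmap f g = tlift (\<lambda>a b. f a \<otimes> g b)"

definition tmul :: "('a::superalgebra, 'a) tensor \<Rightarrow> 'a" where
  "tmul = tlift (*)"

definition tassoc :: "(('a::qspace, 'b::qspace) tensor, 'c::qspace) tensor
    \<Rightarrow> ('a, ('b, 'c) tensor) tensor" where
  "tassoc = tlift (\<lambda>z c. tlift (\<lambda>a b. a \<otimes> (b \<otimes> c)) z)"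

definition tassoc_inv :: "('a::qspace, ('b::qspace, 'c::qspace) tensor) tensor
    \<Rightarrow> (('a, 'b) tensor, 'c) tensor" where
  "tassoc_inv = tlift (\<lambda>a z. tlift (\<lambda>b c. (a \<otimes> b) \<otimes> c) z)"

section \<open>Index sets\<close>

text \<open>The index set of size \<open>2N\<close>, where \<open>N\<close> is the cardinality of the type parameter.\<close>

typedef (overloaded) 'n idx = "{i :: int. i \<noteq> 0 \<and> \<bar>i\<bar> \<le> int CARD('n::finite)}"
proof
  have "CARD('n) \<ge> 1" by (simp add: Suc_leI)
  then show "(1 :: int) \<in> {i. i \<noteq> 0 \<and> \<bar>i\<bar> \<le> int CARD('n)}" by simp
qed

setup_lifting type_definition_idx

instantiation idx :: (finite) "{linorder, uminus, graded, finite}"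
begin

lift_definition uminus_idx :: "'a idx \<Rightarrow> 'a idx" is uminus by simp
lift_definition less_eq_idx :: "'a idx \<Rightarrow> 'a idx \<Rightarrow> bool" is "(\<le>)" .
lift_definition less_idx :: "'a idx \<Rightarrow> 'a idx \<Rightarrow> bool" is "(<)" .
lift_definition par_idx :: "'a idx \<Rightarrow> bool" is "\<lambda>i. i < 0" .

instance
proof
  fix x y z :: "'a idx"
  show "(x < y) = (x \<le> y \<and> \<not> y \<le> x)" by transfer auto
  show "x \<le> x" by transfer simp
  show "x \<le> y \<Longrightarrow> y \<le> z \<Longrightarrow> x \<le> z" by transfer simp
  show "x \<le> y \<Longrightarrow> y \<le> x \<Longrightarrow> x = y" by transfer simp
  show "x \<le> y \<or> y \<le> x" by transfer auto
  have "{i :: int. i \<noteq> 0 \<and> \<bar>i\<bar> \<le> int CARD('a)} \<subseteq> {- int CARD('a)..int CARD('a)}" by auto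
  then have "finite {i :: int. i \<noteq> 0 \<and> \<bar>i\<bar> \<le> int CARD('a)}" by (rule finite_subset) simp
  then have "finite (Abs_idx ` {i :: int. i \<noteq> 0 \<and> \<bar>i\<bar> \<le> int CARD('a)} :: 'a idx set)"
    by (rule finite_imageI)
  then show "finite (UNIV :: 'a idx set)"
    unfolding type_definition.univ[OF type_definition_idx] .
qed

end

lemma par_uminus_idx: "par (- i) = (\<not> par (i :: 'n::finite idx))"
  by transfer auto

section \<open>Matrices over a superalgebra\<close>

text \<open>
  An element of the tensor product of two (possibly rectangular) matrix spaces and a superalgebra
  is given by its entries: \<open>M i j k l\<close> is the coefficient of \<open>E\<^sub>i\<^sub>j\<close> in the first and \<open>E\<^sub>k\<^sub>l\<close> in the second
  matrix factor. The superalgebra may be the first, second or third tensor factor; in each case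
  the Koszul rule determines the product.
\<close>

type_synonym ('i, 'j, 'k, 'l, 'a) mat2 = "'i \<Rightarrow> 'j \<Rightarrow> 'k \<Rightarrow> 'l \<Rightarrow> 'a"

definition epar :: "'i::graded \<Rightarrow> 'j::graded \<Rightarrow> bool" where
  "epar i j \<longleftrightarrow> par i \<noteq> par j"

lemma epar_same: "epar i i = False"
  by (simp add: epar_def)

definition mat_mult1 :: "('i::graded, 'j::{graded, finite}, 'k::graded, 'l::{graded, finite}, 'a) mat2
    \<Rightarrow> ('j, 'm::graded, 'l, 'p::graded, 'a) mat2 \<Rightarrow> ('i, 'm, 'k, 'p, 'a::superalgebra) mat2"
    (infixl \<open>\<cdot>\<^sub>1\<close> 70) where
  "(M \<cdot>\<^sub>1 N) i m k p = (\<Sum>j\<in>UNIV. \<Sum>l\<in>UNIV.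
     sg (epar k l \<and> epar j m) *\<^sub>q (M i j k l * twist (epar i j \<noteq> epar k l) (N j m l p)))"

definition mat_mult2 :: "('i::graded, 'j::{graded, finite}, 'k::graded, 'l::{graded, finite}, 'a) mat2
    \<Rightarrow> ('j, 'm::graded, 'l, 'p::graded, 'a) mat2 \<Rightarrow> ('i, 'm, 'k, 'p, 'a::superalgebra) mat2"
    (infixl \<open>\<cdot>\<^sub>2\<close> 70) where
  "(M \<cdot>\<^sub>2 N) i m k p = (\<Sum>j\<in>UNIV. \<Sum>l\<in>UNIV.
     sg (epar k l \<and> epar j m) *\<^sub>q (twist (epar j m) (M i j k l) * twist (epar k l) (N j m l p)))"

definition mat_mult3 :: "('i::graded, 'j::{graded, finite}, 'k::graded, 'l::{graded, finite}, 'a) mat2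
    \<Rightarrow> ('j, 'm::graded, 'l, 'p::graded, 'a) mat2 \<Rightarrow> ('i, 'm, 'k, 'p, 'a::superalgebra) mat2"
    (infixl \<open>\<cdot>\<^sub>3\<close> 70) where
  "(M \<cdot>\<^sub>3 N) i m k p = (\<Sum>j\<in>UNIV. \<Sum>l\<in>UNIV.
     sg (epar k l \<and> epar j m) *\<^sub>q (twist (epar j m \<noteq> epar l p) (M i j k l) * N j m l p))"

text \<open>A single matrix placed in the first, respectively second, matrix factor.\<close>

definition fst_mat :: "('i \<Rightarrow> 'j \<Rightarrow> 'a::zero) \<Rightarrow> ('i, 'j, 'k, 'k, 'a) mat2" where
  "fst_mat M i j k l = (if k = l then M i j else 0)"

definition snd_mat :: "('k \<Rightarrow> 'l \<Rightarrow> 'a::zero) \<Rightarrow> ('i, 'i, 'k, 'l, 'a) mat2" where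
  "snd_mat M i j k l = (if i = j then M k l else 0)"

definition scalar_mat :: "('i, 'j, 'k, 'l, cq) mat2 \<Rightarrow> ('i, 'j, 'k, 'l, 'a::superalgebra) mat2" where
  "scalar_mat M i j k l = M i j k l *\<^sub>q 1"

definition matrix_unit :: "'i \<Rightarrow> 'j \<Rightarrow> 'i \<Rightarrow> 'j \<Rightarrow> cq" where
  "matrix_unit i j a b = of_bool (a = i \<and> b = j)"

definition phi :: "'n::finite idx \<Rightarrow> 'n idx \<Rightarrow> int" where
  "phi i j = (if par j then - 1 else 1) * (of_bool (i = j) + of_bool (i = - j))"

definition S_mat :: "('n::finite idx, 'n idx, 'n idx, 'n idx, cq) mat2" where
  "S_mat a b c d =
     (\<Sum>i\<in>UNIV. \<Sum>j\<in>UNIV. q powi phi i j * (matrix_unit i i a b * matrix_unit j j c d))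
     + \<xi> * (\<Sum>(i, j) | i < j. sg (par i) *
         ((matrix_unit j i a b + matrix_unit (- j) (- i) a b) * matrix_unit i j c d))"

definition S_inv_mat :: "('n::finite idx, 'n idx, 'n idx, 'n idx, cq) mat2" where
  "S_inv_mat a b c d =
     (\<Sum>i\<in>UNIV. \<Sum>j\<in>UNIV. q powi (- phi i j) * (matrix_unit i i a b * matrix_unit j j c d))
     - \<xi> * (\<Sum>(i, j) | i < j. sg (par i) *
         ((matrix_unit j i a b + matrix_unit (- j) (- i) a b) * matrix_unit i j c d))"

definition even_mat ::
  "('i::graded, 'j::graded, 'k::graded, 'l::graded, 'a::superspace) mat2 \<Rightarrow> bool" where
  "even_mat M \<longleftrightarrow> (\<forall>i j k l. part (epar i j \<noteq> epar k l) (M i j k l) = M i j k l)"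

lemma part_twist: "part p (twist r x) = twist r (part p x)"
  by (simp add: twist_def part_add part_scale part_part)

lemma even_mat_mult3:
  assumes "even_mat M" "even_mat N"
  shows "even_mat (M \<cdot>\<^sub>3 N)"
  unfolding even_mat_def
proof (intro allI)
  fix i m k p
  have "part (epar i m \<noteq> epar k p) (twist t (M i j k l) * N j m l p) = twist t (M i j k l) * N j m l p"
    for j l t
  proof -
    have M: "part (epar i j \<noteq> epar k l) (twist t (M i j k l)) = twist t (M i j k l)"
      and N: "part (epar j m \<noteq> epar l p) (N j m l p) = N j m l p"
      using assms by (simp_all add: even_mat_def part_twist)
    have "(epar i m \<noteq> epar k p) = ((epar i j \<noteq> epar k l) \<noteq> (epar j m \<noteq> epar l p))"
      unfolding epar_def by argo
    then show ?thesis using mult_hom[OF M N] by (simp only:)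
  qed
  then show "part (epar i m \<noteq> epar k p) ((M \<cdot>\<^sub>3 N) i m k p) = (M \<cdot>\<^sub>3 N) i m k p"
    by (simp add: mat_mult3_def part_sum part_scale)
qed

lemma even_mat_mult1:
  assumes "even_mat M" "even_mat N"
  shows "even_mat (M \<cdot>\<^sub>1 N)"
  unfolding even_mat_def
proof (intro allI)
  fix i m k p
  have "part (epar i m \<noteq> epar k p) (M i j k l * twist t (N j m l p)) = M i j k l * twist t (N j m l p)"
    for j l t
  proof -
    have M: "part (epar i j \<noteq> epar k l) (M i j k l) = M i j k l"
      and N: "part (epar j m \<noteq> epar l p) (twist t (N j m l p)) = twist t (N j m l p)"
      using assms by (simp_all add: even_mat_def part_twist)
    have "(epar i m \<noteq> epar k p) = ((epar i j \<noteq> epar k l) \<noteq> (epar j m \<noteq> epar l p))"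
      unfolding epar_def by argo
    then show ?thesis using mult_hom[OF M N] by (simp only:)
  qed
  then show "part (epar i m \<noteq> epar k p) ((M \<cdot>\<^sub>1 N) i m k p) = (M \<cdot>\<^sub>1 N) i m k p"
    by (simp add: mat_mult1_def part_sum part_scale)
qed

lemma even_fst_mat: "(\<And>i j. part (epar i j) (M i j) = M i j) \<Longrightarrow> even_mat (fst_mat M)"
  and even_snd_mat: "(\<And>i j. part (epar i j) (M i j) = M i j) \<Longrightarrow> even_mat (snd_mat M)"
  by (simp_all add: even_mat_def fst_mat_def snd_mat_def epar_same)

lemma even_S_mat: "even_mat (scalar_mat (S_mat :: ('n::finite idx, _, _, _, cq) mat2))"
proof -
  have "S_mat a b c d = 0" if "epar a b \<noteq> epar c d" for a b c d :: "'n idx"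
  proof -
    have 1: "matrix_unit i i a b * matrix_unit j j c d = 0" for i j
      using that by (auto simp: matrix_unit_def epar_def)
    have 2: "matrix_unit j i a b * matrix_unit i j c d = 0" for i j
      using that by (auto simp: matrix_unit_def epar_def)
    have 3: "matrix_unit (- j) (- i) a b * matrix_unit i j c d = 0" for i j
      using that by (auto simp: matrix_unit_def epar_def par_uminus_idx)
    show ?thesis
      unfolding S_mat_def distrib_right 1 2 3 by simp
  qed
  then have nz: "epar a b = epar c d" if "S_mat a b c d \<noteq> 0" for a b c d :: "'n idx"
    using that by blast
  have "part (epar a b \<noteq> epar c d) (S_mat a b c d *\<^sub>q (1 :: 'a::superalgebra)) = S_mat a b c d *\<^sub>q 1"
    for a b c d :: "'n idx"
  proof (cases "S_mat a b c d = 0")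
    case False
    show ?thesis unfolding nz[OF False] by (simp add: part_scale part_one)
  qed simp
  then show ?thesis by (simp add: even_mat_def scalar_mat_def)
qed

section \<open>The quantum queer superalgebra\<close>

datatype 'n lgen = Lgen "'n idx" "'n idx"

definition L_free :: "'n::finite idx \<Rightarrow> 'n idx \<Rightarrow> 'n lgen free" where
  "L_free i j = gen (Lgen i j)"

instantiation lgen :: (finite) graded
begin
primrec par_lgen :: "'a lgen \<Rightarrow> bool" where
  "par (Lgen i j) = epar i j"
instance ..
end

lemma part_L_free: "part (epar i j) (L_free i j) = L_free i j"
  using part_gen[of "Lgen i j"] unfolding L_free_def par_lgen.simps .

text \<open>\<open>L\<close> has an entry for each pair of indices; those below the diagonal are relators.\<close>

instantiation lgen :: (finite) presented
begin

definition relators_lgen :: "'a lgen free set" where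
  "relators =
     {L_free i j | i j. j < i}
     \<union> {L_free i i * L_free (- i) (- i) - 1 | i. True}
     \<union> {(fst_mat L_free \<cdot>\<^sub>1 snd_mat L_free \<cdot>\<^sub>1 scalar_mat S_mat) i j k l
         - (scalar_mat S_mat \<cdot>\<^sub>1 snd_mat L_free \<cdot>\<^sub>1 fst_mat L_free) i j k l | i j k l. True}"

instance
proof
  fix r :: "'a lgen free"
  assume "r \<in> relators"
  then have "\<exists>p. part p r = r"
    unfolding relators_lgen_def
  proof (elim UnE CollectE exE conjE)
    fix i j :: "'a idx"
    assume "r = L_free i j"
    then show ?thesis using part_L_free by blast
  next
    fix i :: "'a idx"
    assume r: "r = L_free i i * L_free (- i) (- i) - 1"
    have e: "part False (L_free i i) = L_free i i" for i :: "'a idx"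
      using part_L_free[of i i] by (simp add: epar_def)
    have "part False r = r"
      unfolding r using mult_hom[OF e e, of i "- i"] by (simp add: part_diff part_one)
    then show ?thesis ..
  next
    fix i j k l :: "'a idx"
    assume r: "r = (fst_mat L_free \<cdot>\<^sub>1 snd_mat L_free \<cdot>\<^sub>1 scalar_mat S_mat) i j k l
         - (scalar_mat S_mat \<cdot>\<^sub>1 snd_mat L_free \<cdot>\<^sub>1 fst_mat L_free) i j k l"
    have "even_mat (fst_mat L_free \<cdot>\<^sub>1 snd_mat L_free \<cdot>\<^sub>1 scalar_mat S_mat :: (_, _, _, _, 'a lgen free) mat2)"
      "even_mat (scalar_mat S_mat \<cdot>\<^sub>1 snd_mat L_free \<cdot>\<^sub>1 fst_mat L_free :: (_, _, _, _, 'a lgen free) mat2)"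
      by (intro even_mat_mult1 even_fst_mat even_snd_mat even_S_mat part_L_free)+
    then have "part (epar i j \<noteq> epar k l) r = r"
      unfolding r by (simp add: even_mat_def part_diff)
    then show ?thesis ..
  qed
  then show "\<exists>p. free_part par p r = r" by (simp add: part_free_def)
qed

end

type_synonym 'n uq = "'n lgen presented_algebra"

definition L_gen :: "'n::finite idx \<Rightarrow> 'n idx \<Rightarrow> 'n uq" where
  "L_gen i j = pgen (Lgen i j)"

text \<open>
  The coproduct and the counit, and the action \<open>Phi_bar\<close> below, are the unique maps with the
  stated properties; that they exist is not proved in this theory.
\<close>

definition coproduct :: "'n::finite uq \<Rightarrow> ('n uq, 'n uq) tensor" where
  "coproduct = (THE D. superalg_hom D \<and>
     (\<forall>i j. D (L_gen i j) = (\<Sum>k\<in>UNIV. sg (epar i k \<and> epar k j) *\<^sub>q (L_gen i k \<otimes> L_gen k j))))"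

definition counit :: "'n::finite uq \<Rightarrow> cq" where
  "counit = (THE e. Vector_Spaces.linear scale (*) e \<and> (\<forall>u. e (part True u) = 0) \<and>
     e 1 = 1 \<and> (\<forall>u v. e (u * v) = e u * e v) \<and>
     (\<forall>i j. e (L_gen i j) = of_bool (i = j)))"

section \<open>Supermodules\<close>

definition supermodule :: "('u::superalgebra \<Rightarrow> 'v::superspace \<Rightarrow> 'v) \<Rightarrow> bool" where
  "supermodule act \<longleftrightarrow> qbilinear act \<and>
     (\<forall>v. act 1 v = v) \<and>
     (\<forall>u w v. act (u * w) v = act u (act w v)) \<and>
     (\<forall>p r u v. part (p \<noteq> r) (act (part p u) (part r v)) = act (part p u) (part r v))"

definition supermodule_hom ::
  "('u::superalgebra \<Rightarrow> 'v::superspace \<Rightarrow> 'v) \<Rightarrow> ('u \<Rightarrow> 'w::superspace \<Rightarrow> 'w) \<Rightarrow> ('v \<Rightarrow> 'w) \<Rightarrow> bool"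
where
  "supermodule_hom act act' f \<longleftrightarrow>
     qlinear f \<and> even_map f \<and> (\<forall>u v. f (act u v) = act' u (f v))"

text \<open>
  The action of \<^term>\<open>u \<otimes> u'\<close> on \<^term>\<open>v \<otimes> w\<close>, with \<open>v\<close> split into its homogeneous components,
  each of which is passed by \<open>u'\<close>; then the action of the quantum superalgebra through the
  coproduct.
\<close>

definition tensor_act ::
  "('u::superspace \<Rightarrow> 'v::superspace \<Rightarrow> 'v) \<Rightarrow> ('u'::superspace \<Rightarrow> 'w::superspace \<Rightarrow> 'w)
    \<Rightarrow> ('u, 'u') tensor \<Rightarrow> ('v, 'w) tensor \<Rightarrow> ('v, 'w) tensor" where
  "tensor_act act act' z t = tlift (\<lambda>u u'.
     tlift (\<lambda>v w. \<Sum>p\<in>UNIV. act u (part p v) \<otimes> act' (twist p u') w) t) z"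

definition uq_tensor ::
  "('n::finite uq \<Rightarrow> 'v::superspace \<Rightarrow> 'v) \<Rightarrow> ('n uq \<Rightarrow> 'w::superspace \<Rightarrow> 'w)
    \<Rightarrow> 'n uq \<Rightarrow> ('v, 'w) tensor \<Rightarrow> ('v, 'w) tensor" where
  "uq_tensor act act' u = tensor_act act act' (coproduct u)"

definition uq_supermodule_superalgebra ::
  "('n::finite uq \<Rightarrow> 'b::superalgebra \<Rightarrow> 'b) \<Rightarrow> bool" where
  "uq_supermodule_superalgebra act \<longleftrightarrow> supermodule act \<and>
     (\<forall>u z. act u (tmul z) = tmul (uq_tensor act act u z)) \<and>
     (\<forall>u. act u 1 = counit u *\<^sub>q 1)"

section \<open>The dual quantum coordinate superalgebra\<close>

datatype ('s, 'n) tgen = Tgen "'s idx" "'n idx"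

instantiation tgen :: (finite, finite) graded
begin
primrec par_tgen :: "('a, 'b) tgen \<Rightarrow> bool" where
  "par (Tgen \<alpha> b) = epar \<alpha> b"
instance ..
end

definition T_free :: "'n::finite idx \<Rightarrow> 's::finite idx \<Rightarrow> ('s, 'n) tgen free" where
  "T_free b \<alpha> = sg (par b \<and> epar \<alpha> b) *\<^sub>q gen (Tgen \<alpha> b)"

lemma part_T_free: "part (epar b \<alpha>) (T_free b \<alpha>) = T_free b \<alpha>"
proof -
  have e: "epar b \<alpha> = par (Tgen \<alpha> b)" by (auto simp: epar_def)
  show ?thesis unfolding T_free_def part_scale e part_gen ..
qed

instantiation tgen :: (finite, finite) presented
begin

definition relators_tgen :: "('a, 'b) tgen free set" where
  "relators =
     {gen (Tgen \<alpha> b) - sg (epar \<alpha> b) *\<^sub>q gen (Tgen (- \<alpha>) (- b)) | \<alpha> b. True}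
     \<union> {(fst_mat T_free \<cdot>\<^sub>3 snd_mat T_free \<cdot>\<^sub>3 scalar_mat S_mat) i j k l
         - (scalar_mat S_mat \<cdot>\<^sub>3 snd_mat T_free \<cdot>\<^sub>3 fst_mat T_free) i j k l | i j k l. True}"

instance
proof
  fix r :: "('a, 'b) tgen free"
  assume "r \<in> relators"
  then have "\<exists>p. part p r = r"
    unfolding relators_tgen_def
  proof (elim UnE CollectE exE conjE)
    fix \<alpha> :: "'a idx" and b :: "'b idx"
    assume r: "r = gen (Tgen \<alpha> b) - sg (epar \<alpha> b) *\<^sub>q gen (Tgen (- \<alpha>) (- b))"
    have "epar (- \<alpha>) (- b) = epar \<alpha> b" by (auto simp: epar_def par_uminus_idx)
    then have "part (epar \<alpha> b) r = r"
      unfolding r using part_gen[of "Tgen \<alpha> b"] part_gen[of "Tgen (- \<alpha>) (- b)"]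
      by (simp add: part_diff part_scale)
    then show ?thesis ..
  next
    fix i k :: "'b idx" and j l :: "'a idx"
    assume r: "r = (fst_mat T_free \<cdot>\<^sub>3 snd_mat T_free \<cdot>\<^sub>3 scalar_mat S_mat) i j k l
         - (scalar_mat S_mat \<cdot>\<^sub>3 snd_mat T_free \<cdot>\<^sub>3 fst_mat T_free) i j k l"
    have "even_mat (fst_mat T_free \<cdot>\<^sub>3 snd_mat T_free \<cdot>\<^sub>3 scalar_mat S_mat :: (_, _, _, _, ('a, 'b) tgen free) mat2)"
      "even_mat (scalar_mat S_mat \<cdot>\<^sub>3 snd_mat T_free \<cdot>\<^sub>3 fst_mat T_free :: (_, _, _, _, ('a, 'b) tgen free) mat2)"
      by (intro even_mat_mult3 even_fst_mat even_snd_mat even_S_mat part_T_free)+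
    then have "part (epar i j \<noteq> epar k l) r = r"
      unfolding r by (simp add: even_mat_def part_diff)
    then show ?thesis ..
  qed
  then show "\<exists>p. free_part par p r = r" by (simp add: part_free_def)
qed

end

type_synonym ('s, 'n) abar = "('s, 'n) tgen presented_algebra"

definition t_gen :: "'s::finite idx \<Rightarrow> 'n::finite idx \<Rightarrow> ('s, 'n) abar" where
  "t_gen \<alpha> b = pgen (Tgen \<alpha> b)"

definition T_mat :: "'n::finite idx \<Rightarrow> 's::finite idx \<Rightarrow> ('s, 'n) abar" where
  "T_mat b \<alpha> = sg (par b \<and> epar \<alpha> b) *\<^sub>q t_gen \<alpha> b"

text \<open>
  The action of the quantum queer superalgebra: the left-hand side is the coefficient of
  \<open>E\<^sub>c\<^sub>\<alpha>\<close> in the first and \<open>E\<^sub>a\<^sub>b\<close> in the third tensor factor.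
\<close>

definition Phi_bar :: "'n::finite uq \<Rightarrow> ('s::finite, 'n) abar \<Rightarrow> ('s, 'n) abar" where
  "Phi_bar = (THE act. uq_supermodule_superalgebra act \<and>
     (\<forall>c \<alpha> a b. act (L_gen a b) (twist (epar a b) (T_mat c \<alpha>)) =
        (scalar_mat S_inv_mat \<cdot>\<^sub>2 fst_mat T_mat) c \<alpha> a b))"

text \<open>
  The matrix \<open>T\<^sub>s\<close> whose columns are the negative indices only. It carries no signs, because
  \<open>(-1)^(|b|(|\<alpha>|+|b|)) = 1\<close> if \<open>\<alpha>\<close> is odd.
\<close>

definition T_neg :: "'n::finite idx \<Rightarrow> 's::finite idx \<Rightarrow> ('s, 'n) abar" where
  "T_neg b \<alpha> = (if par \<alpha> then t_gen \<alpha> b else 0)"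

end

(*
  After a normalisation of signs all Koszul signs disappear and the R-matrix S becomes a single
  crossing operator C on functions of two indices. It satisfies the Hecke relation, so it is
  invertible, and the braid relation. The latter is trivial on positive indices; it extends to all
  indices because C intertwines the odd endomorphisms of the two strands, as in the Hecke-Clifford
  algebra. The same argument reduces the defining relations of the coordinate superalgebra to
  those between negative columns.

  By the braid relation an index strand can be moved past the coordinate superalgebra B, with C or
  with its inverse; this gives two superalgebra homomorphisms from B to matrices over B. The
  inverse crossing yields the action of the quantum queer superalgebra, hence the existence of
  Phi_bar. The crossing C yields operators on the tensor product of B and A, indexed by the
  generators of A, which by the braid relation again satisfy the relations of A; applying the
  resulting action of y in A to x (x) 1 defines the braiding of y (x) x. Both hexagon identities say
  that this action is compatible with multiplication, and equivariance is the braid relation with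
  one inverse crossing. Uniqueness holds because the hexagon identities determine the map from
  its values on generators.
*)
theory Submission
  imports Defs
begin

section \<open>Superspaces and superalgebras\<close>

text \<open>A generator \<open>t_gen \<alpha> b\<close> with \<alpha> odd has parity opposite to
  that of \<open>b\<close>. Hence a strand of index \<open>i\<close> counts as having parity 1 +
  |i|, and \<open>cross\<close> is the component formula for the braiding, with its sign
  (-1)^((|a|+1)(|b|+1)). The Hecke relation reads (C + q)(C - q^-1) = 0, so that C^-1 = C + \<xi>. A
  direct check of the braid relation on all triples would have to compare i, j, k and their
  opposites. C carries the odd endomorphism of the right strand to the left one, C^-1 carries that
  of the left strand to the right one; conjugation by crossings therefore has to be combined with
  the rule D C2 = - C1^-1 D for the defect D of the braid relation, which follows from the Hecke
  relation alone. The two kinds of strand are both needed: C^-1 is triangular, as the matrix L must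
  be, whereas C gives the required values on generators. This is why equivariance mixes the two. The
  operator of y is left multiplication by 1 \<otimes> y in the braided tensor product of B and A,
  and the hexagon on A \<otimes> B \<otimes> B is an associativity law in it.\<close>

lemma qlinearI:
  "(\<And>x y. f (x + y) = f x + f y) \<Longrightarrow> (\<And>c x. f (c *\<^sub>q x) = c *\<^sub>q f x) \<Longrightarrow> qlinear f"
  by (simp add: qlinear_iff)

lemma qlinear_simps:
  assumes "qlinear f"
  shows "f (x + y) = f x + f y" "f (c *\<^sub>q x) = c *\<^sub>q f x" "f 0 = 0"
    "f (- x) = - f x" "f (x - y) = f x - f y" "f (sum g A) = (\<Sum>a\<in>A. f (g a))"
proof -
  show add: "f (x + y) = f x + f y" for x y using assms by (simp add: qlinear_iff)
  show sc: "f (c *\<^sub>q x) = c *\<^sub>q f x" for c x using assms by (simp add: qlinear_iff)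
  show zero: "f 0 = 0" using sc[of 0 0] by simp
  show "f (- x) = - f x" for x
    using sc[of "- 1" x] by (simp add: scale_minus_left scale_one)
  then show "f (x - y) = f x - f y" using add[of x "- y"] by simp
  show "f (sum g A) = (\<Sum>a\<in>A. f (g a))"
    by (induction A rule: infinite_finite_induct) (simp_all add: zero add)
qed

lemma qlinear_compose: "qlinear f \<Longrightarrow> qlinear g \<Longrightarrow> qlinear (\<lambda>x. f (g x))"
  by (simp add: qlinear_iff)

lemma qlinear_id: "qlinear (\<lambda>x. x)" "qlinear id"
  by (simp_all add: qlinear_iff)

lemma qlinear_sum: "(\<And>a. a \<in> A \<Longrightarrow> qlinear (f a)) \<Longrightarrow> qlinear (\<lambda>x. \<Sum>a\<in>A. f a x)"
  by (simp add: qlinear_iff sum.distrib scale_sum)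

lemma qlinear_scale: "qlinear f \<Longrightarrow> qlinear (\<lambda>x. c *\<^sub>q f x)"
  by (simp add: qlinear_iff scale_right_distrib scale_scale mult.commute)

lemma qlinear_twist: "qlinear (twist p)"
  by (simp add: qlinear_iff twist_add twist_scale)

lemma qlinear_part: "qlinear (part p)"
  by (simp add: qlinear_iff part_add part_scale)

lemma qlinear_mult_left: "qlinear (\<lambda>x. (a :: 'a::superalgebra) * x)"
  by (simp add: qlinear_iff distrib_left scale_mult_right)

lemma qlinear_mult_right: "qlinear (\<lambda>x. x * (a :: 'a::superalgebra))"
  by (simp add: qlinear_iff distrib_right scale_mult_left)

lemma qlinear_tens_left: "qlinear (\<lambda>x. x \<otimes> b)" and qlinear_tens_right: "qlinear (\<lambda>x. a \<otimes> x)"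
  by (simp_all add: qlinear_iff tens_simps)

lemmas twist_simps = qlinear_simps[OF qlinear_twist]
lemmas part_simps = qlinear_simps[OF qlinear_part]
lemmas mult_right_simps = qlinear_simps[OF qlinear_mult_right]
lemmas tens_left_simps = qlinear_simps[OF qlinear_tens_left]
lemmas tens_right_simps = qlinear_simps[OF qlinear_tens_right]

lemma qbilinearI:
  "(\<And>a. qlinear (f a)) \<Longrightarrow> (\<And>b. qlinear (\<lambda>a. f a b)) \<Longrightarrow> qbilinear f"
  by (simp add: qbilinear_def)

lemma qlinear_tlift: "qbilinear f \<Longrightarrow> qlinear (tlift f)"
  by (simp add: qlinear_iff tlift_add tlift_scale)

lemma sg_simps [simp]: "sg True = - 1" "sg False = 1"
  by (simp_all add: sg_def)

lemma sg_mult: "sg p * sg r = sg (p \<noteq> r)"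
  by (simp add: sg_def)

lemma sg_square [simp]: "sg p * sg p = 1" "sg p * (sg p * c) = c"
  by (simp_all add: sg_def)

lemma scale_sg_cancel [simp]: "sg p *\<^sub>q sg p *\<^sub>q x = (x :: 'a::qspace)"
  by (simp add: scale_scale scale_one)

lemma twist_twist_same [simp]: "twist p (twist p x) = x"
  by (simp add: twist_twist twist_False)

lemma twist_one: "twist p (1 :: 'a::superalgebra) = 1"
  using twist_hom[OF part_one, of p] by (simp add: scale_one)

lemma twist_tens: "twist p (x \<otimes> y) = twist p x \<otimes> twist p y"
proof (cases p)
  case True
  then show ?thesis
    by (simp add: twist_def part_tens tens_simps scale_one scale_minus_left
       tens_left_simps tens_right_simps)
qed (simp add: twist_False)

lemma even_mapD: "even_map f \<Longrightarrow> f (part p x) = part p (f x)"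
  by (simp add: even_map_def)

lemma even_map_twist: "even_map f \<Longrightarrow> qlinear f \<Longrightarrow> f (twist p x) = twist p (f x)"
  by (simp add: twist_def even_map_def qlinear_simps)

lemma part_mult_hom_left:
  assumes "part u a = (a :: 'a::superalgebra)"
  shows "part p (a * x) = a * part (p \<noteq> u) x"
proof -
  have "part p (a * part r x) = (if p = (u \<noteq> r) then a * part r x else 0)" for r
    using part_mult_eq[of p u a r x] unfolding assms .
  then have "part p (a * (part False x + part True x)) = a * part (p \<noteq> u) x"
    by (cases p; cases u) (simp_all add: distrib_left part_add)
  then show ?thesis by (simp only: part_decompose)
qed

lemma superalg_homD:
  assumes "superalg_hom f"
  shows "qlinear f" "even_map f" "f 1 = 1" "f (x * y) = f x * f y"
  using assms by (simp_all add: superalg_hom_def)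

section \<open>Universal property of presented superalgebras\<close>

lift_definition free_word :: "'g word \<Rightarrow> 'g free" is "\<lambda>w. Poly_Mapping.single w 1" .

lemma free_word_mult: "free_word v * free_word w = (free_word (v + w) :: 'g::graded free)"
  by transfer (simp add: mult_single)

lemma free_word_zero: "free_word 0 = (1 :: 'g::graded free)"
  by transfer (simp only: single_one)

lemma gen_eq_free_word: "gen g = free_word (Word [g])"
  by transfer simp

lemma free_word_induct:
  assumes word: "\<And>w. P (free_word w)"
    and add: "\<And>x y. P x \<Longrightarrow> P y \<Longrightarrow> P (x + y)"
    and scale: "\<And>c x. P x \<Longrightarrow> P (c *\<^sub>q x)"
  shows "P (x :: 'g::graded free)"
proof -
  have single: "P (Abs_free (single k v))" for k :: "'g word" and v
  proof -
    have "Abs_free (single k v) = v *\<^sub>q free_word k"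
      by (simp add: free_word.abs_eq scale_free.abs_eq pscale_simps flip: pscale_def)
    then show ?thesis using word scale by simp
  qed
  have "P (Abs_free x)" for x
  proof (induction x rule: update_induct)
    case const
    show ?case using single[of undefined 0] by simp
  next
    case (update f k v)
    have "Poly_Mapping.update k v f = f + single k v"
      by (rule poly_mapping_eqI)
         (use update in \<open>auto simp: update.rep_eq lookup_add lookup_single when_def in_keys_iff\<close>)
    then show ?case using update add single by (simp flip: plus_free.abs_eq)
  qed
  then show ?thesis by (cases x) simp
qed

lemma free_induct [case_names one gen add scale]:
  assumes one: "P 1" and gen: "\<And>g x. P x \<Longrightarrow> P (gen g * x)"
    and add: "\<And>x y. P x \<Longrightarrow> P y \<Longrightarrow> P (x + y)"
    and scale: "\<And>c x. P x \<Longrightarrow> P (c *\<^sub>q x)"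
  shows "P (x :: 'g::graded free)"
proof (induction x rule: free_word_induct)
  fix w :: "'g word"
  have "P (free_word (Word l))" for l :: "'g list"
  proof (induction l)
    case Nil
    show ?case using one by (simp flip: free_word_zero zero_word_def)
  next
    case (Cons g l)
    have "free_word (Word (g # l)) = gen g * free_word (Word l)"
      by (simp add: gen_eq_free_word free_word_mult plus_word_def)
    then show ?case using Cons gen by simp
  qed
  then show "P (free_word w)" by (cases w) simp
qed (use assms in auto)

definition free_lift :: "('g \<Rightarrow> 'a::superalgebra) \<Rightarrow> 'g free \<Rightarrow> 'a" where
  "free_lift f x = (\<Sum>w\<in>Poly_Mapping.keys (Rep_free x).
     Poly_Mapping.lookup (Rep_free x) w *\<^sub>q prod_list (map f (letters w)))"

lemma free_lift_superset:
  assumes "finite A" "Poly_Mapping.keys (Rep_free x) \<subseteq> A"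
  shows "free_lift f x = (\<Sum>w\<in>A. Poly_Mapping.lookup (Rep_free x) w *\<^sub>q prod_list (map f (letters w)))"
  unfolding free_lift_def
  using assms by (intro sum.mono_neutral_cong_left) (auto simp: in_keys_iff)

lemma free_lift_linear: "qlinear (free_lift f :: 'g::graded free \<Rightarrow> 'a::superalgebra)"
proof (rule qlinearI)
  fix x y :: "'g free" and c
  let ?A = "Poly_Mapping.keys (Rep_free x) \<union> Poly_Mapping.keys (Rep_free y)"
  have "Poly_Mapping.keys (Rep_free (x + y)) \<subseteq> ?A"
    unfolding plus_free.rep_eq by (rule keys_add)
  then show "free_lift f (x + y) = free_lift f x + free_lift f y"
    by (simp add: free_lift_superset[of ?A] plus_free.rep_eq lookup_add scale_left_distrib sum.distrib)
  have "Poly_Mapping.keys (Rep_free (c *\<^sub>q x)) \<subseteq> Poly_Mapping.keys (Rep_free x)"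
    by (auto simp: scale_free.rep_eq in_keys_iff simp flip: pscale_def)
  then show "free_lift f (c *\<^sub>q x) = c *\<^sub>q free_lift f x"
    by (simp add: free_lift_superset[of "Poly_Mapping.keys (Rep_free x)"] scale_free.rep_eq
        scale_sum scale_scale flip: pscale_def)
qed

lemmas free_lift_simps = qlinear_simps[OF free_lift_linear]

lemma free_lift_word: "free_lift f (free_word w) = prod_list (map f (letters w))"
  by (simp add: free_lift_superset[of "{w}"] free_word.rep_eq scale_one)

lemma free_lift_gen: "free_lift f (gen g) = f g"
  by (simp add: gen_eq_free_word free_lift_word)

lemma free_lift_one: "free_lift f (1 :: 'g::graded free) = 1"
  by (simp add: free_lift_word zero_word_def flip: free_word_zero)

lemma free_lift_mult: "free_lift f (x * y :: 'g::graded free) = free_lift f x * free_lift f y"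
proof (induction x rule: free_word_induct)
  fix v :: "'g word"
  show "free_lift f (free_word v * y) = free_lift f (free_word v) * free_lift f y"
    by (induction y rule: free_word_induct)
      (simp_all add: free_word_mult free_lift_word plus_word_def distrib_left free_lift_simps
        scale_mult_right)
qed (simp_all add: distrib_right scale_mult_left free_lift_simps)

lemma free_lift_even:
  assumes "\<And>g. part (par g) (f g) = f g"
  shows "even_map (free_lift f :: 'g::graded free \<Rightarrow> 'a::superalgebra)"
proof -
  have "\<forall>p. free_lift f (part p x) = part p (free_lift f x)" for x :: "'g free"
  proof (induction x rule: free_induct)
    case one
    show ?case by (simp add: part_hom[OF part_one] free_lift_one free_lift_simps)
  next
    case (gen g x)
    then show ?case
      by (simp add: part_mult_hom_left[OF part_gen] part_mult_hom_left[OF assms] free_lift_mult free_lift_gen)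
  qed (simp_all add: part_simps free_lift_simps)
  then show ?thesis by (simp add: even_map_def)
qed

lemma superalg_hom_free_lift:
  "(\<And>g. part (par g) (f g) = f g) \<Longrightarrow> superalg_hom (free_lift f :: 'g::graded free \<Rightarrow> 'a::superalgebra)"
  by (simp add: superalg_hom_def free_lift_linear free_lift_even free_lift_one free_lift_mult)

lemma abs_presented_simps:
  "abs_presented_algebra 1 = 1" "abs_presented_algebra 0 = 0"
  "abs_presented_algebra (gen g) = pgen g"
  "abs_presented_algebra (x * y) = abs_presented_algebra x * abs_presented_algebra y"
  "abs_presented_algebra (x + y) = abs_presented_algebra x + abs_presented_algebra y"
  "abs_presented_algebra (c *\<^sub>q x) = c *\<^sub>q abs_presented_algebra x"
  "abs_presented_algebra (part p x) = part p (abs_presented_algebra x)"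
  by (simp_all add: one_presented_algebra.abs_eq zero_presented_algebra.abs_eq pgen.abs_eq
    times_presented_algebra.abs_eq plus_presented_algebra.abs_eq scale_presented_algebra.abs_eq
    part_presented_algebra.abs_eq)

lemma superalg_hom_abs_presented: "superalg_hom abs_presented_algebra"
  by (simp add: superalg_hom_def qlinear_iff even_map_def abs_presented_simps)

lemma abs_presented_relator:
  fixes r :: "'g::presented free"
  assumes "r \<in> relators"
  shows "abs_presented_algebra r = 0"
proof -
  have "r - 0 \<in> ideal_gen relators"
    using ideal_base[OF assms, of 1 1] by simp
  then have "abs_presented_algebra r = abs_presented_algebra 0"
    by (simp add: presented_algebra.abs_eq_iff)
  then show ?thesis by (simp add: abs_presented_simps)
qed

lemma presented_cases: obtains y where "x = abs_presented_algebra y"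
  by (rule that[of "rep_presented_algebra x"])
    (simp only: Quotient3_abs_rep[OF Quotient3_presented_algebra])

lemma presented_induct [case_names one gen add scale]:
  assumes one: "P 1" and gen: "\<And>g x. P x \<Longrightarrow> P (pgen g * x)"
    and add: "\<And>x y. P x \<Longrightarrow> P y \<Longrightarrow> P (x + y)"
    and scale: "\<And>c x. P x \<Longrightarrow> P (c *\<^sub>q x)"
  shows "P (x :: 'g::presented presented_algebra)"
proof -
  have "P (abs_presented_algebra y)" for y :: "'g free"
    by (induction y rule: free_induct) (simp_all add: abs_presented_simps assms)
  then show ?thesis by (cases x rule: presented_cases) simp
qed

lemma part_pgen: "part (par g) (pgen g) = pgen g"
  by (simp add: part_gen flip: abs_presented_simps)

text \<open>Evaluation at a chosen representative. It is independent of the choice as soon as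
  \<open>free_lift f\<close> kills the relators, because its kernel is then an ideal that contains
  \<open>ideal_gen relators\<close>; this is \<open>presented_lift_abs\<close>.\<close>

definition presented_lift :: "('g \<Rightarrow> 'a::superalgebra) \<Rightarrow> 'g::presented presented_algebra \<Rightarrow> 'a" where
  "presented_lift f x = free_lift f (rep_presented_algebra x)"

lemma presented_lift_abs:
  assumes "\<And>r. r \<in> relators \<Longrightarrow> free_lift f r = 0"
  shows "presented_lift f (abs_presented_algebra x) = free_lift f (x :: 'g::presented free)"
proof -
  have "free_lift f y = 0" if "y \<in> ideal_gen relators" for y :: "'g free"
    using that by induction (simp_all add: free_lift_simps free_lift_mult assms)
  moreover have "rep_presented_algebra (abs_presented_algebra x) - x \<in> ideal_gen relators"
    by (rule Quotient3_rep_abs[OF Quotient3_presented_algebra]) (simp add: ideal_zero)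
  ultimately have "free_lift f (rep_presented_algebra (abs_presented_algebra x) - x) = 0" by blast
  then show ?thesis by (simp add: presented_lift_def free_lift_simps)
qed

lemma
  assumes par: "\<And>g. part (par g) (f g) = f g"
    and rel: "\<And>r. r \<in> relators \<Longrightarrow> free_lift f r = 0"
  shows superalg_hom_presented_lift:
      "superalg_hom (presented_lift f :: 'g::presented presented_algebra \<Rightarrow> 'a::superalgebra)"
    and presented_lift_pgen: "presented_lift f (pgen g) = f g"
proof -
  note A = presented_lift_abs[OF rel]
  show "presented_lift f (pgen g) = f g"
    by (simp add: A free_lift_gen flip: abs_presented_simps)
  show "superalg_hom (presented_lift f :: 'g presented_algebra \<Rightarrow> 'a)"
    unfolding superalg_hom_def qlinear_iff even_map_def
  proof (intro conjI allI)
    fix x y :: "'g presented_algebra" and c :: cq and p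
    obtain x' y' where xy: "x = abs_presented_algebra x'" "y = abs_presented_algebra y'"
      using presented_cases by metis
    show "presented_lift f (x + y) = presented_lift f x + presented_lift f y"
      "presented_lift f (c *\<^sub>q x) = c *\<^sub>q presented_lift f x"
      "presented_lift f (x * y) = presented_lift f x * presented_lift f y"
      "presented_lift f (part p x) = part p (presented_lift f x)"
      unfolding xy by (simp_all add: A free_lift_simps free_lift_mult
          even_mapD[OF free_lift_even[of f, OF par]] flip: abs_presented_simps)
    show "presented_lift f (1 :: 'g presented_algebra) = 1"
      by (simp add: A free_lift_one flip: abs_presented_simps)
  qed
qed

lemma presented_hom_eqI:
  fixes f h :: "'g::presented presented_algebra \<Rightarrow> 'a::superalgebra"
  assumes "superalg_hom f" "superalg_hom h" "\<And>g. f (pgen g) = h (pgen g)"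
  shows "f = h"
proof
  fix x
  show "f x = h x"
    by (induction x rule: presented_induct)
      (simp_all add: assms superalg_homD[OF assms(1)] superalg_homD[OF assms(2)]
        qlinear_simps[OF superalg_homD(1)[OF assms(1)]] qlinear_simps[OF superalg_homD(1)[OF assms(2)]])
qed

section \<open>Matrices, endomorphisms and scalars as superalgebras\<close>

text \<open>
  For odd \<open>j\<close>, the entry \<open>(i, j)\<close> is the Koszul-twisted coefficient of the matrix unit \<open>E\<^sub>i\<^sub>j\<close>;
  this makes the product the usual one, without signs.
\<close>

typedef ('i, 'a) smat = "UNIV :: ('i \<Rightarrow> 'i \<Rightarrow> 'a) set"
  morphisms entry Smat by simp

setup_lifting type_definition_smat

instantiation smat :: ("{graded, finite}", superalgebra) superalgebra
begin

lift_definition zero_smat :: "('a, 'b) smat" is "\<lambda>i j. 0" .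
lift_definition one_smat :: "('a, 'b) smat" is "\<lambda>i j. if i = j then 1 else 0" .
lift_definition plus_smat :: "('a, 'b) smat \<Rightarrow> ('a, 'b) smat \<Rightarrow> ('a, 'b) smat" is
  "\<lambda>M N i j. M i j + N i j" .
lift_definition minus_smat :: "('a, 'b) smat \<Rightarrow> ('a, 'b) smat \<Rightarrow> ('a, 'b) smat" is
  "\<lambda>M N i j. M i j - N i j" .
lift_definition uminus_smat :: "('a, 'b) smat \<Rightarrow> ('a, 'b) smat" is "\<lambda>M i j. - M i j" .
lift_definition times_smat :: "('a, 'b) smat \<Rightarrow> ('a, 'b) smat \<Rightarrow> ('a, 'b) smat" is
  "\<lambda>M N i k. \<Sum>j\<in>UNIV. M i j * N j k" .
lift_definition scale_smat :: "cq \<Rightarrow> ('a, 'b) smat \<Rightarrow> ('a, 'b) smat" is "\<lambda>c M i j. c *\<^sub>q M i j" .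
lift_definition part_smat :: "bool \<Rightarrow> ('a, 'b) smat \<Rightarrow> ('a, 'b) smat" is
  "\<lambda>p M i j. part (p \<noteq> epar i j) (M i j)" .

instance
proof
  fix x y z :: "('a, 'b) smat" and c d :: cq and p r :: bool
  show "x + y + z = x + (y + z)" by transfer (simp add: algebra_simps)
  show "x + y = y + x" by transfer (simp add: algebra_simps)
  show "0 + x = x" by transfer simp
  show "- x + x = 0" by transfer simp
  show "x - y = x + - y" by transfer simp
  show "x * y * z = x * (y * z)"
  proof (transfer, intro ext)
    fix M N K :: "'a \<Rightarrow> 'a \<Rightarrow> 'b" and i k
    have "(\<Sum>j\<in>UNIV. (\<Sum>l\<in>UNIV. M i l * N l j) * K j k) = (\<Sum>j\<in>UNIV. \<Sum>l\<in>UNIV. M i l * (N l j * K j k))"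
      by (simp add: sum_distrib_right mult.assoc)
    also have "\<dots> = (\<Sum>l\<in>UNIV. \<Sum>j\<in>UNIV. M i l * (N l j * K j k))" by (rule sum.swap)
    finally show "(\<Sum>j\<in>UNIV. (\<Sum>l\<in>UNIV. M i l * N l j) * K j k) = (\<Sum>l\<in>UNIV. M i l * (\<Sum>j\<in>UNIV. N l j * K j k))"
      by (simp add: sum_distrib_left)
  qed
  show "(x + y) * z = x * z + y * z" by transfer (simp add: distrib_right sum.distrib)
  show "x * (y + z) = x * y + x * z" by transfer (simp add: distrib_left sum.distrib)
  show "1 * x = x" by transfer (simp add: if_distrib[of "\<lambda>u. u * _"] cong: if_cong)
  show "x * 1 = x" by transfer (simp add: if_distrib[of "\<lambda>u. _ * u"] cong: if_cong)
  show "c *\<^sub>q (x + y) = c *\<^sub>q x + c *\<^sub>q y" by transfer (simp add: scale_right_distrib)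
  show "(c + d) *\<^sub>q x = c *\<^sub>q x + d *\<^sub>q x" by transfer (simp add: scale_left_distrib)
  show "c *\<^sub>q d *\<^sub>q x = (c * d) *\<^sub>q x" by transfer (simp add: scale_scale)
  show "1 *\<^sub>q x = x" by transfer (simp add: scale_one)
  show "part p (x + y) = part p x + part p y" by transfer (simp add: part_add)
  show "part p (c *\<^sub>q x) = c *\<^sub>q part p x" by transfer (simp add: part_scale)
  show "part p (part r x) = (if p = r then part r x else 0)"
    by (cases "p = r") (simp_all, (transfer, force simp: part_part fun_eq_iff)+)
  show "part False x + part True x = x"
  proof (transfer, intro ext)
    fix M :: "'a \<Rightarrow> 'a \<Rightarrow> 'b" and i j
    show "part (False \<noteq> epar i j) (M i j) + part (True \<noteq> epar i j) (M i j) = M i j"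
      using part_decompose[of "M i j"] by (cases "epar i j") (simp_all add: add.commute)
  qed
  show "(c *\<^sub>q x) * y = c *\<^sub>q (x * y)" by transfer (simp add: scale_mult_left scale_sum)
  show "x * (c *\<^sub>q y) = c *\<^sub>q (x * y)" by transfer (simp add: scale_mult_right scale_sum)
  show "part False (1 :: ('a, 'b) smat) = 1"
    by transfer (auto simp: fun_eq_iff epar_def part_one)
  show "part (p \<noteq> r) (part p x * part r y) = part p x * part r y"
  proof (transfer, intro ext)
    fix M N :: "'a \<Rightarrow> 'a \<Rightarrow> 'b" and p r i k
    have "part ((p \<noteq> r) \<noteq> epar i k) (part (p \<noteq> epar i j) (M i j) * part (r \<noteq> epar j k) (N j k))
        = part (p \<noteq> epar i j) (M i j) * part (r \<noteq> epar j k) (N j k)" for j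
    proof -
      have e: "((p \<noteq> r) \<noteq> epar i k) = ((p \<noteq> epar i j) \<noteq> (r \<noteq> epar j k))"
        by (auto simp: epar_def)
      show ?thesis unfolding e by (rule part_mult)
    qed
    then show "part ((p \<noteq> r) \<noteq> epar i k) (\<Sum>j\<in>UNIV. part (p \<noteq> epar i j) (M i j) * part (r \<noteq> epar j k) (N j k))
        = (\<Sum>j\<in>UNIV. part (p \<noteq> epar i j) (M i j) * part (r \<noteq> epar j k) (N j k))"
      by (simp only: part_sum)
  qed
qed

end

text \<open>An action of a presented superalgebra is a homomorphism into this type. It thus suffices
  to give the operators of the generators and to check the relations between them; both the action
  of the quantum queer superalgebra and the braiding are obtained in this way.\<close>

typedef (overloaded) 'a qend = "{f :: 'a::superspace \<Rightarrow> 'a. qlinear f}"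
  morphisms app Qend
  by (rule exI[of _ "\<lambda>x. x"]) (simp add: qlinear_id)

setup_lifting type_definition_qend

lemma app_linear: "qlinear (app f)"
  using app[of f] by simp

lemmas app_simps = qlinear_simps[OF app_linear]

instantiation qend :: (superspace) superalgebra
begin

lift_definition zero_qend :: "'a qend" is "\<lambda>x. 0" by (simp add: qlinear_iff)
lift_definition one_qend :: "'a qend" is "\<lambda>x. x" by (rule qlinear_id)
lift_definition plus_qend :: "'a qend \<Rightarrow> 'a qend \<Rightarrow> 'a qend" is "\<lambda>f g x. f x + g x"
  by (simp add: qlinear_iff scale_right_distrib)
lift_definition minus_qend :: "'a qend \<Rightarrow> 'a qend \<Rightarrow> 'a qend" is "\<lambda>f g x. f x - g x"
  by (simp add: qlinear_iff scale_diff_right)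
lift_definition uminus_qend :: "'a qend \<Rightarrow> 'a qend" is "\<lambda>f x. - f x"
  by (simp add: qlinear_iff scale_minus_right)
lift_definition times_qend :: "'a qend \<Rightarrow> 'a qend \<Rightarrow> 'a qend" is "\<lambda>f g x. f (g x)"
  by (rule qlinear_compose)
lift_definition scale_qend :: "cq \<Rightarrow> 'a qend \<Rightarrow> 'a qend" is "\<lambda>c f x. c *\<^sub>q f x"
  by (rule qlinear_scale)
lift_definition part_qend :: "bool \<Rightarrow> 'a qend \<Rightarrow> 'a qend" is
  "\<lambda>p f x. part p (f (part False x)) + part (\<not> p) (f (part True x))"
  by (simp add: qlinear_iff part_simps scale_right_distrib)

instance
proof
  fix f g h :: "'a qend" and c d :: cq and p r :: bool
  show "f + g + h = f + (g + h)" by transfer (simp add: algebra_simps)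
  show "f + g = g + f" by transfer (simp add: algebra_simps)
  show "0 + f = f" by transfer simp
  show "- f + f = 0" by transfer simp
  show "f - g = f + - g" by transfer simp
  show "f * g * h = f * (g * h)" by transfer simp
  show "(f + g) * h = f * h + g * h" by transfer simp
  show "f * (g + h) = f * g + f * h" by transfer (simp add: qlinear_iff)
  show "1 * f = f" by transfer simp
  show "f * 1 = f" by transfer simp
  show "c *\<^sub>q (f + g) = c *\<^sub>q f + c *\<^sub>q g" by transfer (simp add: scale_right_distrib)
  show "(c + d) *\<^sub>q f = c *\<^sub>q f + d *\<^sub>q f" by transfer (simp add: scale_left_distrib)
  show "c *\<^sub>q d *\<^sub>q f = (c * d) *\<^sub>q f" by transfer (simp add: scale_scale)
  show "1 *\<^sub>q f = f" by transfer (simp add: scale_one)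
  show "part p (f + g) = part p f + part p g" by transfer (simp add: part_add add_ac)
  show "part p (c *\<^sub>q f) = c *\<^sub>q part p f" by transfer (simp add: part_scale scale_right_distrib)
  show "part p (part r f) = (if p = r then part r f else 0)"
    by (cases "p = r"; cases p; cases r; simp; transfer)
      (auto simp: part_part part_simps qlinear_simps fun_eq_iff)
  show "part False f + part True f = f"
  proof (transfer, intro ext)
    fix f :: "'a \<Rightarrow> 'a" and x
    assume f: "qlinear f"
    have "part False (f (part False x)) + part (\<not> False) (f (part True x)) +
        (part True (f (part False x)) + part (\<not> True) (f (part True x)))
      = (part False (f (part False x)) + part True (f (part False x)))
        + (part False (f (part True x)) + part True (f (part True x)))" by simp
    also have "\<dots> = f (part False x + part True x)"
      using qlinear_simps(1)[OF f, of "part False x" "part True x"] by (simp only: part_decompose)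
    finally show "part False (f (part False x)) + part (\<not> False) (f (part True x)) +
        (part True (f (part False x)) + part (\<not> True) (f (part True x))) = f x"
      by (simp only: part_decompose not_False_eq_True not_True_eq_False)
  qed
  show "(c *\<^sub>q f) * g = c *\<^sub>q (f * g)" by transfer simp
  show "f * (c *\<^sub>q g) = c *\<^sub>q (f * g)" by transfer (simp add: qlinear_iff)
  show "part False (1 :: 'a qend) = 1"
    by transfer (simp add: part_part part_decompose)
  show "part (p \<noteq> r) (part p f * part r g) = part p f * part r g"
    by (cases p; cases r; simp; transfer)
      (auto simp: part_part part_simps qlinear_simps fun_eq_iff)
qed

end

lemma app_qend:
  "app (f + g) x = app f x + app g x" "app (f - g) x = app f x - app g x"
  "app (f * g) x = app f (app g x)" "app (c *\<^sub>q f) x = c *\<^sub>q app f x"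
  "app 1 x = x" "app 0 x = 0" "app (- f) x = - app f x"
  by (transfer, simp)+

lemma part_qend_eqI:
  assumes "\<And>r x. part (p \<noteq> r) (app f (part r x)) = app f (part r x)"
  shows "part p f = f"
proof -
  have "app (part p f) x = app f x" for x
    using assms[of False x] assms[of True x]
    by (simp add: part_qend.rep_eq) (simp add: part_decompose flip: app_simps)
  then show ?thesis by (simp add: app_inject[symmetric] fun_eq_iff)
qed

lemma part_app:
  assumes "part p f = f" "part r x = x"
  shows "part (p \<noteq> r) (app f x) = app f x"
proof -
  have "app f x = part p (app f (part False x)) + part (\<not> p) (app f (part True x))"
    using arg_cong[OF assms(1), of "\<lambda>f. app f x"] by (simp add: part_qend.rep_eq)
  also have "\<dots> = part (p \<noteq> r) (app f x)"
    using part_hom[OF assms(2), of True] part_hom[OF assms(2), of False]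
    by (cases r) (simp_all add: app_simps)
  finally show ?thesis ..
qed

text \<open>The universal property needs a superalgebra as its target. This copy of the base field,
  concentrated in even parity, serves for the counit.\<close>

typedef scalar = "UNIV :: cq set"
  morphisms of_scalar Scalar by simp

setup_lifting type_definition_scalar

instantiation scalar :: superalgebra
begin

lift_definition zero_scalar :: scalar is 0 .
lift_definition one_scalar :: scalar is 1 .
lift_definition plus_scalar :: "scalar \<Rightarrow> scalar \<Rightarrow> scalar" is "(+)" .
lift_definition minus_scalar :: "scalar \<Rightarrow> scalar \<Rightarrow> scalar" is "(-)" .
lift_definition uminus_scalar :: "scalar \<Rightarrow> scalar" is uminus .
lift_definition times_scalar :: "scalar \<Rightarrow> scalar \<Rightarrow> scalar" is "(*)" .
lift_definition scale_scalar :: "cq \<Rightarrow> scalar \<Rightarrow> scalar" is "(*)" .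
lift_definition part_scalar :: "bool \<Rightarrow> scalar \<Rightarrow> scalar" is "\<lambda>p x. if p then 0 else x" .

instance
  by standard (transfer, simp add: algebra_simps)+

end

section \<open>Crossings\<close>

lemma idx_simps [simp]:
  "- (- i) = (i :: 'n::finite idx)" "- i = - j \<longleftrightarrow> i = (j :: 'n::finite idx)"
  "- i < - j \<longleftrightarrow> j < (i :: 'n::finite idx)"
  "i \<noteq> - (i :: 'n::finite idx)" "- i \<noteq> (i :: 'n::finite idx)"
  by (transfer, simp)+

lemma par_uminus [simp]: "par (- i) \<longleftrightarrow> \<not> par (i :: 'n::finite idx)"
  by (rule par_uminus_idx)

text \<open>The coefficients of \<open>cross\<close> at \<open>(i, k)\<close> depend on these four
  cases and on whether \<open>k < - i\<close>. All orientations of the disequalities are listed so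
  that simplification can decide every condition.\<close>

lemma idx_cases [case_names eq opp less greater]:
  fixes i k :: "'n::finite idx"
  obtains "i = k" | "i = - k"
  | "i < k" "\<not> k < i" "i \<noteq> k" "i \<noteq> - k" "k \<noteq> i" "k \<noteq> - i" "- i \<noteq> k" "- k \<noteq> i"
  | "k < i" "\<not> i < k" "i \<noteq> k" "i \<noteq> - k" "k \<noteq> i" "k \<noteq> - i" "- i \<noteq> k" "- k \<noteq> i"
proof -
  have "k = - i \<longleftrightarrow> i = - k" "- i = k \<longleftrightarrow> i = - k" "- k = i \<longleftrightarrow> i = - k"
    by (transfer, force)+
  then show ?thesis
    using that by (cases "i = k"; cases "i = - k"; cases i k rule: linorder_cases) simp_all
qed

lemma less_uminus_idx_iff:
  "i \<noteq> - k \<Longrightarrow> - i < k \<longleftrightarrow> \<not> k < - (i :: 'n::finite idx)"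
  "i \<noteq> - k \<Longrightarrow> - k < i \<longleftrightarrow> \<not> k < - (i :: 'n::finite idx)"
  "i < - k \<longleftrightarrow> k < - (i :: 'n::finite idx)"
  by (transfer, force)+

lemma less_uminus_self [simp]:
  "i < - i \<longleftrightarrow> par (i :: 'n::finite idx)" "- i < i \<longleftrightarrow> \<not> par (i :: 'n::finite idx)"
  by (transfer, force)+

lemma q_nonzero [simp]: "q \<noteq> 0"
  by (simp add: q_def Zero_fract_def eq_fract)

text \<open>
  The coefficients of the braiding on generators: \<open>f b a\<close> stands for the product of the generators
  with second indices \<open>b\<close> and \<open>a\<close>.
\<close>

definition cross :: "('n::finite idx \<Rightarrow> 'n idx \<Rightarrow> 'v::qspace) \<Rightarrow> 'n idx \<Rightarrow> 'n idx \<Rightarrow> 'v" where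
  "cross f i k = (sg (\<not> par i \<and> \<not> par k) * q powi phi i k) *\<^sub>q f k i
     - (of_bool (k < i) * \<xi>) *\<^sub>q f i k
     - (of_bool (k < - i) * sg (par i) * \<xi>) *\<^sub>q f (- i) (- k)"

text \<open>The flag selects the crossing or its inverse, which is the crossing plus \<xi> by the
  Hecke relation. Strands of both kinds can then be treated at once.\<close>

definition crossing :: "bool \<Rightarrow> ('n::finite idx \<Rightarrow> 'n idx \<Rightarrow> 'v::qspace) \<Rightarrow> 'n idx \<Rightarrow> 'n idx \<Rightarrow> 'v" where
  "crossing e f i k = (if e then cross f i k else cross f i k + \<xi> *\<^sub>q f i k)"

lemma cross_linear: "qlinear h \<Longrightarrow> h (cross f i k) = cross (\<lambda>i k. h (f i k)) i k"
  by (simp add: cross_def qlinear_simps)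

lemma crossing_linear: "qlinear h \<Longrightarrow> h (crossing e f i k) = crossing e (\<lambda>i k. h (f i k)) i k"
  by (simp add: crossing_def cross_linear qlinear_simps)

lemma cross_simps:
  "cross (\<lambda>i k. f i k + g i k) i k = cross f i k + cross g i k"
  "cross (\<lambda>i k. f i k - g i k) i k = cross f i k - cross g i k"
  "cross (\<lambda>i k. - f i k) i k = - cross f i k"
  "cross (\<lambda>i k. c *\<^sub>q f i k) i k = c *\<^sub>q cross f i k"
  "cross (\<lambda>i k. \<Sum>a\<in>A. h a i k) i k = (\<Sum>a\<in>A. cross (h a) i k)"
  by (simp_all add: cross_def scale_right_distrib scale_diff_right scale_scale mult_ac scale_sum
      sum_subtractf scale_minus_right)

lemma crossing_sum: "crossing e (\<lambda>i k. \<Sum>a\<in>A. h a i k) i k = (\<Sum>a\<in>A. crossing e (h a) i k)"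
  by (simp add: crossing_def cross_simps sum.distrib scale_sum)

lemma phi_simps:
  "phi i i = (if par i then - 1 else 1)"
  "phi (- i) i = (if par i then - 1 else 1)"
  "phi i (- i) = (if par i then 1 else - 1)"
  "phi (- i) (- k) = - phi i k"
  "i \<noteq> k \<Longrightarrow> i \<noteq> - k \<Longrightarrow> phi i k = 0"
  by (auto simp: phi_def)

lemmas scale_simps = scale_right_distrib scale_diff_right scale_minus_right scale_scale

lemma scale_left_simps: "(c + d) *\<^sub>q x = c *\<^sub>q x + d *\<^sub>q (x :: 'a::qspace)"
  "(c - d) *\<^sub>q x = c *\<^sub>q x - d *\<^sub>q x" "(- c) *\<^sub>q x = - (c *\<^sub>q x)"
  using scale_left_distrib[of c "- d" x] by (simp_all add: scale_left_distrib scale_minus_left)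

text \<open>The Hecke relation. Only the values of \<open>f\<close> at \<open>(i, k)\<close>,
  \<open>(k, i)\<close>, \<open>(- i, - k)\<close> and \<open>(- k, - i)\<close> are combined, so a
  distinction of orders and parities suffices.\<close>

lemma cross_cross: "cross (cross f) i k = f i k - \<xi> *\<^sub>q cross f i k"
proof (cases i k rule: idx_cases)
  case eq
  then show ?thesis
    by (cases "par k") (simp_all add: cross_def phi_simps power_int_minus scale_simps scale_one
        xi_def scale_left_simps algebra_simps)
next
  case opp
  then show ?thesis
    by (cases "par k") (simp_all add: cross_def phi_simps power_int_minus scale_simps scale_one
        xi_def scale_left_simps algebra_simps)
next
  case less
  then show ?thesis
    by (cases "par k"; cases "par i"; cases "k < - i")
       (simp_all add: cross_def phi_simps less_uminus_idx_iff[of i k] power_int_minus scale_simps scale_one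
        xi_def scale_left_simps algebra_simps)
next
  case greater
  then show ?thesis
    by (cases "par k"; cases "par i"; cases "k < - i")
       (simp_all add: cross_def phi_simps less_uminus_idx_iff[of i k] power_int_minus scale_simps scale_one
        xi_def scale_left_simps algebra_simps)
qed

lemma crossing_inverse:
  fixes f :: "'n::finite idx \<Rightarrow> 'n idx \<Rightarrow> 'v::qspace"
  shows "crossing (\<not> e) (crossing e f) i k = f i k"
proof -
  have "crossing e f = (if e then cross f else (\<lambda>i k. cross f i k + \<xi> *\<^sub>q f i k))" for e and f :: "'n idx \<Rightarrow> 'n idx \<Rightarrow> 'v"
    by (simp add: crossing_def fun_eq_iff)
  then show ?thesis
    by (cases e) (simp_all add: cross_cross cross_simps scale_simps)
qed

text \<open>The crossing commutes with the odd endomorphism \<open>w\<^sub>i \<mapsto> w\<^sub>-\<^sub>i\<close> of the left strand moving to the right.\<close>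

lemma cross_odd: "cross (\<lambda>i k. sg (\<not> par i) *\<^sub>q f i (- k)) i k = cross f (- i) k"
proof (cases i k rule: idx_cases)
  case less
  then show ?thesis
    by (cases "par k"; cases "par i"; cases "k < - i")
       (simp_all add: cross_def phi_simps less_uminus_idx_iff[of i k] scale_simps scale_one
        scale_left_simps algebra_simps)
next
  case greater
  then show ?thesis
    by (cases "par k"; cases "par i"; cases "k < - i")
       (simp_all add: cross_def phi_simps less_uminus_idx_iff[of i k] scale_simps scale_one
        scale_left_simps algebra_simps)
qed (cases "par k"; simp add: cross_def phi_simps scale_simps scale_one scale_left_simps algebra_simps)+

text \<open>The pairs \<open>(i, k)\<close>, \<open>(k, i)\<close> and \<open>(- i, - k)\<close>
  that \<open>cross\<close> combines have the same sum of parities, so a coefficient depending on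
  this sum alone is a constant.\<close>

lemma cross_parity:
  "cross (\<lambda>i k. h (par i \<noteq> par k) *\<^sub>q f i k) i k = h (par i \<noteq> par k) *\<^sub>q cross f i k"
proof -
  have "(par k \<noteq> par i) = (par i \<noteq> par k)" "(par (- i) \<noteq> par (- k)) = (par i \<noteq> par k)"
    by auto
  then show ?thesis by (simp only: cross_def scale_simps mult.commute mult.left_commute)
qed

lemma crossing_parity:
  "crossing e (\<lambda>i k. h (par i \<noteq> par k) *\<^sub>q f i k) i k = h (par i \<noteq> par k) *\<^sub>q crossing e f i k"
  by (simp only: crossing_def cross_parity) (simp add: scale_simps mult.commute)

definition crossing1 :: "bool \<Rightarrow> ('n::finite idx \<Rightarrow> 'n idx \<Rightarrow> 'n idx \<Rightarrow> 'v::qspace) \<Rightarrow> 'n idx \<Rightarrow> 'n idx \<Rightarrow> 'n idx \<Rightarrow> 'v" where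
  "crossing1 e f i j k = crossing e (\<lambda>i j. f i j k) i j"

definition crossing2 :: "bool \<Rightarrow> ('n::finite idx \<Rightarrow> 'n idx \<Rightarrow> 'n idx \<Rightarrow> 'v::qspace) \<Rightarrow> 'n idx \<Rightarrow> 'n idx \<Rightarrow> 'n idx \<Rightarrow> 'v" where
  "crossing2 e f i = crossing e (f i)"

lemma crossing12_inverse [simp]:
  fixes f :: "'n::finite idx \<Rightarrow> 'n idx \<Rightarrow> 'n idx \<Rightarrow> 'v::qspace"
  shows
  "crossing1 (\<not> e) (crossing1 e f) = f" "crossing2 (\<not> e) (crossing2 e f) = f"
  "crossing1 e (crossing1 (\<not> e) f) = f" "crossing2 e (crossing2 (\<not> e) f) = f"
proof -
  have "crossing (\<not> e) (crossing e f) = f" for e and f :: "'n idx \<Rightarrow> 'n idx \<Rightarrow> 'v"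
    using crossing_inverse[of e f] by (intro ext)
  from this[of e] this[of "\<not> e"] show "crossing1 (\<not> e) (crossing1 e f) = f" "crossing2 (\<not> e) (crossing2 e f) = f"
    "crossing1 e (crossing1 (\<not> e) f) = f" "crossing2 e (crossing2 (\<not> e) f) = f"
    by (simp_all add: crossing1_def [abs_def] crossing2_def [abs_def])
qed

lemma crossing_simps:
  "crossing e (\<lambda>i k. f i k + g i k) i k = crossing e f i k + crossing e g i k"
  "crossing e (\<lambda>i k. f i k - g i k) i k = crossing e f i k - crossing e g i k"
  "crossing e (\<lambda>i k. - f i k) i k = - crossing e f i k"
  "crossing e (\<lambda>i k. c *\<^sub>q f i k) i k = c *\<^sub>q crossing e f i k"
  "crossing e (\<lambda>i k. 0) i k = 0"
  by (simp_all add: crossing_def cross_simps scale_simps mult.commute) (simp add: cross_def)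

lemma crossing_False: "crossing False f i k = crossing True f i k + \<xi> *\<^sub>q f i k"
  by (simp add: crossing_def)

lemma crossing_Hecke:
  fixes f :: "'n::finite idx \<Rightarrow> 'n idx \<Rightarrow> 'v::qspace"
  shows "crossing True (crossing True f) i k = f i k - \<xi> *\<^sub>q crossing True f i k"
proof -
  have "crossing True f = cross f" for f :: "'n idx \<Rightarrow> 'n idx \<Rightarrow> 'v"
    by (simp add: crossing_def fun_eq_iff)
  then show ?thesis by (simp add: cross_cross)
qed

section \<open>The braid relation\<close>

context
begin

private abbreviation (input) "C1 \<equiv> crossing1 True"
private abbreviation (input) "C2 \<equiv> crossing2 True"

text \<open>The defect of the braid relation.\<close>

private definition D :: "('n::finite idx \<Rightarrow> 'n idx \<Rightarrow> 'n idx \<Rightarrow> 'v::qspace) \<Rightarrow> 'n idx \<Rightarrow> 'n idx \<Rightarrow> 'n idx \<Rightarrow> 'v" where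
  "D f i j k = C1 (C2 (C1 f)) i j k - C2 (C1 (C2 f)) i j k"

text \<open>\<open>J1\<close>, \<open>J2\<close> and \<open>J3\<close> are the odd endomorphisms of
  the three strands. The signs in the latter two are the Koszul signs for passing the strands to the
  left, a strand of index \<open>i\<close> having parity opposite to \<open>par i\<close>.\<close>

private definition J1 :: "('n::finite idx \<Rightarrow> 'n idx \<Rightarrow> 'n idx \<Rightarrow> 'v::qspace) \<Rightarrow> 'n idx \<Rightarrow> 'n idx \<Rightarrow> 'n idx \<Rightarrow> 'v" where
  "J1 f i j k = f (- i) j k"

private definition J2 :: "('n::finite idx \<Rightarrow> 'n idx \<Rightarrow> 'n idx \<Rightarrow> 'v::qspace) \<Rightarrow> 'n idx \<Rightarrow> 'n idx \<Rightarrow> 'n idx \<Rightarrow> 'v" where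
  "J2 f i j k = sg (\<not> par i) *\<^sub>q f i (- j) k"

private definition J3 :: "('n::finite idx \<Rightarrow> 'n idx \<Rightarrow> 'n idx \<Rightarrow> 'v::qspace) \<Rightarrow> 'n idx \<Rightarrow> 'n idx \<Rightarrow> 'n idx \<Rightarrow> 'v" where
  "J3 f i j k = sg (par i \<noteq> par j) *\<^sub>q f i j (- k)"

private lemma C1_J2: "C1 (J2 f) = J1 (C1 f)"
proof (intro ext)
  fix i j k
  show "C1 (J2 f) i j k = J1 (C1 f) i j k"
    using cross_odd[of "\<lambda>i j. f i j k" i j] by (simp add: crossing1_def J2_def J1_def crossing_def)
qed

private lemma C2_J3: "C2 (J3 f) = J2 (C2 f)"
proof (intro ext)
  fix i j k
  have "sg (par i \<noteq> par j) = sg (\<not> par i) * sg (\<not> par j)" for i j :: "'a idx"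
    by (simp add: sg_mult)
  then have "J3 f i = (\<lambda>j k. sg (\<not> par i) *\<^sub>q sg (\<not> par j) *\<^sub>q f i j (- k))"
    by (simp add: J3_def fun_eq_iff scale_scale)
  then show "C2 (J3 f) i j k = J2 (C2 f) i j k"
    using cross_odd[of "f i" j k] by (simp add: crossing2_def J2_def crossing_def cross_simps)
qed

private lemma C1_J3: "C1 (J3 f) = J3 (C1 f)"
proof (intro ext)
  fix i j k
  show "C1 (J3 f) i j k = J3 (C1 f) i j k"
    using crossing_parity[of True sg "\<lambda>i j. f i j (- k)" i j] by (simp only: crossing1_def J3_def)
qed

private lemma C2_J1: "C2 (J1 f) = J1 (C2 f)"
  by (simp add: fun_eq_iff crossing2_def J1_def [abs_def])

text \<open>Taking inverses in \<open>C1_J2\<close> reverses the direction in which the odd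
  endomorphism moves.\<close>

private lemma C1_inv_J1: "crossing1 False (J1 f) = J2 (crossing1 False f)"
  using arg_cong[OF C1_J2[of "crossing1 False f"], of "crossing1 False"]
  by (simp add: crossing12_inverse(1)[of True, simplified] crossing12_inverse(3)[of True, simplified])

private lemma C2_inv_J2: "crossing2 False (J2 f) = J3 (crossing2 False f)"
  using arg_cong[OF C2_J3[of "crossing2 False f"], of "crossing2 False"]
  by (simp add: crossing12_inverse(2)[of True, simplified] crossing12_inverse(4)[of True, simplified])

private lemma C_simps:
  "C1 (\<lambda>i j k. f i j k - g i j k) = (\<lambda>i j k. C1 f i j k - C1 g i j k)"
  "C2 (\<lambda>i j k. f i j k - g i j k) = (\<lambda>i j k. C2 f i j k - C2 g i j k)"
  "C1 (\<lambda>i j k. c *\<^sub>q f i j k) = (\<lambda>i j k. c *\<^sub>q C1 f i j k)"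
  "C2 (\<lambda>i j k. c *\<^sub>q f i j k) = (\<lambda>i j k. c *\<^sub>q C2 f i j k)"
  "crossing1 False f = (\<lambda>i j k. C1 f i j k + \<xi> *\<^sub>q f i j k)"
  "crossing2 False f = (\<lambda>i j k. C2 f i j k + \<xi> *\<^sub>q f i j k)"
  "C1 (C1 f) = (\<lambda>i j k. f i j k - \<xi> *\<^sub>q C1 f i j k)"
  "C2 (C2 f) = (\<lambda>i j k. f i j k - \<xi> *\<^sub>q C2 f i j k)"
  by (simp_all add: fun_eq_iff crossing1_def crossing2_def crossing_simps crossing_False crossing_Hecke)

private lemma D_fun: "D f = (\<lambda>i j k. C1 (C2 (C1 f)) i j k - C2 (C1 (C2 f)) i j k)"
  by (simp add: fun_eq_iff D_def)

text \<open>Substituting C^2 = 1 - \<xi> C in D C2 gives C1 C2 C1 C2 - C2 C1 + \<xi> C2 C1 C2, which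
  is also the expansion of - (C1 + \<xi>) D. No property of the crossing other than the Hecke
  relation enters.\<close>

private lemma D_C2: "D (C2 f) = (\<lambda>i j k. - crossing1 False (D f) i j k)"
  by (simp add: D_fun C_simps scale_diff_right algebra_simps)

private lemma D_C1: "D (C1 f) = (\<lambda>i j k. - crossing2 False (D f) i j k)"
  by (simp add: D_fun C_simps scale_diff_right algebra_simps)

private lemma D_J3: "D (J3 f) = J1 (D f)"
proof -
  have "C1 (C2 (C1 (J3 f))) = J1 (C1 (C2 (C1 f)))" "C2 (C1 (C2 (J3 f))) = J1 (C2 (C1 (C2 f)))"
    by (simp_all add: C1_J3 C2_J3 C1_J2 C2_J1)
  then show ?thesis by (simp add: D_fun J1_def [abs_def])
qed

text \<open>By \<open>D_C2\<close> the left side is - C1^-1 D J3 = - C1^-1 J1 D. The inverse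
  crossing turns J1 into J2, and \<open>D_C2\<close> is then applied backwards.\<close>

private lemma D_C2_J3: "D (C2 (J3 f)) = J2 (D (C2 f))"
  by (simp add: D_C2 D_J3 C1_inv_J1) (simp add: J2_def fun_eq_iff scale_minus_right)

private lemma D_C1_C2_J3: "D (C1 (C2 (J3 f))) = J3 (D (C1 (C2 f)))"
  by (simp add: D_C1 D_C2_J3 C2_inv_J2) (simp add: J3_def fun_eq_iff scale_minus_right)

text \<open>For two positive indices the term with opposite indices is absent, and what remains is,
  up to sign, the type A Hecke operator.\<close>

private lemma cross_positive:
  assumes "\<not> par i" "\<not> par k"
  shows "cross f i k = - ((if i = k then q else 1) *\<^sub>q f k i) - (of_bool (k < i) * \<xi>) *\<^sub>q f i k"
proof -
  have "\<not> k < - i" "i \<noteq> - k" using assms by (transfer, force)+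
  then show ?thesis using assms
    by (simp add: cross_def phi_def scale_minus_left)
qed

private lemma order_cases:
  fixes i k :: "'a::linorder"
  obtains "i < k" "\<not> k < i" "i \<noteq> k" "k \<noteq> i" | "i = k" | "k < i" "\<not> i < k" "i \<noteq> k" "k \<noteq> i"
  by (cases i k rule: linorder_cases) auto

text \<open>The coefficients now depend only on the relative order of the three indices.\<close>

private lemma D_positive:
  assumes "\<not> par i" "\<not> par j" "\<not> par k"
  shows "D f i j k = 0"
  by (cases i j rule: order_cases; cases j k rule: order_cases; cases i k rule: order_cases)
    (simp_all add: assms xi_def scale_left_simps D_def crossing1_def crossing2_def crossing_def cross_positive scale_simps scale_one
      scale_minus_left algebra_simps)

private lemma D_zero:
  fixes f :: "'n::finite idx \<Rightarrow> 'n idx \<Rightarrow> 'n idx \<Rightarrow> 'v::qspace"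
  shows "D f i j k = 0"
proof -
  \<comment> \<open>Starting from positive indices, one index after the other is freed from its sign
    condition. For the first one, \<open>D_J3\<close> exchanges \<open>i\<close> and
    \<open>- i\<close>.\<close>
  have 1: "D f i j k = 0" if "\<not> par j" "\<not> par k" for i j k and f :: "'n idx \<Rightarrow> 'n idx \<Rightarrow> 'n idx \<Rightarrow> 'v"
  proof (cases "par i")
    case True
    then have "D (J3 f) (- i) j k = 0" using that by (intro D_positive) simp_all
    then show ?thesis by (simp add: D_J3 J1_def)
  qed (use that D_positive in blast)
  have 2: "D f i j k = 0" if "\<not> par k" for i j k and f :: "'n idx \<Rightarrow> 'n idx \<Rightarrow> 'n idx \<Rightarrow> 'v"
  proof (cases "par j")
    case True
    \<comment> \<open>Since \<open>f\<close> is \<open>C2\<close> of its image under the inverse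
      crossing, \<open>D_C2_J3\<close> expresses the value at \<open>j\<close> by a value at
      \<open>- j\<close>, which vanishes by the previous step.\<close>
    then have "D (C2 (J3 (crossing2 False f))) i (- j) k = 0" using that by (intro 1) simp_all
    then show ?thesis
      using crossing12_inverse(4)[of True f] arg_cong[of _ 0 "\<lambda>x. sg (\<not> par i) *\<^sub>q x"]
      by (simp add: D_C2_J3 J2_def) (metis scale_sg_cancel scale_zero_right)
  qed (use that 1 in blast)
  show ?thesis
  proof (cases "par k")
    case True
    \<comment> \<open>The same for the third index, with \<open>f\<close> written as
      \<open>C1 (C2 g)\<close>.\<close>
    then have "D (C1 (C2 (J3 (crossing2 False (crossing1 False f))))) i j (- k) = 0" by (intro 2) simp_all
    then show ?thesis
      using crossing12_inverse(4)[of True "crossing1 False f"] crossing12_inverse(3)[of True f]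
      by (simp add: D_C1_C2_J3 J3_def) (metis scale_sg_cancel scale_zero_right)
  qed (use 2 in blast)
qed

lemma braid: "crossing1 True (crossing2 True (crossing1 True f)) = crossing2 True (crossing1 True (crossing2 True f))"
  using D_zero[of f] by (simp add: D_def fun_eq_iff)

end

text \<open>Obtained from \<open>braid\<close> by multiplying with inverses on both sides. In the
  first relation one crossing and in the second two crossings of the two inverted strands keep their
  kind consistently when the third vertex is moved; these forms serve for the action of
  \<open>L\<close> and for equivariance, respectively.\<close>

lemma braid_inverse:
  "crossing1 True (crossing2 False (crossing1 False f)) = crossing2 False (crossing1 False (crossing2 True f))"
  "crossing1 False (crossing2 False (crossing1 True f)) = crossing2 True (crossing1 False (crossing2 False f))"
proof -
  note inv = crossing12_inverse[of True, simplified]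
  have "crossing1 True h = crossing2 False (crossing1 False (crossing2 True (crossing1 True (crossing2 True h))))" for h
    by (simp add: inv flip: braid)
  from this[of "crossing2 False (crossing1 False f)"]
  show "crossing1 True (crossing2 False (crossing1 False f)) = crossing2 False (crossing1 False (crossing2 True f))"
    by (simp add: inv)
  have "crossing2 True h = crossing1 False (crossing2 False (crossing1 True (crossing2 True (crossing1 True h))))" for h
    by (simp add: inv braid)
  from this[of "crossing1 False (crossing2 False f)"]
  show "crossing1 False (crossing2 False (crossing1 True f)) = crossing2 True (crossing1 False (crossing2 False f))"
    by (simp add: inv)
qed

section \<open>The transposes of the two crossings, acting on column indices\<close>

definition crossing_col :: "bool \<Rightarrow> ('n::finite idx \<Rightarrow> 'n idx \<Rightarrow> 'v::qspace) \<Rightarrow> 'n idx \<Rightarrow> 'n idx \<Rightarrow> 'v" where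
  "crossing_col e f j l = (sg (\<not> par j \<and> \<not> par l) * q powi phi l j) *\<^sub>q f l j
     - (of_bool (l < j) * \<xi>) *\<^sub>q f j l
     + (of_bool (- l < j) * sg (par j) * \<xi>) *\<^sub>q f (- j) (- l)
     + (if e then 0 else \<xi> *\<^sub>q f j l)"

lemma crossing_col_linear: "qlinear h \<Longrightarrow> h (crossing_col e f j l) = crossing_col e (\<lambda>j l. h (f j l)) j l"
  by (simp add: crossing_col_def qlinear_simps)

lemma crossing_col_sum: "crossing_col e (\<lambda>j l. \<Sum>a\<in>A. h a j l) j l = (\<Sum>a\<in>A. crossing_col e (h a) j l)"
  by (simp add: crossing_col_def scale_sum sum.distrib sum_subtractf)

lemma crossing_col_simps:
  "crossing_col e (\<lambda>i k. f i k + g i k) i k = crossing_col e f i k + crossing_col e g i k"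
  "crossing_col e (\<lambda>i k. c *\<^sub>q f i k) i k = c *\<^sub>q crossing_col e f i k"
  by (simp_all add: crossing_col_def scale_right_distrib scale_diff_right scale_scale mult_ac)

lemma crossing_col_parity:
  "crossing_col e (\<lambda>i k. h (par i \<noteq> par k) *\<^sub>q f i k) i k = h (par i \<noteq> par k) *\<^sub>q crossing_col e f i k"
proof -
  have "(par k \<noteq> par i) = (par i \<noteq> par k)" "(par (- i) \<noteq> par (- k)) = (par i \<noteq> par k)"
    by auto
  then show ?thesis
    by (simp only: crossing_col_def scale_simps mult.commute mult.left_commute if_distrib[of "\<lambda>x. _ *\<^sub>q x"] scale_zero_right)
qed

text \<open>The transpose of \<open>cross_odd\<close>. The two lemmas that follow are the
  corresponding statements for the inverse of the transpose and for the inverse crossing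
  itself.\<close>

lemma crossing_col_odd:
  "crossing_col True (\<lambda>j l. f (- j) l) j l = sg (\<not> par j) *\<^sub>q crossing_col True f j (- l)"
proof (cases j l rule: idx_cases)
  case less
  then show ?thesis
    by (cases "par j"; cases "par l"; cases "l < - j")
       (simp_all add: crossing_col_def phi_simps less_uminus_idx_iff[of j l] scale_simps scale_one
        scale_left_simps algebra_simps)
next
  case greater
  then show ?thesis
    by (cases "par j"; cases "par l"; cases "l < - j")
       (simp_all add: crossing_col_def phi_simps less_uminus_idx_iff[of j l] scale_simps scale_one
        scale_left_simps algebra_simps)
qed (cases "par l"; simp add: crossing_col_def phi_simps scale_simps scale_one scale_left_simps algebra_simps)+

lemma crossing_col_odd_inverse:
  "crossing_col False (\<lambda>j l. sg (\<not> par j) *\<^sub>q f j (- l)) j l = crossing_col False f (- j) l"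
proof (cases j l rule: idx_cases)
  case less
  then show ?thesis
    by (cases "par j"; cases "par l"; cases "l < - j")
       (simp_all add: crossing_col_def phi_simps less_uminus_idx_iff[of j l] scale_simps scale_one
        scale_left_simps algebra_simps)
next
  case greater
  then show ?thesis
    by (cases "par j"; cases "par l"; cases "l < - j")
       (simp_all add: crossing_col_def phi_simps less_uminus_idx_iff[of j l] scale_simps scale_one
        scale_left_simps algebra_simps)
qed (cases "par l"; simp add: crossing_col_def phi_simps scale_simps scale_one scale_left_simps
      power_int_minus xi_def algebra_simps)+

lemma crossing_odd_inverse:
  "crossing False (\<lambda>i k. f (- i) k) i k = sg (\<not> par i) *\<^sub>q crossing False f i (- k)"
proof (cases i k rule: idx_cases)
  case less
  then show ?thesis
    by (cases "par i"; cases "par k"; cases "k < - i")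
       (simp_all add: crossing_def cross_def phi_simps less_uminus_idx_iff[of i k] scale_simps scale_one
        scale_left_simps algebra_simps)
next
  case greater
  then show ?thesis
    by (cases "par i"; cases "par k"; cases "k < - i")
       (simp_all add: crossing_def cross_def phi_simps less_uminus_idx_iff[of i k] scale_simps scale_one
        scale_left_simps algebra_simps)
qed (cases "par k"; simp add: crossing_def cross_def phi_simps scale_simps scale_one scale_left_simps
      power_int_minus xi_def algebra_simps)+

text \<open>This is the sense in which \<open>crossing_col\<close> is a transpose: a crossing can be
  moved from one side of a contraction over two indices to the other. Renaming \<open>(j, l)\<close>
  to \<open>(l, j)\<close> or to \<open>(- j, - l)\<close> matches the sums term by term; the latter
  flips \<open>sg (par j)\<close>, which explains the plus sign in
  \<open>crossing_col\<close>.\<close>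

lemma crossing_adjoint:
  fixes B :: "'u::qspace \<Rightarrow> 'v::qspace \<Rightarrow> 'w::qspace" and g :: "'n::finite idx \<Rightarrow> 'n idx \<Rightarrow> 'u"
  assumes "qbilinear B"
  shows "(\<Sum>j\<in>UNIV. \<Sum>l\<in>UNIV. B (crossing_col e g j l) (f j l))
    = (\<Sum>j\<in>UNIV. \<Sum>l\<in>UNIV. B (g j l) (crossing e f j l))"
proof -
  note L = qlinear_simps[OF assms[unfolded qbilinear_def, THEN conjunct1, rule_format]]
    qlinear_simps[OF assms[unfolded qbilinear_def, THEN conjunct2, rule_format]]
  have swap: "(\<Sum>j\<in>UNIV. \<Sum>l\<in>UNIV. h j l) = (\<Sum>j\<in>UNIV. \<Sum>l\<in>UNIV. h l j)" for h :: "'n idx \<Rightarrow> 'n idx \<Rightarrow> 'w"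
    by (rule sum.swap)
  have neg1: "(\<Sum>j\<in>UNIV. h j) = (\<Sum>j\<in>UNIV. h (- j))" for h :: "'n idx \<Rightarrow> 'w"
    by (rule sum.reindex_bij_witness[of _ uminus uminus]) simp_all
  have neg: "(\<Sum>j\<in>UNIV. \<Sum>l\<in>UNIV. h j l) = (\<Sum>j\<in>UNIV. \<Sum>l\<in>UNIV. h (- j) (- l))" for h :: "'n idx \<Rightarrow> 'n idx \<Rightarrow> 'w"
    by (subst neg1, rule sum.cong[OF refl], rule neg1)
  have 1: "(\<Sum>j\<in>UNIV. \<Sum>l\<in>UNIV. (sg (\<not> par j \<and> \<not> par l) * q powi phi l j) *\<^sub>q B (g l j) (f j l))
      = (\<Sum>j\<in>UNIV. \<Sum>l\<in>UNIV. (sg (\<not> par j \<and> \<not> par l) * q powi phi j l) *\<^sub>q B (g j l) (f l j))"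
    by (subst swap) (simp add: conj_commute)
  have sg_not: "sg (\<not> p) = - sg p" for p
    by (simp add: sg_def)
  have e: "- l < j \<longleftrightarrow> - j < l" for j l :: "'n idx"
    by (transfer, force)
  have 2: "(\<Sum>j\<in>UNIV. \<Sum>l\<in>UNIV. (of_bool (- l < j) * sg (par j) * \<xi>) *\<^sub>q B (g (- j) (- l)) (f j l))
      = - (\<Sum>j\<in>UNIV. \<Sum>l\<in>UNIV. (of_bool (l < - j) * sg (par j) * \<xi>) *\<^sub>q B (g j l) (f (- j) (- l)))"
    by (subst neg) (simp add: sg_not scale_minus_left flip: sum_negf)
  show ?thesis
    by (cases e)
      (simp_all add: crossing_def cross_def crossing_col_def L sum.distrib sum_subtractf 1 2)
qed

text \<open>Both sides are the matrix entry of the crossing with row \<open>(b, d)\<close> and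
  column \<open>(j, l)\<close>. Read as a quadratic relation, this says that the unit matrix is a
  solution; it is used for the counit and for strands passing 1.\<close>

lemma crossing_delta:
  fixes x :: "'v::qspace"
  shows "crossing e (\<lambda>b d. if b = j \<and> d = l then x else 0) b d
    = crossing_col e (\<lambda>j l. if b = j \<and> d = l then x else 0) j l"
proof -
  have 1: "(sg (\<not> par j \<and> \<not> par l) * q powi phi l j) *\<^sub>q (if b = l \<and> d = j then x else 0)
      = (sg (\<not> par b \<and> \<not> par d) * q powi phi b d) *\<^sub>q (if d = j \<and> b = l then x else 0)"
    by (simp add: conj_commute)
  have 2: "(of_bool (l < j) * \<xi>) *\<^sub>q (if b = j \<and> d = l then x else 0)
      = (of_bool (d < b) * \<xi>) *\<^sub>q (if b = j \<and> d = l then x else 0)"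
    by simp
  have 3: "(of_bool (- l < j) * sg (par j) * \<xi>) *\<^sub>q (if b = - j \<and> d = - l then x else 0)
      = - ((of_bool (d < - b) * sg (par b) * \<xi>) *\<^sub>q (if - b = j \<and> - d = l then x else 0))"
    by (cases "b = - j \<and> d = - l") (auto simp: sg_def scale_minus_left)
  show ?thesis
    unfolding crossing_col_def crossing_def cross_def 1 2 3 by simp
qed

section \<open>The quadratic relations\<close>

lemma sum_strict_pairs:
  "(\<Sum>(i, j) | i < j. h i j * matrix_unit i j c d) = of_bool (c < d) * h c (d :: 'n::finite idx)"
proof -
  have "(\<Sum>(i, j) | i < j. h i j * matrix_unit i j c d)
      = (\<Sum>p\<in>{(i, j). i < j}. if p = (c, d) then h c d else 0)"
    by (rule sum.cong) (auto simp: matrix_unit_def)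
  also have "\<dots> = of_bool (c < d) * h c d"
    by (subst sum.delta) (simp_all)
  finally show ?thesis .
qed

lemma sum_delta2:
  "(\<Sum>j\<in>UNIV. \<Sum>l\<in>UNIV. if j = a then if l = b then x else 0 else 0) = (x :: 'v::comm_monoid_add)"
  for a :: "'i::finite" and b :: "'j::finite"
proof -
  have "(\<Sum>l\<in>UNIV. if j = a then if l = b then x else 0 else 0) = (if j = a then x else 0)" for j
    by (cases "j = a") simp_all
  then show ?thesis by simp
qed

lemma sum_diagonal_pairs:
  "(\<Sum>i\<in>UNIV. \<Sum>j\<in>UNIV. h i j * (matrix_unit i i a b * matrix_unit j j c d))
    = of_bool (a = b \<and> c = d) * h (a :: 'm::finite idx) (c :: 'n::finite idx)"
proof -
  have "h i j * (matrix_unit i i a b * matrix_unit j j c d)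
      = (if i = a then if j = c then of_bool (a = b \<and> c = d) * h a c else 0 else 0)" for i j
    by (auto simp: matrix_unit_def)
  then show ?thesis by (simp only: sum_delta2)
qed

lemma S_mat_eq: "S_mat a b c d = of_bool (a = b \<and> c = d) * q powi phi a c
    + of_bool (c < d) * \<xi> * sg (par c) * (of_bool (a = d \<and> b = c) + of_bool (a = - d \<and> b = - c))"
  using sum_strict_pairs[of "\<lambda>i j. sg (par i) * (matrix_unit j i a b + matrix_unit (- j) (- i) a b)" c d]
  unfolding S_mat_def sum_diagonal_pairs by (simp add: matrix_unit_def mult_ac)

lemma S_inv_mat_eq: "S_inv_mat a b c d = of_bool (a = b \<and> c = d) * q powi (- phi a c)
    - of_bool (c < d) * \<xi> * sg (par c) * (of_bool (a = d \<and> b = c) + of_bool (a = - d \<and> b = - c))"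
  using sum_strict_pairs[of "\<lambda>i j. sg (par i) * (matrix_unit j i a b + matrix_unit (- j) (- i) a b)" c d]
  unfolding S_inv_mat_def sum_diagonal_pairs by (simp add: matrix_unit_def mult_ac)

lemma epar_S_mat: "S_mat a b c d \<noteq> 0 \<Longrightarrow> epar a b = epar c d"
proof (rule ccontr)
  assume "S_mat a b c d \<noteq> 0" "epar a b \<noteq> epar c d"
  moreover have "\<not> (a = b \<and> c = d)" "\<not> (a = d \<and> b = c)" "\<not> (a = - d \<and> b = - c)"
    using calculation(2) by (auto simp: epar_def)
  ultimately show False unfolding S_mat_eq by (simp only: of_bool_eq) simp
qed

lemma S_mat_row:
  fixes f :: "'n::finite idx \<Rightarrow> 'n idx \<Rightarrow> 'v::qspace"
  shows "(\<Sum>j\<in>UNIV. \<Sum>l\<in>UNIV. S_mat i j k l *\<^sub>q f j l)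
    = q powi phi i k *\<^sub>q f i k + (of_bool (k < i) * \<xi> * sg (par k)) *\<^sub>q f k i
      + (of_bool (k < - i) * \<xi> * sg (par k)) *\<^sub>q f (- k) (- i)"
proof -
  have "S_mat i j k l *\<^sub>q f j l =
      (if j = i then if l = k then q powi phi i k *\<^sub>q f i k else 0 else 0)
      + (if j = k then if l = i then (of_bool (k < i) * \<xi> * sg (par k)) *\<^sub>q f k i else 0 else 0)
      + (if j = - k then if l = - i then (of_bool (k < - i) * \<xi> * sg (par k)) *\<^sub>q f (- k) (- i) else 0 else 0)"
    for j l
    unfolding S_mat_eq by (auto simp: scale_left_distrib)
  then show ?thesis by (simp only: sum.distrib sum_delta2)
qed

lemma S_mat_col:
  fixes f :: "'n::finite idx \<Rightarrow> 'n idx \<Rightarrow> 'v::qspace"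
  shows "(\<Sum>j\<in>UNIV. \<Sum>l\<in>UNIV. S_mat j m l p *\<^sub>q f j l)
    = q powi phi m p *\<^sub>q f m p + (of_bool (m < p) * \<xi> * sg (par m)) *\<^sub>q f p m
      + (of_bool (- m < p) * \<xi> * sg (\<not> par m)) *\<^sub>q f (- p) (- m)"
proof -
  have "S_mat j m l p *\<^sub>q f j l =
      (if j = m then if l = p then q powi phi m p *\<^sub>q f m p else 0 else 0)
      + (if j = p then if l = m then (of_bool (m < p) * \<xi> * sg (par m)) *\<^sub>q f p m else 0 else 0)
      + (if j = - p then if l = - m then (of_bool (- m < p) * \<xi> * sg (\<not> par m)) *\<^sub>q f (- p) (- m) else 0 else 0)"
    for j l
    unfolding S_mat_eq by (auto simp: scale_left_distrib)
  then show ?thesis by (simp only: sum.distrib sum_delta2)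
qed

text \<open>
  The signs turn the Koszul products of the matrices \<open>F\<close> and \<open>G\<close>, in which both relators are
  written, into products of plain matrices.
\<close>

definition quad :: "('i::graded \<Rightarrow> 'j::graded \<Rightarrow> 'a) \<Rightarrow> ('i \<Rightarrow> 'j \<Rightarrow> 'a) \<Rightarrow> 'i \<Rightarrow> 'i \<Rightarrow> 'j \<Rightarrow> 'j \<Rightarrow> 'a::superalgebra" where
  "quad F G i k j l = sg (((par j \<and> par l) \<noteq> (par j \<and> par k)) \<noteq>
     (((par i \<and> par j) \<noteq> (par k \<and> par l)) \<noteq> (par i \<noteq> par l))) *\<^sub>q (F i j * G k l)"

text \<open>The sign-free form of the defining matrix relations of both algebras. \<open>Y\<close>
  need not be a product of two matrices, so that solutions can be composed by tensor products, as in
  \<open>quad_relation_tens\<close>.\<close>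

definition quad_relation :: "('i::finite idx \<Rightarrow> 'i idx \<Rightarrow> 'j::finite idx \<Rightarrow> 'j idx \<Rightarrow> 'v::qspace) \<Rightarrow> 'i idx \<Rightarrow> 'i idx \<Rightarrow> 'j idx \<Rightarrow> 'j idx \<Rightarrow> bool" where
  "quad_relation Y i k j l \<longleftrightarrow>
     crossing_col True (Y i k) j l = crossing True (\<lambda>i k. Y i k j l) i k"

text \<open>The entries of F F S with all Koszul signs made explicit. They turn out to be the same
  whether the coefficient algebra is the first or the third tensor factor.\<close>

definition S_right :: "('i::graded \<Rightarrow> 'j::finite idx \<Rightarrow> 'a::superalgebra) \<Rightarrow> 'i \<Rightarrow> 'j idx \<Rightarrow> 'i \<Rightarrow> 'j idx \<Rightarrow> 'a" where
  "S_right F i j k l = (\<Sum>j'\<in>UNIV. \<Sum>l'\<in>UNIV. S_mat j' j l' l *\<^sub>q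
     sg ((epar k l' \<and> epar j' j) \<noteq> (epar k l' \<and> epar i j')) *\<^sub>q (F i j' * F k l'))"

text \<open>Two matrices are allowed because the condition on the braiding involves the generator
  matrices of two different algebras.\<close>

definition S_left :: "('i::finite idx \<Rightarrow> 'j::graded \<Rightarrow> 'a::superalgebra) \<Rightarrow> ('i idx \<Rightarrow> 'l::graded \<Rightarrow> 'a)
    \<Rightarrow> 'i idx \<Rightarrow> 'j \<Rightarrow> 'i idx \<Rightarrow> 'l \<Rightarrow> 'a" where
  "S_left F G i j k l = (\<Sum>j'\<in>UNIV. \<Sum>l'\<in>UNIV. S_mat i j' k l' *\<^sub>q
     sg (epar k l' \<and> epar j' j) *\<^sub>q (G l' l * F j' j))"

text \<open>The sign by which the two sides of the matrix relation both differ from their sign-free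
  forms; being common to them, it cancels.\<close>

definition quad_sign :: "'i::graded \<Rightarrow> 'j::graded \<Rightarrow> 'i \<Rightarrow> 'j \<Rightarrow> cq" where
  "quad_sign i j k l = sg ((((par i \<and> par k) \<noteq> (par i \<and> par l)) \<noteq> ((par i \<and> par j) \<noteq> (par k \<and> par l)))
     \<noteq> (((par j \<and> par l) \<noteq> par i) \<noteq> (\<not> par j)))"

text \<open>Up to signs S is the crossing composed with the flip, hence the columns appear in the
  order \<open>l j\<close>.\<close>

lemma S_right_quad: "S_right F i j k l = quad_sign i j k l *\<^sub>q crossing_col True (quad F F i k) l j"
  unfolding S_right_def S_mat_col
  by (cases "par i"; cases "par j"; cases "par k"; cases "par l")
    (simp_all add: crossing_col_def quad_def quad_sign_def epar_def scale_simps scale_one scale_minus_left)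

lemma S_left_quad: "S_left F F i j k l = quad_sign i j k l *\<^sub>q crossing True (\<lambda>i k. quad F F i k l j) i k"
  unfolding S_left_def S_mat_row
  by (cases "par i"; cases "par j"; cases "par k"; cases "par l")
    (simp_all add: crossing_def cross_def quad_def quad_sign_def epar_def scale_simps scale_one scale_minus_left)

lemma S_left_eq_S_right_iff: "S_right F i j k l = S_left F F i j k l \<longleftrightarrow> quad_relation (quad F F) i k l j"
  unfolding S_right_quad S_left_quad quad_relation_def quad_sign_def
  by (metis scale_sg_cancel)

section \<open>Koszul products of matrices in terms of entries\<close>

lemma scalar_mat_mult:
  "scalar_mat M i j k l * x = M i j k l *\<^sub>q (x :: 'a::superalgebra)"
  "x * scalar_mat M i j k l = M i j k l *\<^sub>q x"
  "twist p (scalar_mat M i j k l) = M i j k l *\<^sub>q (1 :: 'a)"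
  by (simp_all add: scalar_mat_def scale_mult_left scale_mult_right twist_scale twist_one)

text \<open>S is even: signs under a factor \<open>S_mat a b c d\<close> only have to be compared
  when the two matrix units have the same parity.\<close>

lemma S_mat_cong:
  assumes "epar a b = epar c d \<Longrightarrow> x = y"
  shows "S_mat a b c d *\<^sub>q x = S_mat a b c d *\<^sub>q (y :: 'v::qspace)"
  using assms epar_S_mat[of a b c d] by (cases "S_mat a b c d = 0") auto

lemma sum_if_eq:
  "(\<Sum>j\<in>UNIV. if j = a then f j else 0) = f (a :: 'i::finite)"
  "(\<Sum>j\<in>UNIV. if a = j then f j else 0) = f (a :: 'i::finite)"
  by simp_all

lemma fst_snd_mult3:
  fixes F :: "'i::finite idx \<Rightarrow> 'j::finite idx \<Rightarrow> 'a::superalgebra" and G :: "'k::finite idx \<Rightarrow> 'l::finite idx \<Rightarrow> 'a"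
  assumes F: "\<And>i j. part (epar i j) (F i j) = F i j"
  shows "(fst_mat F \<cdot>\<^sub>3 snd_mat G) i j k l = sg (epar i j \<and> epar k l) *\<^sub>q (F i j * G k l)"
proof -
  have "(fst_mat F \<cdot>\<^sub>3 snd_mat G) i j k l = (\<Sum>j'\<in>UNIV. \<Sum>l'\<in>UNIV.
      if j' = j then if l' = k then twist (epar k l) (F i j) * G k l else 0 else 0)"
    unfolding mat_mult3_def
    by (intro sum.cong refl) (auto simp: fst_mat_def snd_mat_def epar_same scale_one twist_simps)
  then show ?thesis
    by (simp add: sum_delta2 twist_hom[OF F] scale_mult_left conj_commute)
qed

lemma S_left_mult3:
  fixes F :: "'i::finite idx \<Rightarrow> 'j::finite idx \<Rightarrow> 'a::superalgebra" and G :: "'i idx \<Rightarrow> 'l::finite idx \<Rightarrow> 'a"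
  assumes G: "\<And>i j. part (epar i j) (G i j) = G i j"
  shows "(scalar_mat S_mat \<cdot>\<^sub>3 snd_mat G \<cdot>\<^sub>3 fst_mat F) i j k l = S_left F G i j k l"
proof -
  have 1: "(scalar_mat S_mat \<cdot>\<^sub>3 snd_mat G) i j k l = (\<Sum>l'\<in>UNIV. S_mat i j k l' *\<^sub>q G l' l)"
    for i j k :: "'i idx" and l
  proof -
    have "(scalar_mat S_mat \<cdot>\<^sub>3 snd_mat G) i j k l = (\<Sum>j'\<in>UNIV. if j' = j then
        (\<Sum>l'\<in>UNIV. S_mat i j k l' *\<^sub>q G l' l) else 0)"
      unfolding mat_mult3_def scalar_mat_mult
      by (intro sum.cong refl) (auto simp: snd_mat_def epar_same scale_one scale_mult_left)
    then show ?thesis by simp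
  qed
  have "(scalar_mat S_mat \<cdot>\<^sub>3 snd_mat G \<cdot>\<^sub>3 fst_mat F) i j k l = (\<Sum>j'\<in>UNIV. \<Sum>l''\<in>UNIV. if l'' = l then
      (sg (epar k l \<and> epar j' j) *\<^sub>q ((\<Sum>l'\<in>UNIV. S_mat i j' k l' *\<^sub>q twist (epar j' j) (G l' l)) * F j' j)) else 0)"
    unfolding mat_mult3_def[of "scalar_mat S_mat \<cdot>\<^sub>3 snd_mat G"] 1
    by (intro sum.cong refl) (auto simp: fst_mat_def twist_simps epar_same)
  also have "\<dots> = S_left F G i j k l"
    unfolding sum_if_eq S_left_def sum_distrib_right scale_sum twist_hom[OF G]
    unfolding scale_mult_left scale_mult_right scale_scale mult.commute[of "sg (epar k l \<and> _)"] mult.assoc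
    unfolding scale_scale[symmetric]
  proof (intro sum.cong refl S_mat_cong)
    fix j' l' :: "'i idx"
    assume e: "epar i j' = epar k l'"
    show "sg (epar j' j \<and> epar l' l) *\<^sub>q sg (epar k l \<and> epar j' j) *\<^sub>q (G l' l * F j' j)
      = sg (epar k l' \<and> epar j' j) *\<^sub>q (G l' l * F j' j)"
      unfolding scale_scale sg_mult by (rule arg_cong[where f = "\<lambda>p. sg p *\<^sub>q _"]) (auto simp: epar_def)
  qed
  finally show ?thesis .
qed

context
  fixes F :: "'i::finite idx \<Rightarrow> 'j::finite idx \<Rightarrow> 'a::superalgebra"
  assumes F: "\<And>i j. part (epar i j) (F i j) = F i j"
begin

lemma fst_snd_mult1: "(fst_mat F \<cdot>\<^sub>1 snd_mat F) i j k l = sg (epar i j \<and> epar k l) *\<^sub>q (F i j * F k l)"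
proof -
  have "(fst_mat F \<cdot>\<^sub>1 snd_mat F) i j k l = (\<Sum>j'\<in>UNIV. \<Sum>l'\<in>UNIV.
      if j' = j then if l' = k then F i j * twist (epar i j) (F k l) else 0 else 0)"
    unfolding mat_mult1_def
    by (intro sum.cong refl) (auto simp: fst_mat_def snd_mat_def epar_same scale_one twist_simps)
  then show ?thesis
    by (simp add: sum_delta2 twist_hom[OF F] scale_mult_right)
qed

lemma S_right_mult1: "(fst_mat F \<cdot>\<^sub>1 snd_mat F \<cdot>\<^sub>1 scalar_mat S_mat) i j k l = S_right F i j k l"
  unfolding mat_mult1_def[of "fst_mat F \<cdot>\<^sub>1 snd_mat F"] S_right_def fst_snd_mult1
  by (intro sum.cong refl)
    (simp only: scalar_mat_mult scale_mult_right mult_1_right, simp only: scale_scale mult_ac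
      conj_commute[of "epar i _"] flip: sg_mult)

lemma S_right_mult3: "(fst_mat F \<cdot>\<^sub>3 snd_mat F \<cdot>\<^sub>3 scalar_mat S_mat) i j k l = S_right F i j k l"
  unfolding mat_mult3_def[of "fst_mat F \<cdot>\<^sub>3 snd_mat F"] S_right_def scalar_mat_mult fst_snd_mult3[OF F]
proof (intro sum.cong refl)
  fix j' l'
  show "sg (epar k l' \<and> epar j' j) *\<^sub>q S_mat j' j l' l *\<^sub>q twist (epar j' j \<noteq> epar l' l) (sg (epar i j' \<and> epar k l') *\<^sub>q (F i j' * F k l'))
    = S_mat j' j l' l *\<^sub>q sg ((epar k l' \<and> epar j' j) \<noteq> (epar k l' \<and> epar i j')) *\<^sub>q (F i j' * F k l')"
    unfolding scale_scale mult.commute[of _ "S_mat _ _ _ _"]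
    unfolding scale_scale[symmetric]
    by (rule S_mat_cong) (simp add: twist_False scale_scale conj_commute[of "epar i _"] del: not_iff flip: sg_mult)
qed

lemma S_left_mult1: "(scalar_mat S_mat \<cdot>\<^sub>1 snd_mat F \<cdot>\<^sub>1 fst_mat F) i j k l = S_left F F i j k l"
proof -
  have 1: "(scalar_mat S_mat \<cdot>\<^sub>1 snd_mat F) i j k l = (\<Sum>l'\<in>UNIV. S_mat i j k l' *\<^sub>q F l' l)"
    for i j k :: "'i idx" and l
  proof -
    have "(scalar_mat S_mat \<cdot>\<^sub>1 snd_mat F) i j k l = (\<Sum>j'\<in>UNIV. if j' = j then
        (\<Sum>l'\<in>UNIV. S_mat i j k l' *\<^sub>q twist (epar i j \<noteq> epar k l') (F l' l)) else 0)"
      unfolding mat_mult1_def scalar_mat_mult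
      by (intro sum.cong refl) (auto simp: snd_mat_def epar_same scale_one twist_simps)
    also have "\<dots> = (\<Sum>l'\<in>UNIV. S_mat i j k l' *\<^sub>q F l' l)"
      unfolding sum_if_eq by (intro sum.cong refl S_mat_cong) (simp add: twist_False)
    finally show ?thesis .
  qed
  have "(scalar_mat S_mat \<cdot>\<^sub>1 snd_mat F \<cdot>\<^sub>1 fst_mat F) i j k l = (\<Sum>j'\<in>UNIV. \<Sum>l''\<in>UNIV. if l'' = l then
      (sg (epar k l \<and> epar j' j) *\<^sub>q ((\<Sum>l'\<in>UNIV. S_mat i j' k l' *\<^sub>q F l' l) * twist (epar i j' \<noteq> epar k l) (F j' j))) else 0)"
    unfolding mat_mult1_def[of "scalar_mat S_mat \<cdot>\<^sub>1 snd_mat F"] 1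
    by (intro sum.cong refl) (auto simp: fst_mat_def twist_simps)
  also have "\<dots> = S_left F F i j k l"
    unfolding sum_if_eq S_left_def sum_distrib_right scale_sum
  proof (intro sum.cong refl)
    fix j' l' :: "'i idx"
    have "sg (epar k l \<and> epar j' j) *\<^sub>q (S_mat i j' k l' *\<^sub>q F l' l * twist (epar i j' \<noteq> epar k l) (F j' j))
      = S_mat i j' k l' *\<^sub>q sg ((epar k l \<and> epar j' j) \<noteq> ((epar i j' \<noteq> epar k l) \<and> epar j' j)) *\<^sub>q (F l' l * F j' j)"
      by (simp only: twist_hom[OF F] scale_mult_left scale_mult_right scale_scale mult_ac flip: sg_mult)
    also have "\<dots> = S_mat i j' k l' *\<^sub>q sg (epar k l' \<and> epar j' j) *\<^sub>q (F l' l * F j' j)"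
      by (intro S_mat_cong arg_cong[where f = "\<lambda>p. sg p *\<^sub>q _"]) blast
    finally show "sg (epar k l \<and> epar j' j) *\<^sub>q (S_mat i j' k l' *\<^sub>q F l' l * twist (epar i j' \<noteq> epar k l) (F j' j))
      = S_mat i j' k l' *\<^sub>q sg (epar k l' \<and> epar j' j) *\<^sub>q (F l' l * F j' j)" .
  qed
  finally show ?thesis .
qed

end

lemma crossing_odd:
  "crossing True (\<lambda>i k. sg (\<not> par i) *\<^sub>q f i (- k)) i k = crossing True f (- i) k"
  by (simp add: crossing_def cross_odd)

text \<open>
  A relation between given columns implies those between their opposites, because the crossing
  commutes with the odd endomorphism of one strand and its inverse with that of the other.
\<close>

context
  fixes T :: "'i::finite idx \<Rightarrow> 'j::finite idx \<Rightarrow> 'a::superalgebra"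
  assumes sym: "\<And>i j. T (- i) (- j) = T i j"
begin

private lemma sym': "T i (- j) = T (- i) j"
  using sym[of "- i" j] by simp

private lemma quad_uminus:
  "quad T T i k (- j) l = (- sg ((par i \<noteq> par k) \<noteq> (par j \<noteq> par l))) *\<^sub>q quad T T (- i) k j l"
  "quad T T i k j (- l) = (- sg (par k \<noteq> par l)) *\<^sub>q quad T T i (- k) j l"
  unfolding quad_def sym'
  by (cases "par i"; cases "par j"; cases "par k"; cases "par l"; simp add: scale_scale)+

private lemma quad_relation_uminus_second:
  assumes "quad_relation (quad T T) (- i) k j l"
  shows "quad_relation (quad T T) i k j (- l)"
proof -
  let ?Y = "quad T T"
  \<comment> \<open>The signs of \<open>quad_uminus\<close> are written as functions of a sum of two
    parities, the form in which \<open>crossing_col_parity\<close> and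
    \<open>crossing_parity\<close> can move them outside.\<close>
  let ?h = "\<lambda>p. - sg ((par i \<noteq> par k) \<noteq> p)" and ?h' = "\<lambda>p. sg (p \<noteq> par l)"
  have "crossing_col True (?Y i k) j (- l) = sg (\<not> par j) *\<^sub>q crossing_col True (\<lambda>j l. ?Y i k (- j) l) j l"
    by (simp add: crossing_col_odd)
  also have "(\<lambda>j l. ?Y i k (- j) l) = (\<lambda>j l. ?h (par j \<noteq> par l) *\<^sub>q ?Y (- i) k j l)"
    unfolding quad_uminus ..
  also have "crossing_col True \<dots> j l = ?h (par j \<noteq> par l) *\<^sub>q crossing_col True (?Y (- i) k) j l"
    by (rule crossing_col_parity)
  also have "crossing_col True (?Y (- i) k) j l = crossing True (\<lambda>i k. ?Y i k j l) (- i) k"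
    using assms unfolding quad_relation_def .
  finally have col: "crossing_col True (?Y i k) j (- l) = (sg (\<not> par j) * ?h (par j \<noteq> par l)) *\<^sub>q
    crossing True (\<lambda>i k. ?Y i k j l) (- i) k" by (simp only: scale_scale)
  have "- sg (par k \<noteq> par l) = ?h' (par i \<noteq> par k) * sg (\<not> par i)" for i k :: "'i idx"
    by (cases "par i"; cases "par k"; cases "par l"; simp)
  then have "(\<lambda>i k. ?Y i k j (- l)) = (\<lambda>i k. ?h' (par i \<noteq> par k) *\<^sub>q sg (\<not> par i) *\<^sub>q ?Y i (- k) j l)"
    unfolding quad_uminus by (simp add: scale_scale)
  then have "crossing True (\<lambda>i k. ?Y i k j (- l)) i k
    = crossing True (\<lambda>i k. ?h' (par i \<noteq> par k) *\<^sub>q sg (\<not> par i) *\<^sub>q ?Y i (- k) j l) i k" by (simp only:)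
  also have "\<dots> = ?h' (par i \<noteq> par k) *\<^sub>q crossing True (\<lambda>i k. sg (\<not> par i) *\<^sub>q ?Y i (- k) j l) i k"
    by (rule crossing_parity)
  also have "crossing True (\<lambda>i k. sg (\<not> par i) *\<^sub>q ?Y i (- k) j l) i k = crossing True (\<lambda>i k. ?Y i k j l) (- i) k"
    by (rule crossing_odd)
  finally have row: "crossing True (\<lambda>i k. ?Y i k j (- l)) i k = ?h' (par i \<noteq> par k) *\<^sub>q
    crossing True (\<lambda>i k. ?Y i k j l) (- i) k" .
  have "sg (\<not> par j) * ?h (par j \<noteq> par l) = ?h' (par i \<noteq> par k)"
    by (cases "par i"; cases "par j"; cases "par k"; cases "par l"; simp)
  then show ?thesis unfolding quad_relation_def col row by (simp only:)
qed

private lemma quad_relation_uminus_first: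
  assumes "quad_relation (quad T T) i (- k) j l"
  shows "quad_relation (quad T T) i k (- j) l"
proof -
  let ?Y = "quad T T"
  let ?h = "\<lambda>p. - sg ((par i \<noteq> par k) \<noteq> p)" and ?h' = "\<lambda>p. sg (p \<noteq> par k)"
  \<comment> \<open>Both sides of the relation change by the same summand
    \<open>\<xi> *\<^sub>q ?Y i k j l\<close>. The inverse crossings are needed here because they
    carry the odd endomorphism of the other strand.\<close>
  have inverse: "quad_relation ?Y i k j l \<longleftrightarrow>
      crossing_col False (?Y i k) j l = crossing False (\<lambda>i k. ?Y i k j l) i k" for i k j l
    by (simp add: quad_relation_def crossing_col_def crossing_def)
  have "crossing_col False (?Y i k) (- j) l = crossing_col False (\<lambda>j l. sg (\<not> par j) *\<^sub>q ?Y i k j (- l)) j l"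
    by (simp only: crossing_col_odd_inverse)
  also have "(\<lambda>j l. sg (\<not> par j) *\<^sub>q ?Y i k j (- l)) = (\<lambda>j l. ?h' (par j \<noteq> par l) *\<^sub>q ?Y i (- k) j l)"
  proof -
    have "sg (\<not> par j) * (- sg (par k \<noteq> par l)) = ?h' (par j \<noteq> par l)" for j l :: "'j idx"
      by (cases "par j"; cases "par k"; cases "par l"; simp)
    then show ?thesis unfolding quad_uminus scale_scale by simp
  qed
  also have "crossing_col False \<dots> j l = ?h' (par j \<noteq> par l) *\<^sub>q crossing_col False (?Y i (- k)) j l"
    by (rule crossing_col_parity)
  also have "crossing_col False (?Y i (- k)) j l = crossing False (\<lambda>i k. ?Y i k j l) i (- k)"
    using assms unfolding inverse .
  finally have col: "crossing_col False (?Y i k) (- j) l = ?h' (par j \<noteq> par l) *\<^sub>q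
    crossing False (\<lambda>i k. ?Y i k j l) i (- k)" .
  let ?g = "\<lambda>p. - sg (p \<noteq> (par j \<noteq> par l))"
  have "crossing False (\<lambda>i k. ?Y i k (- j) l) i k
    = crossing False (\<lambda>i k. ?g (par i \<noteq> par k) *\<^sub>q ?Y (- i) k j l) i k" unfolding quad_uminus ..
  also have "\<dots> = ?g (par i \<noteq> par k) *\<^sub>q crossing False (\<lambda>i k. ?Y (- i) k j l) i k"
    by (rule crossing_parity)
  also have "crossing False (\<lambda>i k. ?Y (- i) k j l) i k = sg (\<not> par i) *\<^sub>q crossing False (\<lambda>i k. ?Y i k j l) i (- k)"
    by (rule crossing_odd_inverse)
  finally have row: "crossing False (\<lambda>i k. ?Y i k (- j) l) i k = (?g (par i \<noteq> par k) * sg (\<not> par i)) *\<^sub>q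
    crossing False (\<lambda>i k. ?Y i k j l) i (- k)" by (simp only: scale_scale)
  have "?h' (par j \<noteq> par l) = ?g (par i \<noteq> par k) * sg (\<not> par i)"
    by (cases "par i"; cases "par j"; cases "par k"; cases "par l"; simp)
  then show ?thesis unfolding inverse col row by (simp only:)
qed

lemma quad_relation_extend:
  assumes "\<And>i k j l. par j \<Longrightarrow> par l \<Longrightarrow> quad_relation (quad T T) i k j l"
  shows "quad_relation (quad T T) i k j l"
proof -
  have 1: "quad_relation (quad T T) i k j l" if "par l" for i k j l
    using that assms[of j l i k] quad_relation_uminus_first[OF assms[of "- j" l i "- k"]]
    by (cases "par j") simp_all
  show ?thesis
    using 1[of l i k j] quad_relation_uminus_second[OF 1[of "- l" "- i" k j]]
    by (cases "par l") simp_all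
qed

end

lemma quad_negative:
  assumes "par j" "par l"
  shows "quad F G i k j l = F i j * G k l"
  using assms by (cases "par i"; cases "par k"; simp add: quad_def scale_one)

lemma crossing_col_negative:
  assumes "par j" "par l"
  shows "crossing_col e f j l = q powi phi l j *\<^sub>q f l j - (of_bool (l < j) * \<xi>) *\<^sub>q f j l + (if e then 0 else \<xi> *\<^sub>q f j l)"
proof -
  have "\<not> - l < j" using assms by (transfer, force)
  then show ?thesis using assms by (simp add: crossing_col_def)
qed

text \<open>For two negative columns the signs in \<open>quad\<close> and the term with opposite
  columns disappear. What is left is the relation of the presentation by the generators with
  negative first index.\<close>

lemma quad_relation_negative:
  assumes "par j" "par l"
  shows "quad_relation (quad F F) i k j l \<longleftrightarrow>
    q powi phi l j *\<^sub>q (F i l * F k j) - (of_bool (l < j) * \<xi>) *\<^sub>q (F i j * F k l)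
    = crossing True (\<lambda>i k. F i j * F k l) i k"
  unfolding quad_relation_def crossing_col_negative[OF assms] quad_negative[OF assms]
    quad_negative[OF assms(2,1)] by simp

lemma superalg_hom_S_right:
  "superalg_hom h \<Longrightarrow> h (S_right F i j k l) = S_right (\<lambda>i j. h (F i j)) i j k l"
  by (simp add: S_right_def qlinear_simps[OF superalg_homD(1)] superalg_homD(4))

lemma superalg_hom_S_left:
  "superalg_hom h \<Longrightarrow> h (S_left F G i j k l) = S_left (\<lambda>i j. h (F i j)) (\<lambda>i j. h (G i j)) i j k l"
  by (simp add: S_left_def qlinear_simps[OF superalg_homD(1)] superalg_homD(4))

section \<open>The presentations\<close>

text \<open>Stated for any homomorphism from the free superalgebra, so that it has two uses: the
  quotient map shows that the generators satisfy the relations, and \<open>free_lift\<close> gives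
  the universal property.\<close>

lemma lgen_relators:
  fixes h :: "'n::finite lgen free \<Rightarrow> 'a::superalgebra"
  assumes h: "superalg_hom h"
  shows "(\<forall>r\<in>relators. h r = 0) \<longleftrightarrow>
    (\<forall>i j. j < i \<longrightarrow> h (L_free i j) = 0) \<and>
    (\<forall>i. h (L_free i i) * h (L_free (- i) (- i)) = 1) \<and>
    (\<forall>i k j l. quad_relation (quad (\<lambda>i j. h (L_free i j)) (\<lambda>i j. h (L_free i j))) i k j l)"
proof -
  have "h ((fst_mat L_free \<cdot>\<^sub>1 snd_mat L_free \<cdot>\<^sub>1 scalar_mat S_mat) i j k l
      - (scalar_mat S_mat \<cdot>\<^sub>1 snd_mat L_free \<cdot>\<^sub>1 fst_mat L_free) i j k l) = 0 \<longleftrightarrow>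
      quad_relation (quad (\<lambda>i j. h (L_free i j)) (\<lambda>i j. h (L_free i j))) i k l j" for i j k l
    by (simp add: S_right_mult1[of L_free, OF part_L_free] S_left_mult1[of L_free, OF part_L_free] qlinear_simps[OF superalg_homD(1)[OF h]]
        superalg_hom_S_left[OF h] superalg_hom_S_right[OF h] S_left_eq_S_right_iff)
  moreover have "h (L_free i i * L_free (- i) (- i) - 1) = 0 \<longleftrightarrow> h (L_free i i) * h (L_free (- i) (- i)) = 1" for i
    by (simp add: qlinear_simps[OF superalg_homD(1)[OF h]] superalg_homD[OF h])
  moreover have "(\<forall>r\<in>relators. h r = 0) \<longleftrightarrow> (\<forall>i j. j < i \<longrightarrow> h (L_free i j) = 0) \<and>
      (\<forall>i. h (L_free i i * L_free (- i) (- i) - 1) = 0) \<and>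
      (\<forall>i j k l. h ((fst_mat L_free \<cdot>\<^sub>1 snd_mat L_free \<cdot>\<^sub>1 scalar_mat S_mat) i j k l
        - (scalar_mat S_mat \<cdot>\<^sub>1 snd_mat L_free \<cdot>\<^sub>1 fst_mat L_free) i j k l) = 0)"
    unfolding relators_lgen_def ball_Un by blast
  ultimately show ?thesis by blast
qed

lemma tgen_relators:
  fixes h :: "('s::finite, 'n::finite) tgen free \<Rightarrow> 'a::superalgebra"
  assumes h: "superalg_hom h"
  shows "(\<forall>r\<in>relators. h r = 0) \<longleftrightarrow>
    (\<forall>\<alpha> b. h (gen (Tgen \<alpha> b)) = sg (epar \<alpha> b) *\<^sub>q h (gen (Tgen (- \<alpha>) (- b)))) \<and>
    (\<forall>i k j l. quad_relation (quad (\<lambda>i j. h (T_free i j)) (\<lambda>i j. h (T_free i j))) i k j l)"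
proof -
  have "h ((fst_mat T_free \<cdot>\<^sub>3 snd_mat T_free \<cdot>\<^sub>3 scalar_mat S_mat) i j k l
      - (scalar_mat S_mat \<cdot>\<^sub>3 snd_mat T_free \<cdot>\<^sub>3 fst_mat T_free) i j k l) = 0 \<longleftrightarrow>
      quad_relation (quad (\<lambda>i j. h (T_free i j)) (\<lambda>i j. h (T_free i j))) i k l j" for i j k l
    by (simp add: S_right_mult3[of T_free, OF part_T_free] S_left_mult3[of T_free, OF part_T_free] qlinear_simps[OF superalg_homD(1)[OF h]]
        superalg_hom_S_left[OF h] superalg_hom_S_right[OF h] S_left_eq_S_right_iff)
  moreover have "h (gen (Tgen \<alpha> b) - sg (epar \<alpha> b) *\<^sub>q gen (Tgen (- \<alpha>) (- b))) = 0 \<longleftrightarrow>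
      h (gen (Tgen \<alpha> b)) = sg (epar \<alpha> b) *\<^sub>q h (gen (Tgen (- \<alpha>) (- b)))" for \<alpha> b
    by (simp add: qlinear_simps[OF superalg_homD(1)[OF h]])
  moreover have "(\<forall>r\<in>relators. h r = 0) \<longleftrightarrow>
      (\<forall>\<alpha> b. h (gen (Tgen \<alpha> b) - sg (epar \<alpha> b) *\<^sub>q gen (Tgen (- \<alpha>) (- b))) = 0) \<and>
      (\<forall>i j k l. h ((fst_mat T_free \<cdot>\<^sub>3 snd_mat T_free \<cdot>\<^sub>3 scalar_mat S_mat) i j k l
        - (scalar_mat S_mat \<cdot>\<^sub>3 snd_mat T_free \<cdot>\<^sub>3 fst_mat T_free) i j k l) = 0)"
    unfolding relators_tgen_def ball_Un by blast
  ultimately show ?thesis by blast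
qed

lemma L_gen_abs: "L_gen i j = abs_presented_algebra (L_free i j)"
  by (simp add: L_gen_def L_free_def abs_presented_simps)

lemma part_L_gen: "part (epar i j) (L_gen i j) = L_gen i j"
  using part_pgen[of "Lgen i j"] by (simp add: L_gen_def)

lemma
  fixes i j :: "'n::finite idx"
  shows L_gen_lower: "j < i \<Longrightarrow> L_gen i j = 0"
    and L_gen_diagonal: "L_gen i i * L_gen (- i) (- i) = 1"
    and L_gen_quad: "quad_relation (quad L_gen L_gen) i k j l"
proof -
  have "superalg_hom (abs_presented_algebra :: 'n lgen free \<Rightarrow> _)"
    by (rule superalg_hom_abs_presented)
  note R = lgen_relators[OF this, folded L_gen_abs, THEN iffD1, OF ballI[OF abs_presented_relator]]
  show "j < i \<Longrightarrow> L_gen i j = 0" "L_gen i i * L_gen (- i) (- i) = 1" "quad_relation (quad L_gen L_gen) i k j l"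
    using R by blast+
qed

lemma uq_hom_exists:
  fixes F :: "'n::finite idx \<Rightarrow> 'n idx \<Rightarrow> 'a::superalgebra"
  assumes par: "\<And>i j. part (epar i j) (F i j) = F i j"
    and lower: "\<And>i j. j < i \<Longrightarrow> F i j = 0"
    and diagonal: "\<And>i. F i i * F (- i) (- i) = 1"
    and quad: "\<And>i k j l. quad_relation (quad F F) i k j l"
  obtains h where "superalg_hom h" "\<And>i j. h (L_gen i j) = F i j"
proof -
  let ?f = "case_lgen F"
  have p: "part (par g) (?f g) = ?f g" for g by (cases g) (simp add: par)
  note h = superalg_hom_free_lift[of ?f, OF p]
  have "free_lift ?f (L_free i j) = F i j" for i j by (simp add: L_free_def free_lift_gen)
  then have "free_lift ?f r = 0" if "r \<in> relators" for r
    using lgen_relators[OF h] lower diagonal quad that by simp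
  then show thesis
    using that[of "presented_lift ?f"] superalg_hom_presented_lift[of ?f, OF p] presented_lift_pgen[of ?f, OF p]
    by (simp add: L_gen_def)
qed

lemma T_mat_abs: "T_mat b \<alpha> = abs_presented_algebra (T_free b \<alpha>)"
  by (simp add: T_mat_def t_gen_def T_free_def abs_presented_simps)

lemma part_t_gen: "part (epar \<alpha> b) (t_gen \<alpha> b) = t_gen \<alpha> b"
  using part_pgen[of "Tgen \<alpha> b"] by (simp add: t_gen_def)

lemma
  fixes \<alpha> :: "'s::finite idx" and b i :: "'n::finite idx"
  shows t_gen_uminus: "t_gen \<alpha> (b :: 'n idx) = sg (epar \<alpha> b) *\<^sub>q t_gen (- \<alpha>) (- b)"
    and T_mat_quad: "quad_relation (quad T_mat (T_mat :: 'n idx \<Rightarrow> 's idx \<Rightarrow> _)) i k j l"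
proof -
  have "superalg_hom (abs_presented_algebra :: ('s, 'n) tgen free \<Rightarrow> _)"
    by (rule superalg_hom_abs_presented)
  note R = tgen_relators[OF this, folded T_mat_abs, unfolded abs_presented_simps, folded t_gen_def,
      THEN iffD1, OF ballI[OF abs_presented_relator]]
  show "t_gen \<alpha> b = sg (epar \<alpha> b) *\<^sub>q t_gen (- \<alpha>) (- b)" "quad_relation (quad T_mat (T_mat :: 'n idx \<Rightarrow> 's idx \<Rightarrow> _)) i k j l"
    using R by blast+
qed

lemma T_mat_negative: "par \<alpha> \<Longrightarrow> T_mat b \<alpha> = t_gen \<alpha> b"
  by (simp add: T_mat_def epar_def scale_one)

lemma T_mat_uminus: "T_mat (- b) (- \<alpha>) = T_mat b \<alpha>"
  unfolding T_mat_def t_gen_uminus[of \<alpha> b]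
  by (cases "par b"; cases "par \<alpha>"; simp add: epar_def scale_scale)

lemma t_gen_relation:
  assumes "par \<alpha>" "par \<beta>"
  shows "q powi phi \<beta> \<alpha> *\<^sub>q (t_gen \<beta> i * t_gen \<alpha> k) - (of_bool (\<beta> < \<alpha>) * \<xi>) *\<^sub>q (t_gen \<alpha> i * t_gen \<beta> k)
    = crossing True (\<lambda>i k. t_gen \<alpha> i * t_gen \<beta> k) i k"
  using T_mat_quad[of i k \<alpha> \<beta>] assms unfolding quad_relation_negative[OF assms]
  by (simp add: T_mat_negative)

text \<open>The universal property of the presentation by negative columns;
  \<open>quad_relation_extend\<close> supplies the relations for the other columns.\<close>

lemma abar_hom_exists:
  fixes w :: "'n::finite idx \<Rightarrow> 's::finite idx \<Rightarrow> 'a::superalgebra"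
  assumes par: "\<And>b \<alpha>. par \<alpha> \<Longrightarrow> part (\<not> par b) (w b \<alpha>) = w b \<alpha>"
    and rel: "\<And>i k \<alpha> \<beta>. par \<alpha> \<Longrightarrow> par \<beta> \<Longrightarrow>
      q powi phi \<beta> \<alpha> *\<^sub>q (w i \<beta> * w k \<alpha>) - (of_bool (\<beta> < \<alpha>) * \<xi>) *\<^sub>q (w i \<alpha> * w k \<beta>)
      = crossing True (\<lambda>i k. w i \<alpha> * w k \<beta>) i k"
  obtains h where "superalg_hom h" "\<And>b \<alpha>. par \<alpha> \<Longrightarrow> h (t_gen \<alpha> b) = w b \<alpha>"
proof -
  \<comment> \<open>The values in positive columns are forced by the symmetry
    \<open>T_mat_uminus\<close>.\<close>
  let ?T = "\<lambda>b \<alpha>. if par \<alpha> then w b \<alpha> else w (- b) (- \<alpha>)"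
  let ?f = "case_tgen (\<lambda>\<alpha> b. sg (par b \<and> epar \<alpha> b) *\<^sub>q ?T b \<alpha>)"
  have p: "part (par g) (?f g) = ?f g" for g
    using par par[of _ "- b" for b]
    by (cases g) (auto simp: part_scale epar_def)
  note h = superalg_hom_free_lift[of ?f, OF p]
  have T: "free_lift ?f (T_free i j) = ?T i j" for i j
    by (simp add: T_free_def free_lift_gen free_lift_simps)
  have neg: "quad_relation (quad ?T ?T) i k j l" if "par j" "par l" for i k j l
    unfolding quad_relation_negative[OF that] using rel[OF that] that by simp
  have "quad_relation (quad ?T ?T) i k j l" for i k j l
    by (rule quad_relation_extend[of ?T, OF _ neg]) simp_all
  moreover have "sg (par b \<and> epar \<alpha> b) *\<^sub>q ?T b \<alpha>
      = sg (epar \<alpha> b) *\<^sub>q sg (par (- b) \<and> epar (- \<alpha>) (- b)) *\<^sub>q ?T (- b) (- \<alpha>)" for \<alpha> b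
    by (cases "par b"; cases "par \<alpha>"; simp add: epar_def scale_scale)
  ultimately have "\<forall>r\<in>relators. free_lift ?f r = 0"
    unfolding tgen_relators[OF h] T free_lift_gen tgen.case by blast
  then show thesis
    using that[of "presented_lift ?f"] superalg_hom_presented_lift[of ?f, OF p] presented_lift_pgen[of ?f, OF p]
    by (simp add: t_gen_def epar_def scale_one)
qed

text \<open>By \<open>t_gen_uminus\<close> a generator with positive first index is, up to sign, one
  with negative first index.\<close>

lemma abar_induct [case_names one gen add scale]:
  fixes x :: "('s::finite, 'n::finite) abar"
  assumes one: "P 1" and gen: "\<And>\<alpha> b x. par \<alpha> \<Longrightarrow> P x \<Longrightarrow> P (t_gen \<alpha> b * x)"
    and add: "\<And>x y. P x \<Longrightarrow> P y \<Longrightarrow> P (x + y)"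
    and scale: "\<And>c x. P x \<Longrightarrow> P (c *\<^sub>q x)"
  shows "P x"
proof (induction x rule: presented_induct)
  case (gen g x)
  obtain \<alpha> b where g: "g = Tgen \<alpha> b" by (cases g)
  have "pgen g * x = sg (epar \<alpha> b) *\<^sub>q (t_gen (- \<alpha>) (- b) * x)"
    using t_gen_uminus[of \<alpha> b] by (simp add: g t_gen_def scale_mult_left)
  then show ?case
    using assms(2)[of \<alpha> x b] assms(2)[of "- \<alpha>" x "- b"] gen scale
    by (cases "par \<alpha>") (simp_all add: g t_gen_def)
qed (use assms in auto)

section \<open>The coproduct and the counit\<close>

lemma qbilinear_tens: "qbilinear (\<otimes>)"
  by (simp add: qbilinear_def qlinear_tens_left qlinear_tens_right)

text \<open>The crossing travels from the columns of \<open>Z\<close> to its rows, by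
  \<open>crossing_adjoint\<close> to the columns of \<open>Y\<close>, and from there to the rows of
  \<open>Y\<close>. This is the reason why the coproduct respects the relations.\<close>

lemma quad_relation_tens:
  fixes Y :: "'i::finite idx \<Rightarrow> 'i idx \<Rightarrow> 'm::finite idx \<Rightarrow> 'm idx \<Rightarrow> 'v::qspace"
    and Z :: "'m idx \<Rightarrow> 'm idx \<Rightarrow> 'j::finite idx \<Rightarrow> 'j idx \<Rightarrow> 'w::qspace"
  assumes Y: "\<And>i k j l. quad_relation Y i k j l" and Z: "\<And>i k j l. quad_relation Z i k j l"
  shows "quad_relation (\<lambda>i k j l. \<Sum>m\<in>UNIV. \<Sum>p\<in>UNIV. Y i k m p \<otimes> Z m p j l) i k j l"
proof -
  have "crossing_col True (\<lambda>j l. \<Sum>m\<in>UNIV. \<Sum>p\<in>UNIV. Y i k m p \<otimes> Z m p j l) j l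
      = (\<Sum>m\<in>UNIV. \<Sum>p\<in>UNIV. Y i k m p \<otimes> crossing_col True (Z m p) j l)"
    by (simp add: crossing_col_sum crossing_col_linear[OF qlinear_tens_right])
  also have "\<dots> = (\<Sum>m\<in>UNIV. \<Sum>p\<in>UNIV. Y i k m p \<otimes> crossing True (\<lambda>m p. Z m p j l) m p)"
    using Z by (simp add: quad_relation_def)
  also have "\<dots> = (\<Sum>m\<in>UNIV. \<Sum>p\<in>UNIV. crossing_col True (Y i k) m p \<otimes> Z m p j l)"
    by (rule crossing_adjoint[OF qbilinear_tens, symmetric])
  also have "\<dots> = (\<Sum>m\<in>UNIV. \<Sum>p\<in>UNIV. crossing True (\<lambda>i k. Y i k m p) i k \<otimes> Z m p j l)"
    using Y by (simp add: quad_relation_def)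
  also have "\<dots> = crossing True (\<lambda>i k. \<Sum>m\<in>UNIV. \<Sum>p\<in>UNIV. Y i k m p \<otimes> Z m p j l) i k"
    by (simp add: crossing_sum crossing_linear[OF qlinear_tens_left])
  finally show ?thesis by (simp add: quad_relation_def)
qed

lemma superalg_hom_eqI_uq:
  fixes f h :: "'n::finite uq \<Rightarrow> 'a::superalgebra"
  assumes "superalg_hom f" "superalg_hom h" "\<And>i j. f (L_gen i j) = h (L_gen i j)"
  shows "f = h"
proof (rule presented_hom_eqI[OF assms(1,2)])
  fix g :: "'n lgen"
  show "f (pgen g) = h (pgen g)" using assms(3) by (cases g) (simp add: L_gen_def)
qed

context
begin

private definition L2 :: "'n::finite idx \<Rightarrow> 'n idx \<Rightarrow> ('n uq, 'n uq) tensor" where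
  "L2 i j = (\<Sum>k\<in>UNIV. sg (epar i k \<and> epar k j) *\<^sub>q (L_gen i k \<otimes> L_gen k j))"

private lemma part_L2: "part (epar i j) (L2 i j) = L2 i j"
proof -
  have "part (epar i j) (L_gen i k \<otimes> L_gen k j) = L_gen i k \<otimes> L_gen k j" for k
    by (subst part_tens_hom[OF part_L_gen part_L_gen]) (auto simp: epar_def)
  then show ?thesis by (simp add: L2_def part_sum part_scale)
qed

private lemma L2_diagonal: "L2 i i = L_gen i i \<otimes> L_gen i i"
proof -
  have "sg (epar i k \<and> epar k i) *\<^sub>q (L_gen i k \<otimes> L_gen k i) = (if k = i then L_gen i i \<otimes> L_gen i i else 0)" for k
    using L_gen_lower[of i k] L_gen_lower[of k i]
    by (cases i k rule: linorder_cases) (auto simp: epar_def scale_one)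
  then show ?thesis by (simp add: L2_def)
qed

private lemma L2_lower: "j < i \<Longrightarrow> L2 i j = 0"
proof -
  assume "j < i"
  then have "L_gen i k \<otimes> L_gen k j = 0" for k
    using L_gen_lower[of k i] L_gen_lower[of j k] by (cases "k < i") auto
  then show "L2 i j = 0" by (simp add: L2_def)
qed

text \<open>The signs of the coproduct, those of multiplication in the tensor product and those of
  \<open>quad\<close> cancel, so that the coproduct becomes a matrix product without signs.\<close>

private lemma quad_L2: "quad L2 L2 i k j l = (\<Sum>m\<in>UNIV. \<Sum>p\<in>UNIV. quad L_gen L_gen i k m p \<otimes> quad L_gen L_gen m p j l)"
proof -
  have "(L_gen i m \<otimes> L_gen m j) * (L_gen k p \<otimes> L_gen p l)
      = sg (epar m j \<and> epar k p) *\<^sub>q ((L_gen i m * L_gen k p) \<otimes> (L_gen m j * L_gen p l))" for m p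
    by (simp add: tensor_mult_hom[OF part_L_gen] twist_hom[OF part_L_gen] scale_mult_left tens_simps conj_commute)
  then have "quad L2 L2 i k j l = (\<Sum>m\<in>UNIV. \<Sum>p\<in>UNIV.
    sg (((par j \<and> par l) \<noteq> (par j \<and> par k)) \<noteq> (((par i \<and> par j) \<noteq> (par k \<and> par l)) \<noteq> (par i \<noteq> par l))) *\<^sub>q
    sg (epar k p \<and> epar p l) *\<^sub>q sg (epar i m \<and> epar m j) *\<^sub>q
    sg (epar m j \<and> epar k p) *\<^sub>q ((L_gen i m * L_gen k p) \<otimes> (L_gen m j * L_gen p l)))"
    by (simp only: quad_def L2_def sum_product scale_sum scale_mult_left scale_mult_right)
  also have "\<dots> = (\<Sum>m\<in>UNIV. \<Sum>p\<in>UNIV. quad L_gen L_gen i k m p \<otimes> quad L_gen L_gen m p j l)"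
  proof (intro sum.cong refl)
    fix m p
    show "sg (((par j \<and> par l) \<noteq> (par j \<and> par k)) \<noteq> (((par i \<and> par j) \<noteq> (par k \<and> par l)) \<noteq> (par i \<noteq> par l))) *\<^sub>q
        sg (epar k p \<and> epar p l) *\<^sub>q sg (epar i m \<and> epar m j) *\<^sub>q
        sg (epar m j \<and> epar k p) *\<^sub>q ((L_gen i m * L_gen k p) \<otimes> (L_gen m j * L_gen p l))
      = quad L_gen L_gen i k m p \<otimes> quad L_gen L_gen m p j l"
      by (cases "par i"; cases "par j"; cases "par k"; cases "par l"; cases "par m"; cases "par p")
        (simp_all add: quad_def epar_def tens_simps scale_scale scale_one)
  qed
  finally show ?thesis .
qed

lemma
  shows superalg_hom_coproduct: "superalg_hom (coproduct :: 'n::finite uq \<Rightarrow> _)"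
    and coproduct_L_gen: "coproduct (L_gen i j :: 'n uq)
      = (\<Sum>k\<in>UNIV. sg (epar i k \<and> epar k j) *\<^sub>q (L_gen i k \<otimes> L_gen k j))"
proof -
  obtain D :: "'n uq \<Rightarrow> _" where D: "superalg_hom D" "\<And>i j. D (L_gen i j) = L2 i j"
  proof (rule uq_hom_exists[of "L2 :: 'n idx \<Rightarrow> _"])
    show "L2 i i * L2 (- i) (- i) = 1" for i :: "'n idx"
    proof -
      have e: "part False (L_gen i i) = L_gen i i" for i :: "'n idx"
        using part_L_gen[of i i] by (simp add: epar_def)
      show ?thesis
        by (simp add: L2_diagonal tensor_mult_hom[OF e] twist_False L_gen_diagonal one_tensor_def)
    qed
    show "quad_relation (quad L2 L2) i k j l" for i k j l :: "'n idx"
      using quad_relation_tens[OF L_gen_quad L_gen_quad] by (simp add: quad_L2[abs_def])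
    show "part (epar i j) (L2 i j) = L2 i j" for i j :: "'n idx" by (rule part_L2)
    show "L2 i j = 0" if "j < i" for i j :: "'n idx" using that by (rule L2_lower)
  qed (use that in blast)
  have "superalg_hom (coproduct :: 'n uq \<Rightarrow> _) \<and> (\<forall>i j. coproduct (L_gen i j :: 'n uq)
      = (\<Sum>k\<in>UNIV. sg (epar i k \<and> epar k j) *\<^sub>q (L_gen i k \<otimes> L_gen k j)))"
    unfolding coproduct_def
    by (rule theI[of _ D]) (use D in \<open>auto simp: L2_def intro: superalg_hom_eqI_uq\<close>)
  then show "superalg_hom (coproduct :: 'n uq \<Rightarrow> _)" "coproduct (L_gen i j :: 'n uq)
      = (\<Sum>k\<in>UNIV. sg (epar i k \<and> epar k j) *\<^sub>q (L_gen i k \<otimes> L_gen k j))" by auto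
qed

private definition L0 :: "'n::finite idx \<Rightarrow> 'n idx \<Rightarrow> scalar" where
  "L0 i j = (if i = j then 1 else 0)"

private lemma quad_L0: "quad L0 L0 i k j l = (if i = j \<and> k = l then 1 else 0)"
  by (cases "par i"; cases "par k") (auto simp: quad_def L0_def scale_one)

private lemma L0_relation: "quad_relation (quad L0 L0) i k j l"
  unfolding quad_relation_def quad_L0 by (rule crossing_delta[symmetric])

lemma
  shows counit_linear: "Vector_Spaces.linear scale (*) (counit :: 'n::finite uq \<Rightarrow> cq)"
    and counit_one: "counit (1 :: 'n uq) = 1"
    and counit_mult: "counit (u * v :: 'n uq) = counit u * counit v"
    and counit_L_gen: "counit (L_gen i j :: 'n uq) = of_bool (i = j)"
proof -
  let ?P = "\<lambda>e :: 'n uq \<Rightarrow> cq. Vector_Spaces.linear scale (*) e \<and> (\<forall>u. e (part True u) = 0) \<and>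
     e 1 = 1 \<and> (\<forall>u v. e (u * v) = e u * e v) \<and> (\<forall>i j. e (L_gen i j) = of_bool (i = j))"
  have vs: "vector_space ((*) :: cq \<Rightarrow> cq \<Rightarrow> cq)"
    by unfold_locales (simp_all add: algebra_simps)
  have lin: "Vector_Spaces.linear scale (*) e \<longleftrightarrow> (\<forall>x y. e (x + y) = e x + e y) \<and> (\<forall>c x. e (c *\<^sub>q x) = c * e x)"
    for e :: "'n uq \<Rightarrow> cq"
    by (simp add: Vector_Spaces.linear_iff qspace_vector_space vs)
  obtain h :: "'n uq \<Rightarrow> scalar" where h: "superalg_hom h" "\<And>i j. h (L_gen i j) = L0 i j"
  proof (rule uq_hom_exists[of "L0 :: 'n idx \<Rightarrow> _"])
    show "part (epar i j) (L0 i j) = L0 i j" for i j :: "'n idx"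
      by (auto simp: L0_def epar_def part_one)
    show "quad_relation (quad L0 L0) i k j l" for i k j l :: "'n idx" by (rule L0_relation)
  qed (auto simp: L0_def)
  note [simp] = superalg_homD(3,4)[OF h(1)] qlinear_simps[OF superalg_homD(1)[OF h(1)]]
    even_mapD[OF superalg_homD(2)[OF h(1)]]
  have ex: "?P (\<lambda>u. of_scalar (h u))"
    unfolding lin by (auto simp: plus_scalar.rep_eq scale_scalar.rep_eq times_scalar.rep_eq
      one_scalar.rep_eq part_scalar.rep_eq h(2) L0_def zero_scalar.rep_eq)
  have unique: "e = e'" if "?P e" "?P e'" for e e'
  proof
    fix x
    show "e x = e' x"
    proof (induction x rule: presented_induct)
      case (gen g x)
      then show ?case using that by (cases g) (simp add: L_gen_def)
    qed (use that in \<open>auto simp: lin\<close>)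
  qed
  have "?P counit"
    unfolding counit_def by (rule theI[of ?P, OF ex]) (rule unique[OF _ ex])
  then show "Vector_Spaces.linear scale (*) (counit :: 'n uq \<Rightarrow> cq)"
    "counit (1 :: 'n uq) = 1" "counit (u * v :: 'n uq) = counit u * counit v"
    "counit (L_gen i j :: 'n uq) = of_bool (i = j)" by auto
qed

end

section \<open>Tensor products of supermodules\<close>

lemma supermoduleD:
  assumes "supermodule act"
  shows "qbilinear act" "act 1 v = v" "act (u * w) v = act u (act w v)"
    "qlinear (act u)" "qlinear (\<lambda>u. act u v)"
    "part (p \<noteq> r) (act (part p u) (part r v)) = act (part p u) (part r v)"
  using assms by (simp_all add: supermodule_def qbilinear_def)

lemma supermodule_part:
  assumes "supermodule act" "part p u = u" "part r v = v"
  shows "part (p \<noteq> r) (act u v) = act u v"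
  using supermoduleD(6)[OF assms(1), of p r u v] assms(2,3) by simp

definition koszul_act ::
  "('u::superspace \<Rightarrow> 'v::superspace \<Rightarrow> 'v) \<Rightarrow> ('u'::superspace \<Rightarrow> 'w::superspace \<Rightarrow> 'w)
    \<Rightarrow> 'u \<Rightarrow> 'u' \<Rightarrow> 'v \<Rightarrow> 'w \<Rightarrow> ('v, 'w) tensor" where
  "koszul_act act act' u u' v w = (\<Sum>p\<in>UNIV. act u (part p v) \<otimes> act' (twist p u') w)"

context
  fixes act :: "'u::superspace \<Rightarrow> 'v::superspace \<Rightarrow> 'v" and act' :: "'u'::superspace \<Rightarrow> 'w::superspace \<Rightarrow> 'w"
  assumes bilinear: "qbilinear act" "qbilinear act'"
begin

private lemmas lin = bilinear[unfolded qbilinear_def, THEN conjunct1, rule_format, THEN qlinear_simps(1)]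
  bilinear[unfolded qbilinear_def, THEN conjunct1, rule_format, THEN qlinear_simps(2)]
  bilinear[unfolded qbilinear_def, THEN conjunct2, rule_format, THEN qlinear_simps(1)]
  bilinear[unfolded qbilinear_def, THEN conjunct2, rule_format, THEN qlinear_simps(2)]

private lemma inner: "qbilinear (koszul_act act act' u u')"
  by (simp add: koszul_act_def qbilinear_def qlinear_iff UNIV_bool lin part_simps tens_simps scale_right_distrib)

private lemma outer: "qbilinear (\<lambda>u u'. tlift (koszul_act act act' u u') t)"
proof -
  let ?f = "\<lambda>u u'. tlift (koszul_act act act' u u') t"
  have "?f (u1 + u2) u' = ?f u1 u' + ?f u2 u'" "?f u (u1' + u2') = ?f u u1' + ?f u u2'"
    "?f (c *\<^sub>q u) u' = c *\<^sub>q ?f u u'" "?f u (c *\<^sub>q u') = c *\<^sub>q ?f u u'" for u u' u1 u2 u1' u2' c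
    by (induction t rule: tensor_induct)
      (simp_all add: tlift_add tlift_scale tlift_tens inner, simp_all add: koszul_act_def UNIV_bool lin twist_simps tens_simps
        scale_right_distrib scale_scale mult.commute add_ac)
  then show ?thesis by (simp add: qbilinear_def qlinear_iff)
qed

private lemma tensor_act_koszul: "tensor_act act act' z t = tlift (\<lambda>u u'. tlift (koszul_act act act' u u') t) z"
  by (simp only: tensor_act_def koszul_act_def[abs_def])

private lemma tensor_act_left: "tensor_act act act' (u \<otimes> u') t = tlift (koszul_act act act' u u') t"
  unfolding tensor_act_koszul by (rule tlift_tens[OF outer])

lemma tensor_act_tens:
  "tensor_act act act' (u \<otimes> u') (v \<otimes> w) = (\<Sum>p\<in>UNIV. act u (part p v) \<otimes> act' (twist p u') w)"
  unfolding tensor_act_left tlift_tens[OF inner] by (rule koszul_act_def)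

lemma tensor_act_hom:
  "part p v = v \<Longrightarrow> tensor_act act act' (u \<otimes> u') (v \<otimes> w) = act u v \<otimes> act' (twist p u') w"
  using part_hom[of p v True] part_hom[of p v False] qlinear_simps(3)[of "act u"] bilinear(1)
  by (cases p) (simp_all add: tensor_act_tens UNIV_bool qbilinear_def)

lemma qlinear_tensor_act_left: "qlinear (\<lambda>z. tensor_act act act' z t)"
  unfolding tensor_act_koszul by (rule qlinear_tlift[OF outer])

lemma qlinear_tensor_act_right: "qlinear (tensor_act act act' z)"
proof -
  have "tensor_act act act' z (t + t') = tensor_act act act' z t + tensor_act act act' z t'"
    "tensor_act act act' z (c *\<^sub>q t) = c *\<^sub>q tensor_act act act' z t" for t t' c
    by (induction z rule: tensor_induct)
      (simp_all add: qlinear_simps[OF qlinear_tensor_act_left],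
        simp_all only: tensor_act_left tlift_add[OF inner] tlift_scale[OF inner],
        simp_all add: scale_scale mult.commute add_ac scale_right_distrib)
  then show ?thesis by (simp add: qlinear_iff)
qed

end

context
  fixes act :: "'u::superalgebra \<Rightarrow> 'v::superspace \<Rightarrow> 'v" and act' :: "'u'::superalgebra \<Rightarrow> 'w::superspace \<Rightarrow> 'w"
  assumes sm: "supermodule act" "supermodule act'"
begin

private lemmas bil = supermoduleD(1)[OF sm(1)] supermoduleD(1)[OF sm(2)]
private lemmas linl = qlinear_simps[OF qlinear_tensor_act_left[OF bil]]
private lemmas linr = qlinear_simps[OF qlinear_tensor_act_right[OF bil]]

lemma tensor_act_mult: "tensor_act act act' (z * z') t = tensor_act act act' z (tensor_act act act' z' t)"
proof (induction z rule: tensor_induct_hom)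
  case (tens u v a b)
  show ?case
  proof (induction z' rule: tensor_induct_hom)
    case (tens u' v' a' b')
    show ?case
    proof (induction t rule: tensor_induct_hom)
      case (tens u'' v'' x y)
      have "tensor_act act act' ((a \<otimes> b) * (a' \<otimes> b')) (x \<otimes> y)
          = act (a * a') x \<otimes> act' (twist u'' (twist u' b * b')) y"
        by (simp only: tensor_mult_hom[OF \<open>part u' a' = a'\<close>] tensor_act_hom[OF bil tens(1)])
      also have "\<dots> = act a (act a' x) \<otimes> act' (twist (u' \<noteq> u'') b) (act' (twist u'' b') y)"
      proof -
        have "(u'' \<noteq> u') = (u' \<noteq> u'')" by blast
        then show ?thesis
          by (simp only: supermoduleD(3)[OF sm(1)] supermoduleD(3)[OF sm(2)] twist_mult twist_twist)
      qed
      also have "\<dots> = tensor_act act act' (a \<otimes> b) (tensor_act act act' (a' \<otimes> b') (x \<otimes> y))"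
        by (simp only: tensor_act_hom[OF bil tens(1)]
          tensor_act_hom[OF bil supermodule_part[OF sm(1) \<open>part u' a' = a'\<close> tens(1)]])
      finally show ?case .
    qed (simp_all only: linl linr)
  qed (simp_all only: linl linr distrib_left scale_mult_right)
qed (simp_all only: linl linr distrib_right scale_mult_left)

lemma tensor_act_one: "tensor_act act act' 1 t = t"
proof (induction t rule: tensor_induct_hom)
  case (tens u v x y)
  then show ?case
    by (simp add: one_tensor_def tensor_act_hom[OF bil tens(1)] twist_one supermoduleD[OF sm(1)] supermoduleD[OF sm(2)])
qed (simp_all add: linr)

end

context
  fixes act :: "'n::finite uq \<Rightarrow> 'v::superspace \<Rightarrow> 'v" and act' :: "'n uq \<Rightarrow> 'w::superspace \<Rightarrow> 'w"
  assumes sm: "supermodule act" "supermodule act'"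
begin

lemma qlinear_uq_tensor_left: "qlinear (\<lambda>u. uq_tensor act act' u t)"
  unfolding uq_tensor_def
  by (rule qlinear_compose[OF qlinear_tensor_act_left superalg_homD(1)[OF superalg_hom_coproduct]])
    (rule supermoduleD(1)[OF sm(1)] supermoduleD(1)[OF sm(2)])+

lemma qlinear_uq_tensor_right: "qlinear (uq_tensor act act' u)"
  unfolding uq_tensor_def
  by (rule qlinear_tensor_act_right) (rule supermoduleD(1)[OF sm(1)] supermoduleD(1)[OF sm(2)])+

lemma uq_tensor_mult: "uq_tensor act act' (u * v) t = uq_tensor act act' u (uq_tensor act act' v t)"
  by (simp add: uq_tensor_def superalg_homD(4)[OF superalg_hom_coproduct] tensor_act_mult[OF sm])

lemma uq_tensor_one: "uq_tensor act act' 1 t = t"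
  by (simp add: uq_tensor_def superalg_homD(3)[OF superalg_hom_coproduct] tensor_act_one[OF sm])

lemma uq_tensor_L_gen:
  assumes "part p v = v"
  shows "uq_tensor act act' (L_gen i j) (v \<otimes> w) =
    (\<Sum>k\<in>UNIV. sg ((epar i k \<and> epar k j) \<noteq> (p \<and> epar k j)) *\<^sub>q (act (L_gen i k) v \<otimes> act' (L_gen k j) w))"
proof -
  note bil = supermoduleD(1)[OF sm(1)] supermoduleD(1)[OF sm(2)]
  show ?thesis
    by (simp add: uq_tensor_def coproduct_L_gen qlinear_simps[OF qlinear_tensor_act_left[OF bil]]
        tensor_act_hom[OF bil assms] twist_hom[OF part_L_gen] qlinear_simps[OF supermoduleD(5)[OF sm(2)]]
        tens_simps scale_scale sg_mult)
qed

end

section \<open>Moving an index strand past the coordinate superalgebra\<close>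

lemma crossing_part:
  assumes "\<And>i k. part (h (par i \<noteq> par k)) (f i k) = (f i k :: 'v::superspace)"
  shows "part (h (par i \<noteq> par k)) (crossing e f i k) = crossing e f i k"
proof -
  have "(par k \<noteq> par i) = (par i \<noteq> par k)" "(par (- i) \<noteq> par (- k)) = (par i \<noteq> par k)"
    by auto
  then have "part (h (par i \<noteq> par k)) (f i k) = f i k" "part (h (par i \<noteq> par k)) (f k i) = f k i"
    "part (h (par i \<noteq> par k)) (f (- i) (- k)) = f (- i) (- k)"
    using assms[of i k] assms[of k i] assms[of "- i" "- k"] by (simp_all only:)
  then show ?thesis
    by (simp only: crossing_def cross_def part_simps if_distrib[of "part _"])
qed

text \<open>Contracting the outgoing strand index with \<open>g\<close> replaces the delta function
  by \<open>g\<close>. In this way products of strand matrices become iterated crossings.\<close>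

lemma crossing_contract:
  assumes "qbilinear B"
  shows "(\<Sum>j\<in>UNIV. B (crossing e (\<lambda>a b. if b = j then f a else 0) i k) (g j))
    = crossing e (\<lambda>a b. B (f a) (g b)) i k"
proof -
  have B: "qlinear (\<lambda>x. B x y)" for y using assms by (simp add: qbilinear_def)
  have "B (if b = j then f a else 0) (g j) = (if b = j then B (f a) (g j) else 0)" for a b j
    by (simp add: qlinear_simps[OF B])
  then show ?thesis
    by (simp add: crossing_linear[OF B] flip: crossing_sum)
qed

lemma crossing_crossing_col:
  "crossing_col c (\<lambda>j l. crossing e (f j l) b d) j l = crossing e (\<lambda>b d. crossing_col c (\<lambda>j l. f j l b d) j l) b d"
  by (cases c; cases e)
    (simp_all add: crossing_col_def crossing_def cross_def scale_simps mult_ac add_ac diff_diff_eq diff_add_eq add_diff_eq diff_diff_eq2)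

text \<open>A strand of index \<open>i\<close> passes \<open>t_gen \<alpha> b\<close>: the entry
  \<open>(i, j)\<close> collects what is left behind when the strand comes out with index
  \<open>j\<close>.\<close>

definition strand_matrix :: "bool \<Rightarrow> 'n::finite idx \<Rightarrow> 's::finite idx \<Rightarrow> ('n idx, ('s, 'n) abar) smat" where
  "strand_matrix e b \<alpha> = Smat (\<lambda>i j. crossing e (\<lambda>a b'. if b' = j then t_gen \<alpha> a else 0) i b)"

lemma entry_strand_matrix:
  "entry (strand_matrix e b \<alpha>) i j = crossing e (\<lambda>a b'. if b' = j then t_gen \<alpha> a else 0) i b"
  by (simp add: strand_matrix_def Smat_inverse)

lemma qlinear_entry: "qlinear (\<lambda>M. entry M i j)"
  by (simp add: qlinear_iff plus_smat.rep_eq scale_smat.rep_eq)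

lemma qbilinear_times: "qbilinear ((*) :: 'a::superalgebra \<Rightarrow> _)"
  by (simp add: qbilinear_def qlinear_mult_left qlinear_mult_right)

lemma crossing_braid: "crossing2 True (crossing1 e (crossing2 e f)) = crossing1 e (crossing2 e (crossing1 True f))"
  by (cases e) (simp_all add: braid braid_inverse)

lemma part_strand_matrix:
  assumes "par \<alpha>"
  shows "part (\<not> par b) (strand_matrix e b \<alpha>) = strand_matrix e b \<alpha>"
proof -
  have "part ((\<not> par b) \<noteq> epar i j) (crossing e (\<lambda>a b'. if b' = j then t_gen \<alpha> a else 0) i b)
    = crossing e (\<lambda>a b'. if b' = j then t_gen \<alpha> a else 0) i b" for i j
  proof -
    have "part ((par a \<noteq> par b') \<noteq> (\<not> par j)) (if b' = j then t_gen \<alpha> a else 0) = (if b' = j then t_gen \<alpha> a else 0)" for a b'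
      using part_t_gen[of \<alpha> a] assms by (cases "par j"; simp add: epar_def)
    from crossing_part[of "\<lambda>p. p \<noteq> (\<not> par j)", OF this]
    have "part ((par i \<noteq> par b) \<noteq> (\<not> par j)) (crossing e (\<lambda>a b'. if b' = j then t_gen \<alpha> a else 0) i b)
      = crossing e (\<lambda>a b'. if b' = j then t_gen \<alpha> a else 0) i b" .
    moreover have "((par i \<noteq> par b) \<noteq> (\<not> par j)) = ((\<not> par b) \<noteq> epar i j)" by (auto simp: epar_def)
    ultimately show ?thesis by (simp only:)
  qed
  then show ?thesis
    by (simp add: part_smat_def strand_matrix_def Smat_inverse)
qed

lemma strand_matrix_mult:
  "entry (strand_matrix e i \<alpha> * strand_matrix e k \<beta>) b d
    = crossing1 e (crossing2 e (\<lambda>a a' b'. if b' = d then t_gen \<alpha> a * t_gen \<beta> a' else 0)) b i k"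
proof -
  have *: "x * crossing e (\<lambda>a' b'. if b' = d then t_gen \<beta> a' else 0) j k
      = crossing e (\<lambda>a' b'. if b' = d then x * t_gen \<beta> a' else 0) j k" for x j
    by (simp add: crossing_linear[OF qlinear_mult_left] if_distrib[of "\<lambda>y. x * y"] cong: if_cong)
  show ?thesis
    by (simp add: times_smat.rep_eq entry_strand_matrix crossing_contract[OF qbilinear_times] *
        crossing1_def crossing2_def)
qed

text \<open>The outer crossing exchanges the second indices of two generators that a strand passes.
  By \<open>crossing_braid\<close> it may act after the strand has passed, hence on a product of two
  generators, where the relation of the algebra evaluates it.\<close>

lemma strand_matrix_relation:
  assumes "par \<alpha>" "par \<beta>"
  shows "q powi phi \<beta> \<alpha> *\<^sub>q (strand_matrix e i \<beta> * strand_matrix e k \<alpha>)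
      - (of_bool (\<beta> < \<alpha>) * \<xi>) *\<^sub>q (strand_matrix e i \<alpha> * strand_matrix e k \<beta>)
    = crossing True (\<lambda>i k. strand_matrix e i \<alpha> * strand_matrix e k \<beta>) i k"
proof -
  let ?F = "\<lambda>\<alpha> \<beta> d a a' b'. if b' = d then t_gen \<alpha> a * t_gen \<beta> a' else 0"
  have "entry (crossing True (\<lambda>i k. strand_matrix e i \<alpha> * strand_matrix e k \<beta>) i k) b d
    = q powi phi \<beta> \<alpha> *\<^sub>q entry (strand_matrix e i \<beta> * strand_matrix e k \<alpha>) b d
      - (of_bool (\<beta> < \<alpha>) * \<xi>) *\<^sub>q entry (strand_matrix e i \<alpha> * strand_matrix e k \<beta>) b d" for b d
  proof -
    have F: "crossing1 True (?F \<alpha> \<beta> d) = (\<lambda>a a' b'. q powi phi \<beta> \<alpha> *\<^sub>q ?F \<beta> \<alpha> d a a' b' - (of_bool (\<beta> < \<alpha>) * \<xi>) *\<^sub>q ?F \<alpha> \<beta> d a a' b')"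
      by (auto simp: fun_eq_iff crossing1_def crossing_simps t_gen_relation[OF assms, symmetric])
    have "entry (crossing True (\<lambda>i k. strand_matrix e i \<alpha> * strand_matrix e k \<beta>) i k) b d
      = crossing2 True (crossing1 e (crossing2 e (?F \<alpha> \<beta> d))) b i k"
      by (simp add: crossing_linear[OF qlinear_entry] strand_matrix_mult crossing2_def[of True])
    also have "\<dots> = crossing1 e (crossing2 e (crossing1 True (?F \<alpha> \<beta> d))) b i k"
      by (simp only: crossing_braid)
    also have "\<dots> = q powi phi \<beta> \<alpha> *\<^sub>q crossing1 e (crossing2 e (?F \<beta> \<alpha> d)) b i k
      - (of_bool (\<beta> < \<alpha>) * \<xi>) *\<^sub>q crossing1 e (crossing2 e (?F \<alpha> \<beta> d)) b i k"
      unfolding F by (simp only: crossing1_def crossing2_def crossing_simps)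
    finally show ?thesis by (simp only: strand_matrix_mult)
  qed
  then show ?thesis
    by (simp add: entry_inject[symmetric] fun_eq_iff minus_smat.rep_eq scale_smat.rep_eq)
qed

definition strand_hom :: "bool \<Rightarrow> ('s::finite, 'n::finite) abar \<Rightarrow> ('n idx, ('s, 'n) abar) smat" where
  "strand_hom e = (SOME h. superalg_hom h \<and> (\<forall>b \<alpha>. par \<alpha> \<longrightarrow> h (t_gen \<alpha> b) = strand_matrix e b \<alpha>))"

text \<open>
  For \<open>e = True\<close> these are the coefficients of the braiding with a generator on the left, for
  \<open>e = False\<close>, up to signs, the actions of the generators of the quantum queer superalgebra.
\<close>

definition strand :: "bool \<Rightarrow> 'n::finite idx \<Rightarrow> 'n idx \<Rightarrow> ('s::finite, 'n) abar \<Rightarrow> ('s, 'n) abar" where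
  "strand e i j x = entry (strand_hom e x) i j"

lemma strand_hom:
  "superalg_hom (strand_hom e)" "par \<alpha> \<Longrightarrow> strand_hom e (t_gen \<alpha> b) = strand_matrix e b \<alpha>"
proof -
  have "\<exists>h. superalg_hom h \<and> (\<forall>b \<alpha>. par \<alpha> \<longrightarrow> h (t_gen \<alpha> b) = strand_matrix e b \<alpha>)"
    by (rule abar_hom_exists[OF part_strand_matrix strand_matrix_relation]) blast+
  from someI_ex[OF this] show "superalg_hom (strand_hom e)"
    "par \<alpha> \<Longrightarrow> strand_hom e (t_gen \<alpha> b) = strand_matrix e b \<alpha>"
    unfolding strand_hom_def by auto
qed

lemma qlinear_strand: "qlinear (strand e i j)"
  unfolding strand_def
  by (rule qlinear_compose[OF qlinear_entry superalg_homD(1)[OF strand_hom(1)]])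

lemmas strand_simps = qlinear_simps[OF qlinear_strand]

lemma strand_one: "strand e i j 1 = (if i = j then 1 else 0)"
  by (simp add: strand_def superalg_homD(3)[OF strand_hom(1)] one_smat.rep_eq)

lemma strand_mult: "strand e i k (x * y) = (\<Sum>j\<in>UNIV. strand e i j x * strand e j k y)"
  by (simp add: strand_def superalg_homD(4)[OF strand_hom(1)] times_smat.rep_eq)

lemma strand_part: "strand e i j (part p x) = part (p \<noteq> epar i j) (strand e i j x)"
  by (simp add: strand_def even_mapD[OF superalg_homD(2)[OF strand_hom(1)]] part_smat.rep_eq)

lemma strand_twist: "strand e i j (twist p x) = sg (p \<and> epar i j) *\<^sub>q twist p (strand e i j x)"
  by (cases p; cases "epar i j")
    (simp_all add: twist_def strand_simps strand_part scale_simps scale_one scale_minus_left add.commute)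

lemma strand_gen:
  "par \<alpha> \<Longrightarrow> strand e i j (t_gen \<alpha> b) = crossing e (\<lambda>a b'. if b' = j then t_gen \<alpha> a else 0) i b"
  by (simp add: strand_def strand_hom(2) entry_strand_matrix)

lemma strand_gen_contract:
  "par \<alpha> \<Longrightarrow> qbilinear B \<Longrightarrow> (\<Sum>j\<in>UNIV. B (strand e i j (t_gen \<alpha> b)) (g j)) = crossing e (\<lambda>a b'. B (t_gen \<alpha> a) (g b')) i b"
  by (simp add: strand_gen crossing_contract)

lemma strand_gen_mult:
  "par \<alpha> \<Longrightarrow> strand e i j (t_gen \<alpha> b * x) = crossing e (\<lambda>a b'. t_gen \<alpha> a * strand e b' j x) i b"
  by (simp add: strand_mult strand_gen_contract[OF _ qbilinear_times])

lemma strand_strand_gen_mult: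
  assumes "par \<alpha>"
  shows "strand e b j (strand d i l (t_gen \<alpha> a * x))
    = crossing2 d (crossing1 e (\<lambda>a b' i'. t_gen \<alpha> a * strand e b' j (strand d i' l x))) b i a"
  unfolding crossing1_def crossing2_def
  by (simp add: strand_gen_mult[OF assms] crossing_linear[OF qlinear_strand])

text \<open>Two index strands may be crossed before or after they have moved past \<open>x\<close>.\<close>

lemma strand_crossing:
  fixes x :: "('s::finite, 'n::finite) abar"
  assumes braid: "\<And>h :: 'n idx \<Rightarrow> 'n idx \<Rightarrow> 'n idx \<Rightarrow> ('s, 'n) abar.
    crossing1 c (crossing2 d (crossing1 e h)) = crossing2 e (crossing1 d (crossing2 c h))"
  shows "crossing c (\<lambda>b i. strand e b j (strand d i l x)) b i
    = crossing_col c (\<lambda>j l. strand d b j (strand e i l x)) j l"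
proof (induction x arbitrary: b i j l rule: abar_induct)
  case one
  have "strand e b j (strand d i l 1) = (if b = j \<and> i = l then 1 else 0 :: ('s, 'n) abar)" for e d b j i l
    by (auto simp: strand_one strand_simps)
  then show ?case by (simp add: crossing_delta)
next
  case (gen \<alpha> a x)
  let ?H = "\<lambda>e d j l a b' i'. t_gen \<alpha> a * strand e b' j (strand d i' l x)"
  \<comment> \<open>Both strands pass the first generator. The braid relation then moves the
    crossing of the two strands beyond this generator, where the induction hypothesis moves it past
    the remaining word.\<close>
  have "crossing c (\<lambda>b i. strand e b j (strand d i l (t_gen \<alpha> a * x))) b i
      = crossing1 c (crossing2 d (crossing1 e (?H e d j l))) b i a"
    by (simp add: strand_strand_gen_mult[OF gen(1)] crossing1_def[of c])
  also have "\<dots> = crossing2 e (crossing1 d (crossing2 c (?H e d j l))) b i a"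
    by (simp only: braid)
  also have "crossing2 c (?H e d j l) = (\<lambda>a b' i'. crossing_col c (\<lambda>j l. ?H d e j l a b' i') j l)"
    using gen(2) by (simp add: fun_eq_iff crossing2_def
        flip: crossing_linear[OF qlinear_mult_left] crossing_col_linear[OF qlinear_mult_left])
  also have "crossing2 e (crossing1 d \<dots>) b i a = crossing_col c (\<lambda>j l. crossing2 e (crossing1 d (?H d e j l)) b i a) j l"
    by (simp add: crossing1_def[abs_def] crossing2_def[abs_def] crossing_crossing_col)
  also have "\<dots> = crossing_col c (\<lambda>j l. strand d b j (strand e i l (t_gen \<alpha> a * x))) j l"
    by (simp add: strand_strand_gen_mult[OF gen(1)])
  finally show ?case .
qed (simp_all add: strand_simps crossing_simps crossing_col_simps)

section \<open>The action of the quantum queer superalgebra\<close>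

text \<open>The summand \<open>\<xi> *\<^sub>q f i k\<close> turns the condition
  \<open>k < i\<close> into \<open>i < k\<close> and, for \<open>i = k\<close>, joins the first
  term. The second index on the right is then \<open>i\<close> or greater than \<open>i\<close> in
  every term, which makes the inverse crossing triangular.\<close>

lemma crossing_False_eq:
  fixes f :: "'n::finite idx \<Rightarrow> 'n idx \<Rightarrow> 'v::qspace"
  shows "crossing False f i k = (sg (\<not> par i \<and> \<not> par k) * q powi phi i k + of_bool (i = k) * \<xi>) *\<^sub>q f k i
    + (of_bool (i < k) * \<xi>) *\<^sub>q f i k - (of_bool (i < - k) * sg (par i) * \<xi>) *\<^sub>q f (- i) (- k)"
proof -
  have "i < - k \<longleftrightarrow> k < - i" by (transfer, force)
  then show ?thesis
    by (cases i k rule: linorder_cases)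
      (auto simp: crossing_def cross_def scale_left_distrib)
qed

text \<open>An inverse crossing never lowers the index of the strand, by
  \<open>crossing_False_eq\<close>. This gives the triangularity of \<open>L\<close>.\<close>

lemma strand_lower: "j < i \<Longrightarrow> strand False i j x = 0"
proof (induction x arbitrary: i j rule: abar_induct)
  case (gen \<alpha> b x)
  have "t_gen \<alpha> a * strand False b' j x = 0" if "j < b'" for a b'
    using gen(2)[OF that] by simp
  then show ?case
    using gen(3) by (simp add: strand_gen_mult[OF gen(1)] crossing_False_eq of_bool_def)
qed (auto simp: strand_one strand_simps)

lemma strand_diagonal:
  assumes "par \<alpha>"
  shows "strand False i i (t_gen \<alpha> b * x)
    = (sg (\<not> par i \<and> \<not> par b) * q powi phi i b + of_bool (i = b) * \<xi>) *\<^sub>q (t_gen \<alpha> b * strand False i i x)"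
proof -
  have "t_gen \<alpha> a * strand False b' i x = 0" if "i < b'" for a b'
    by (simp add: strand_lower[OF that])
  then show ?thesis
    by (simp add: strand_gen_mult[OF assms] crossing_False_eq of_bool_def)
qed

lemma strand_diagonal_inverse: "strand False i i (strand False (- i) (- i) x) = twist True x"
proof (induction x rule: abar_induct)
  case (gen \<alpha> b x)
  let ?c = "\<lambda>i. sg (\<not> par i \<and> \<not> par b) * q powi phi i b + of_bool (i = b) * \<xi>"
  \<comment> \<open>For \<open>i = b\<close> or \<open>i = - b\<close> the summand \<xi> changes one
    of the two powers of q into the inverse of the other; in all other cases both coefficients are
    signs.\<close>
  have c: "?c i * ?c (- i) = sg (\<not> par b)"
  proof (cases i b rule: idx_cases)
    case eq
    then show ?thesis
      by (cases "par b"; simp add: phi_simps xi_def power_int_minus algebra_simps)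
  next
    case opp
    then show ?thesis
      by (cases "par b"; simp add: phi_simps xi_def power_int_minus algebra_simps)
  next
    case less
    then have "phi i b = 0" "phi (- i) b = 0" by (auto simp: phi_def)
    with less show ?thesis by (cases "par i") simp_all
  next
    case greater
    then have "phi i b = 0" "phi (- i) b = 0" by (auto simp: phi_def)
    with greater show ?thesis by (cases "par i") simp_all
  qed
  have e: "epar \<alpha> b = (\<not> par b)" using gen(1) by (simp add: epar_def)
  have "strand False i i (strand False (- i) (- i) (t_gen \<alpha> b * x)) = (?c i * ?c (- i)) *\<^sub>q (t_gen \<alpha> b * twist True x)"
    unfolding strand_diagonal[OF gen(1)] strand_simps gen(2) scale_scale by (simp only: mult.commute)
  also have "\<dots> = twist True (t_gen \<alpha> b * x)"
    unfolding c twist_mult twist_hom[OF part_t_gen] e by (simp add: scale_mult_left)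
  finally show ?case .
qed (simp_all add: strand_one strand_simps twist_one twist_simps)

text \<open>The inner twists for \<open>i\<close> and \<open>- i\<close> combine to the one in
  \<open>strand_diagonal_inverse\<close>, which makes the diagonal operators inverse to each other.
  The outer twist and the sign give the values prescribed on the generators, see
  \<open>L_op_T_mat\<close>.\<close>

lift_definition L_op :: "'n::finite idx \<Rightarrow> 'n idx \<Rightarrow> ('s::finite, 'n) abar qend" is
  "\<lambda>i j x. sg (par i \<and> epar i j) *\<^sub>q twist True (strand False i j (twist (par j) x))"
  by (intro qlinear_scale qlinear_compose[OF qlinear_twist] qlinear_compose[OF qlinear_strand] qlinear_twist)

lemma part_L_op: "part (epar i j) (L_op i j) = L_op i j"
proof (rule part_qend_eqI)
  fix r x
  have "part (epar i j \<noteq> r) (strand False i j (part r x)) = strand False i j (part r x)"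
    unfolding strand_part part_part by (cases r; cases "epar i j"; simp)
  then show "part (epar i j \<noteq> r) (app (L_op i j) (part r x)) = app (L_op i j) (part r x)"
    unfolding L_op.rep_eq part_simps part_twist strand_twist strand_simps twist_simps
    by (simp flip: part_twist)
qed

lemma L_op_lower: "j < i \<Longrightarrow> L_op i j = 0"
  by (simp add: app_inject[symmetric] fun_eq_iff L_op.rep_eq zero_qend.rep_eq strand_lower twist_simps)

lemma L_op_diagonal: "L_op i i * L_op (- i) (- i) = 1"
proof -
  have "app (L_op i i * L_op (- i) (- i)) x = x" for x :: "('a, 'b) abar"
  proof -
    have "app (L_op i i * L_op (- i) (- i)) x
        = twist True (twist (par i) (twist True (twist (\<not> par i) (strand False i i (strand False (- i) (- i) x)))))"
      by (simp add: app_qend L_op.rep_eq epar_same strand_twist twist_simps scale_one)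
    then show ?thesis
      by (cases "par i") (simp_all add: strand_diagonal_inverse twist_False)
  qed
  then show ?thesis by (simp add: app_inject[symmetric] fun_eq_iff one_qend.rep_eq)
qed

text \<open>The remaining sign and twist depend only on the parity sums of the rows and of the
  columns. These are preserved by the crossings, so the relations of \<open>L\<close> reduce to
  \<open>strand_crossing\<close>.\<close>

lemma app_quad_L_op:
  "app (quad L_op L_op i k j l) x = sg ((par i \<noteq> par k) \<noteq> (par j \<noteq> par l)) *\<^sub>q
     strand False i j (strand False k l (twist (par j \<noteq> par l) x))"
  by (cases "par i"; cases "par j"; cases "par k"; cases "par l")
    (simp_all add: quad_def app_qend L_op.rep_eq epar_def strand_twist twist_simps strand_simps
      twist_False scale_simps scale_one scale_minus_left scale_minus_right)

lemma crossing_depends_parity: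
  "crossing e (\<lambda>i k. f (par i \<noteq> par k) i k) i k = crossing e (f (par i \<noteq> par k)) i k"
  "crossing_col e (\<lambda>i k. f (par i \<noteq> par k) i k) i k = crossing_col e (f (par i \<noteq> par k)) i k"
proof -
  have "(par k \<noteq> par i) = (par i \<noteq> par k)" "(par (- i) \<noteq> par (- k)) = (par i \<noteq> par k)"
    by auto
  then show "crossing e (\<lambda>i k. f (par i \<noteq> par k) i k) i k = crossing e (f (par i \<noteq> par k)) i k"
    "crossing_col e (\<lambda>i k. f (par i \<noteq> par k) i k) i k = crossing_col e (f (par i \<noteq> par k)) i k"
    by (simp_all only: crossing_def cross_def crossing_col_def)
qed

lemma qlinear_app: "qlinear (\<lambda>f. app f x)"
  by (simp add: qlinear_iff app_qend)

lemma L_op_quad: "quad_relation (quad L_op (L_op :: 'n::finite idx \<Rightarrow> 'n idx \<Rightarrow> ('s::finite, 'n) abar qend)) i k j l"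
proof -
  let ?Y = "quad L_op (L_op :: 'n idx \<Rightarrow> 'n idx \<Rightarrow> ('s, 'n) abar qend)"
  have "app (crossing_col True (?Y i k) j l) x = app (crossing True (\<lambda>i k. ?Y i k j l) i k) x" for x
  proof -
    let ?s = "sg ((par i \<noteq> par k) \<noteq> (par j \<noteq> par l))" and ?x = "twist (par j \<noteq> par l) x"
    have "app (crossing_col True (?Y i k) j l) x
      = ?s *\<^sub>q crossing_col True (\<lambda>j l. strand False i j (strand False k l ?x)) j l"
      using crossing_depends_parity(2)[of True "\<lambda>p j l. sg ((par i \<noteq> par k) \<noteq> p) *\<^sub>q
        strand False i j (strand False k l (twist p x))" j l]
      by (simp only: crossing_col_linear[OF qlinear_app] app_quad_L_op crossing_col_simps)
    \<comment> \<open>Two inverse strands and a positive crossing between them: the case of the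
      first relation in \<open>braid_inverse\<close>.\<close>
    also have "crossing_col True (\<lambda>j l. strand False i j (strand False k l ?x)) j l
      = crossing True (\<lambda>i k. strand False i j (strand False k l ?x)) i k"
      by (rule strand_crossing[symmetric]) (simp only: braid_inverse)
    also have "?s *\<^sub>q \<dots> = app (crossing True (\<lambda>i k. ?Y i k j l) i k) x"
      using crossing_depends_parity(1)[of True "\<lambda>p i k. sg (p \<noteq> (par j \<noteq> par l)) *\<^sub>q
        strand False i j (strand False k l ?x)" i k]
      by (simp only: crossing_linear[OF qlinear_app] app_quad_L_op crossing_simps)
    finally show ?thesis .
  qed
  then show ?thesis by (simp add: quad_relation_def app_inject[symmetric] fun_eq_iff)
qed

lemma S_inv_mat_uminus: "S_inv_mat (- a) (- b) c d = S_inv_mat a b c d"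
proof -
  have "phi (- a) c = phi a c" by (auto simp: phi_def)
  moreover have "- a = d \<longleftrightarrow> a = - d" "- b = c \<longleftrightarrow> b = - c" by (transfer, force)+
  ultimately show ?thesis by (auto simp: S_inv_mat_eq add.commute)
qed

lemma mult2_S_inv_mat:
  "(scalar_mat S_inv_mat \<cdot>\<^sub>2 fst_mat T_mat) c \<alpha> a b = (\<Sum>c'\<in>UNIV. S_inv_mat c c' a b *\<^sub>q T_mat c' \<alpha>)"
proof -
  have part: "part (epar c' \<alpha>) (T_mat c' \<alpha>) = T_mat c' \<alpha>" for c'
    using part_t_gen[of \<alpha> c'] by (simp add: T_mat_def part_scale epar_def eq_commute)
  have "(scalar_mat S_inv_mat \<cdot>\<^sub>2 fst_mat T_mat) c \<alpha> a b = (\<Sum>c'\<in>UNIV. \<Sum>l\<in>UNIV. if l = b then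
      sg (epar a b \<and> epar c' \<alpha>) *\<^sub>q S_inv_mat c c' a b *\<^sub>q twist (epar a b) (T_mat c' \<alpha>) else 0)"
    unfolding mat_mult2_def scalar_mat_mult
    by (intro sum.cong refl) (simp add: fst_mat_def twist_simps scale_mult_left)
  also have "\<dots> = (\<Sum>c'\<in>UNIV. S_inv_mat c c' a b *\<^sub>q T_mat c' \<alpha>)"
    unfolding sum_if_eq twist_hom[OF part] by (intro sum.cong refl) (simp add: scale_scale mult_ac)
  finally show ?thesis .
qed

lemma S_inv_mat_row:
  fixes g :: "'n::finite idx \<Rightarrow> 'v::qspace"
  shows "(\<Sum>c'\<in>UNIV. S_inv_mat c c' a b *\<^sub>q g c') = (of_bool (a = b) * q powi (- phi c a)) *\<^sub>q g c
    - (of_bool (a < b \<and> c = b) * \<xi> * sg (par a)) *\<^sub>q g a - (of_bool (a < b \<and> c = - b) * \<xi> * sg (par a)) *\<^sub>q g (- a)"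
proof -
  have "S_inv_mat c c' a b *\<^sub>q g c' = (if c' = c then (of_bool (a = b) * q powi (- phi c a)) *\<^sub>q g c else 0)
    - (if c' = a then (of_bool (a < b \<and> c = b) * \<xi> * sg (par a)) *\<^sub>q g a else 0)
    - (if c' = - a then (of_bool (a < b \<and> c = - b) * \<xi> * sg (par a)) *\<^sub>q g (- a) else 0)" for c'
    unfolding S_inv_mat_eq by (auto simp: scale_left_simps scale_one)
  then show ?thesis by (simp add: sum_subtractf)
qed

lemma L_op_T_mat:
  fixes a b c :: "'n::finite idx" and \<alpha> :: "'s::finite idx"
  shows
  "app (L_op a b) (twist (epar a b) (T_mat c \<alpha>)) = (scalar_mat S_inv_mat \<cdot>\<^sub>2 fst_mat T_mat) c \<alpha> a b"
proof -
  have neg: "app (L_op a b) (twist (epar a b) (T_mat c \<alpha>)) = (\<Sum>c'\<in>UNIV. S_inv_mat c c' a b *\<^sub>q T_mat c' \<alpha>)"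
    if "par \<alpha>" for c :: "'n idx" and \<alpha> :: "'s idx"
  proof -
    have e: "epar \<alpha> c = (\<not> par c)" for c :: "'n idx" using that by (simp add: epar_def)
    let ?f = "\<lambda>a b'. if b' = b then t_gen \<alpha> a else 0"
    have "app (L_op a b) (twist (epar a b) (t_gen \<alpha> c))
      = (sg (par a \<and> epar a b) * sg (par a \<and> \<not> par c)) *\<^sub>q twist True (crossing False ?f a c)"
    proof -
      have "twist (par b) (twist (epar a b) (t_gen \<alpha> c)) = twist (par a) (t_gen \<alpha> c)"
        by (cases "par a"; cases "par b"; simp add: epar_def twist_False)
      also have "\<dots> = sg (par a \<and> \<not> par c) *\<^sub>q t_gen \<alpha> c"
        using twist_hom[OF part_t_gen, of "par a" \<alpha> c] by (simp only: e)
      finally show ?thesis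
        by (simp add: L_op.rep_eq strand_simps strand_gen[OF that] twist_simps scale_scale)
    qed
    also have "twist True (crossing False ?f a c) = crossing False (\<lambda>a b'. if b' = b then sg (\<not> par a) *\<^sub>q t_gen \<alpha> a else 0) a c"
    proof -
      have "(\<lambda>(i :: 'n idx) k. twist True (?f i k)) = (\<lambda>a b'. if b' = b then sg (\<not> par a) *\<^sub>q t_gen \<alpha> a else 0)"
        by (auto simp: fun_eq_iff twist_simps twist_hom[OF part_t_gen] e)
      then show ?thesis by (simp only: crossing_linear[OF qlinear_twist])
    qed
    also have "(sg (par a \<and> epar a b) * sg (par a \<and> \<not> par c)) *\<^sub>q \<dots> = (\<Sum>c'\<in>UNIV. S_inv_mat c c' a b *\<^sub>q t_gen \<alpha> c')"
    proof -
      have 0: "- c = b \<longleftrightarrow> c = - b" "a < - c \<longleftrightarrow> c < - a" by (transfer, force)+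
      show ?thesis
        unfolding S_inv_mat_row crossing_False_eq
        by (cases a c rule: idx_cases; cases "par a"; cases "par c"; cases "c < - a"; cases "par b")
          (auto simp: 0 phi_simps epar_def scale_simps scale_one scale_minus_left scale_left_simps xi_def power_int_minus)
    qed
    finally show ?thesis by (simp add: T_mat_negative[OF that])
  qed
  show ?thesis
  proof (cases "par \<alpha>")
    case False
    \<comment> \<open>Positive columns reduce to negative ones, since both \<open>T_mat\<close> and
      the first pair of indices of \<open>S_inv_mat\<close> are invariant under simultaneous change
      of sign.\<close>
    have "app (L_op a b) (twist (epar a b) (T_mat c \<alpha>)) = app (L_op a b) (twist (epar a b) (T_mat (- c) (- \<alpha>)))"
      by (simp add: T_mat_uminus)
    also have "\<dots> = (\<Sum>c'\<in>UNIV. S_inv_mat (- c) c' a b *\<^sub>q T_mat c' (- \<alpha>))"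
      using False by (intro neg) simp
    also have "\<dots> = (\<Sum>c'\<in>UNIV. S_inv_mat (- c) (- c') a b *\<^sub>q T_mat (- c') (- \<alpha>))"
      by (rule sum.reindex_bij_witness[of _ uminus uminus]) simp_all
    also have "\<dots> = (\<Sum>c'\<in>UNIV. S_inv_mat c c' a b *\<^sub>q T_mat c' \<alpha>)"
      by (simp add: T_mat_uminus S_inv_mat_uminus)
    finally show ?thesis by (simp add: mult2_S_inv_mat)
  qed (simp add: neg mult2_S_inv_mat)
qed


definition L_hom :: "'n::finite uq \<Rightarrow> ('s::finite, 'n) abar qend" where
  "L_hom = (SOME h. superalg_hom h \<and> (\<forall>i j. h (L_gen i j) = L_op i j))"

lemma
  shows superalg_hom_L_hom: "superalg_hom (L_hom :: 'n::finite uq \<Rightarrow> ('s::finite, 'n) abar qend)"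
    and L_hom_L_gen: "L_hom (L_gen i j) = (L_op i j :: ('s::finite, 'n) abar qend)"
proof -
  have "\<exists>h :: 'n uq \<Rightarrow> ('s, 'n) abar qend. superalg_hom h \<and> (\<forall>i j. h (L_gen i j) = L_op i j)"
    by (rule uq_hom_exists[of L_op]) (use part_L_op L_op_lower L_op_diagonal L_op_quad in blast)+
  from someI_ex[OF this] show "superalg_hom (L_hom :: 'n uq \<Rightarrow> ('s, 'n) abar qend)"
    "L_hom (L_gen i j) = (L_op i j :: ('s, 'n) abar qend)"
    unfolding L_hom_def by auto
qed

lemma supermodule_app:
  fixes h :: "'u::superalgebra \<Rightarrow> 'v::superspace qend"
  assumes "superalg_hom h"
  shows "supermodule (\<lambda>u. app (h u))"
  unfolding supermodule_def
proof (intro conjI allI)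
  show "qbilinear (\<lambda>u. app (h u))"
    by (intro qbilinearI app_linear qlinear_compose[OF qlinear_app superalg_homD(1)[OF assms]])
  fix p r and u :: 'u and v :: 'v
  have "part p (h (part p u)) = h (part p u)" "part r (part r v) = part r v"
    by (simp_all add: even_mapD[OF superalg_homD(2)[OF assms]] part_part)
  then show "part (p \<noteq> r) (app (h (part p u)) (part r v)) = app (h (part p u)) (part r v)"
    by (rule part_app)
qed (simp_all add: superalg_homD[OF assms] app_qend)

lemma uq_induct [case_names one gen add scale]:
  fixes u :: "'n::finite uq"
  assumes "P 1" and "\<And>i j u. P u \<Longrightarrow> P (L_gen i j * u)"
    and "\<And>x y. P x \<Longrightarrow> P y \<Longrightarrow> P (x + y)" and "\<And>c x. P x \<Longrightarrow> P (c *\<^sub>q x)"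
  shows "P u"
proof (induction u rule: presented_induct)
  case (gen g x)
  then show ?case using assms(2) by (cases g) (simp add: L_gen_def)
qed (use assms in auto)

lemma qlinear_tmul: "qlinear tmul"
  unfolding tmul_def by (rule qlinear_tlift[OF qbilinear_times])

lemma tmul_tens: "tmul (x \<otimes> y) = x * y"
  unfolding tmul_def by (rule tlift_tens[OF qbilinear_times])

text \<open>One inverse strand passing both factors. With the signs of \<open>L_op\<close> it is the
  action of \<open>L_gen i j\<close> on the tensor product, see
  \<open>uq_tensor_L_hom\<close>.\<close>

definition tensor_strand :: "'n::finite idx \<Rightarrow> 'n idx \<Rightarrow> (('s::finite, 'n) abar, ('l::finite, 'n) abar) tensor
    \<Rightarrow> (('s, 'n) abar, ('l, 'n) abar) tensor" where
  "tensor_strand i j = tlift (\<lambda>x y. \<Sum>k\<in>UNIV. strand False i k x \<otimes> strand False k j y)"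

lemma tensor_strand_bilinear: "qbilinear (\<lambda>x y. \<Sum>k\<in>UNIV. strand False i k x \<otimes> strand False k j y)"
  by (intro qbilinearI qlinear_sum qlinear_compose[OF qlinear_tens_right] qlinear_compose[OF qlinear_tens_left] qlinear_strand)

lemma tensor_strand_tens: "tensor_strand i j (x \<otimes> y) = (\<Sum>k\<in>UNIV. strand False i k x \<otimes> strand False k j y)"
  unfolding tensor_strand_def by (rule tlift_tens[OF tensor_strand_bilinear])

lemma qlinear_tensor_strand: "qlinear (tensor_strand i j)"
  unfolding tensor_strand_def by (rule qlinear_tlift[OF tensor_strand_bilinear])

lemma tmul_tensor_strand: "tmul (tensor_strand i j z) = strand False i j (tmul z)"
  by (induction z rule: tensor_induct)
    (simp_all add: qlinear_simps[OF qlinear_tmul] qlinear_simps[OF qlinear_tensor_strand] strand_simps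
      tensor_strand_tens tmul_tens strand_mult)

lemma uq_tensor_L_hom:
  "uq_tensor (\<lambda>u. app (L_hom u)) (\<lambda>u. app (L_hom u)) (L_gen i j) z
    = sg (par i \<and> epar i j) *\<^sub>q twist True (tensor_strand i j (twist (par j) z))"
proof (induction z rule: tensor_induct_hom)
  case (tens p r x y)
  note sm = supermodule_app[OF superalg_hom_L_hom]
  have "uq_tensor (\<lambda>u. app (L_hom u)) (\<lambda>u. app (L_hom u)) (L_gen i j) (x \<otimes> y)
    = (\<Sum>k\<in>UNIV. sg ((epar i k \<and> epar k j) \<noteq> (p \<and> epar k j)) *\<^sub>q (app (L_op i k) x \<otimes> app (L_op k j) y))"
    by (simp only: uq_tensor_L_gen[OF sm sm tens(1)] L_hom_L_gen)
  also have "\<dots> = (\<Sum>k\<in>UNIV. sg (par i \<and> epar i j) *\<^sub>q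
    (twist True (strand False i k (twist (par j) x)) \<otimes> twist True (strand False k j (twist (par j) y))))"
  proof (intro sum.cong refl)
    fix k
    show "sg ((epar i k \<and> epar k j) \<noteq> (p \<and> epar k j)) *\<^sub>q (app (L_op i k) x \<otimes> app (L_op k j) y)
      = sg (par i \<and> epar i j) *\<^sub>q
        (twist True (strand False i k (twist (par j) x)) \<otimes> twist True (strand False k j (twist (par j) y)))"
      unfolding L_op.rep_eq twist_hom[OF tens(1)]
      by (cases "par i"; cases "par j"; cases "par k"; cases p)
        (simp_all add: epar_def strand_simps twist_simps tens_simps tens_left_simps tens_right_simps scale_simps
          scale_one scale_minus_left)
  qed
  finally show ?case
    by (simp add: twist_tens tensor_strand_tens twist_simps scale_sum)
qed (simp_all add: qlinear_simps[OF qlinear_uq_tensor_right[OF supermodule_app[OF superalg_hom_L_hom] supermodule_app[OF superalg_hom_L_hom]]]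
  twist_simps qlinear_simps[OF qlinear_tensor_strand] scale_simps mult.commute)

text \<open>For the generators of the quantum superalgebra, compatibility with products is
  \<open>strand_mult\<close>, that is, multiplicativity of \<open>strand_hom\<close>. It passes to
  products of generators by the module law.\<close>

lemma L_hom_supermodule_superalgebra:
  "uq_supermodule_superalgebra (\<lambda>u :: 'n::finite uq. app (L_hom u :: ('s::finite, 'n) abar qend))"
  unfolding uq_supermodule_superalgebra_def
proof (intro conjI allI)
  let ?act = "\<lambda>u :: 'n uq. app (L_hom u :: ('s, 'n) abar qend)"
  show sm: "supermodule ?act" by (rule supermodule_app[OF superalg_hom_L_hom])
  note lin = qlinear_simps[OF superalg_homD(1)[OF superalg_hom_L_hom]] superalg_homD(3,4)[OF superalg_hom_L_hom]
    app_qend app_simps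
  fix u :: "'n uq"
  show "?act u (tmul z) = tmul (uq_tensor ?act ?act u z)" for z
  proof (induction u arbitrary: z rule: uq_induct)
    case (gen i j u)
    have "?act (L_gen i j) (tmul z) = tmul (uq_tensor ?act ?act (L_gen i j) z)" for z
    proof -
      have "twist p (tmul z) = tmul (twist p z)" for p and z :: "(('s, 'n) abar, ('s, 'n) abar) tensor"
        by (induction z rule: tensor_induct)
          (simp_all add: tmul_tens twist_tens twist_mult qlinear_simps[OF qlinear_tmul] twist_simps)
      then show ?thesis
        by (simp add: L_hom_L_gen L_op.rep_eq uq_tensor_L_hom qlinear_simps[OF qlinear_tmul] tmul_tensor_strand[symmetric])
    qed
    then show ?case by (simp add: lin gen uq_tensor_mult[OF sm sm])
  qed (simp_all add: lin uq_tensor_one[OF sm sm] qlinear_simps[OF qlinear_uq_tensor_left[OF sm sm]] qlinear_simps[OF qlinear_tmul])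
  have counit_lin: "counit (x + y) = counit x + counit y" "counit (c *\<^sub>q x) = c * counit x" for x y :: "'n uq" and c
    using counit_linear unfolding Vector_Spaces.linear_iff by blast+
  show "?act u 1 = counit u *\<^sub>q 1"
  proof (induction u rule: uq_induct)
    case (gen i j u)
    have "?act (L_gen i j) 1 = counit (L_gen i j) *\<^sub>q 1"
      by (cases "i = j") (simp_all add: L_hom_L_gen L_op.rep_eq twist_one strand_one counit_L_gen epar_same scale_one twist_simps)
    then show ?case by (simp add: lin gen counit_mult scale_scale mult.commute)
  qed (simp_all add: lin counit_one counit_lin scale_one scale_left_distrib scale_scale)
qed

text \<open>The product rule determines the operator of each \<open>L_gen i j\<close> from its
  values on generators, and the module law determines the rest. This gives the uniqueness in the
  description of \<open>Phi_bar\<close>.\<close>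

lemma uq_supermodule_superalgebra_eqI:
  fixes act act' :: "'n::finite uq \<Rightarrow> ('s::finite, 'n) abar \<Rightarrow> ('s, 'n) abar"
  assumes "uq_supermodule_superalgebra act" "uq_supermodule_superalgebra act'"
    and gen: "\<And>i j \<alpha> b. act (L_gen i j) (t_gen \<alpha> b) = act' (L_gen i j) (t_gen \<alpha> b)"
  shows "act = act'"
proof -
  have sm: "supermodule act" "supermodule act'"
    and mul: "act u (x * y) = tmul (uq_tensor act act u (x \<otimes> y))" "act' u (x * y) = tmul (uq_tensor act' act' u (x \<otimes> y))"
    and one: "act u 1 = counit u *\<^sub>q 1" "act' u 1 = counit u *\<^sub>q 1" for u x y
    using assms(1,2) by (simp_all add: uq_supermodule_superalgebra_def flip: tmul_tens)
  note lin = qlinear_simps[OF supermoduleD(4)[OF sm(1)]] qlinear_simps[OF supermoduleD(4)[OF sm(2)]]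
    qlinear_simps[OF supermoduleD(5)[OF sm(1)]] qlinear_simps[OF supermoduleD(5)[OF sm(2)]]
  have 1: "act (L_gen i j) x = act' (L_gen i j) x" for i j x
  proof (induction x arbitrary: i j rule: abar_induct)
    case (gen \<alpha> b x)
    then show ?case
      by (simp add: mul uq_tensor_L_gen[OF sm(1) sm(1) part_t_gen] uq_tensor_L_gen[OF sm(2) sm(2) part_t_gen] assms(3))
  qed (simp_all add: one lin)
  have "act u x = act' u x" for u x
    by (induction u arbitrary: x rule: uq_induct)
      (simp_all add: lin supermoduleD(2,3)[OF sm(1)] supermoduleD(2,3)[OF sm(2)] 1)
  then show ?thesis by (simp add: fun_eq_iff)
qed

lemma Phi_bar_eq: "Phi_bar = (\<lambda>u :: 'n::finite uq. app (L_hom u :: ('s::finite, 'n) abar qend))"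
  unfolding Phi_bar_def
proof (rule the_equality)
  show "uq_supermodule_superalgebra (\<lambda>u :: 'n uq. app (L_hom u :: ('s, 'n) abar qend)) \<and>
     (\<forall>c \<alpha> a b. app (L_hom (L_gen a b)) (twist (epar a b) (T_mat c \<alpha> :: ('s, 'n) abar)) =
        (scalar_mat S_inv_mat \<cdot>\<^sub>2 fst_mat T_mat) c \<alpha> a b)"
    by (simp only: L_hom_supermodule_superalgebra L_hom_L_gen L_op_T_mat simp_thms)
  fix act :: "'n uq \<Rightarrow> ('s, 'n) abar \<Rightarrow> ('s, 'n) abar"
  assume act: "uq_supermodule_superalgebra act \<and>
     (\<forall>c \<alpha> a b. act (L_gen a b) (twist (epar a b) (T_mat c \<alpha>)) =
        (scalar_mat S_inv_mat \<cdot>\<^sub>2 fst_mat T_mat) c \<alpha> a b)"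
  show "act = (\<lambda>u. app (L_hom u))"
  proof (rule uq_supermodule_superalgebra_eqI[OF conjunct1[OF act] L_hom_supermodule_superalgebra])
    fix a b :: "'n idx" and \<alpha> :: "'s idx" and c :: "'n idx"
    have sm: "supermodule act" using act by (simp add: uq_supermodule_superalgebra_def)
    have e: "t_gen \<alpha> c = sg ((par c \<and> epar \<alpha> c) \<noteq> (epar a b \<and> epar \<alpha> c)) *\<^sub>q twist (epar a b) (T_mat c \<alpha>)"
      unfolding T_mat_def twist_scale twist_hom[OF part_t_gen]
      by (cases "par c"; cases "epar \<alpha> c"; cases "epar a b"; simp add: scale_scale scale_one)
    have "act (L_gen a b) (twist (epar a b) (T_mat c \<alpha>)) = app (L_hom (L_gen a b)) (twist (epar a b) (T_mat c \<alpha>))"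
      using act by (simp only: L_hom_L_gen L_op_T_mat)
    then show "act (L_gen a b) (t_gen \<alpha> c) = app (L_hom (L_gen a b)) (t_gen \<alpha> c)"
      unfolding e qlinear_simps(2)[OF supermoduleD(4)[OF sm]] app_simps by (simp only:)
  qed
qed

section \<open>The braiding\<close>

lemma tens_one_mult: "(x \<otimes> 1) * (y \<otimes> z) = (x * y) \<otimes> (z :: 'b::superalgebra)"
proof -
  have "(x \<otimes> 1) * (part False y \<otimes> z + part True y \<otimes> z) = (x * part False y + x * part True y) \<otimes> z"
    by (simp add: distrib_left tensor_mult_hom[of False "part False y"] tensor_mult_hom[of True "part True y"]
        part_part twist_one tens_simps)
  then show ?thesis
    by (simp only: part_decompose flip: tens_add_left distrib_left)
qed

lemma tens_mult_one: "(x \<otimes> y) * (1 \<otimes> z) = x \<otimes> (y * (z :: 'b::superalgebra))"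
  by (simp add: tensor_mult_hom[OF part_one] twist_False)

text \<open>Left multiplication by the generator with indices \<beta> and \<open>b\<close> in the
  braided tensor product: the strand passes \<open>x\<close>, and the generator with the outgoing
  index multiplies \<open>y\<close>.\<close>

lift_definition braid_op :: "'n::finite idx \<Rightarrow> 'l::finite idx \<Rightarrow> (('s::finite, 'n) abar, ('l, 'n) abar) tensor qend" is
  "\<lambda>b \<beta>. tlift (\<lambda>x y. \<Sum>c\<in>UNIV. strand True b c x \<otimes> (t_gen \<beta> c * y))"
  by (intro qlinear_tlift qbilinearI qlinear_sum qlinear_compose[OF qlinear_tens_right]
      qlinear_compose[OF qlinear_tens_left] qlinear_strand qlinear_mult_left)

lemma braid_op_tens: "app (braid_op b \<beta>) (x \<otimes> y) = (\<Sum>c\<in>UNIV. strand True b c x \<otimes> (t_gen \<beta> c * y))"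
  unfolding braid_op.rep_eq
  by (intro tlift_tens qbilinearI qlinear_sum qlinear_compose[OF qlinear_tens_right]
      qlinear_compose[OF qlinear_tens_left] qlinear_strand qlinear_mult_left)

lemma part_braid_op:
  fixes b :: "'n::finite idx" and \<beta> :: "'l::finite idx"
  assumes "par \<beta>"
  shows "part (\<not> par b) (braid_op b \<beta>) = (braid_op b \<beta> :: (('s::finite, 'n) abar, ('l, 'n) abar) tensor qend)"
proof (rule part_qend_eqI)
  fix r and z :: "(('s, 'n) abar, ('l, 'n) abar) tensor"
  have "part p (app (braid_op b \<beta>) z) = app (braid_op b \<beta>) (part (p \<noteq> (\<not> par b)) z)"
    for p and z :: "(('s, 'n) abar, ('l, 'n) abar) tensor"
  proof (induction z rule: tensor_induct_hom)
    case (tens u v x y)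
    have "part (u \<noteq> epar b c) (strand True b c x) = strand True b c x" for c
      using strand_part[of True b c u x] tens(1) by simp
    moreover have "part ((\<not> par c) \<noteq> v) (t_gen \<beta> c * y) = t_gen \<beta> c * y" for c
      using mult_hom[OF part_t_gen tens(2), of \<beta> c] assms by (simp add: epar_def)
    ultimately have "part p (strand True b c x \<otimes> (t_gen \<beta> c * y))
        = (if p = ((u \<noteq> v) \<noteq> (\<not> par b)) then strand True b c x \<otimes> (t_gen \<beta> c * y) else 0)" for c
    proof -
      have e: "((u \<noteq> v) \<noteq> (\<not> par b)) = ((u \<noteq> epar b c) \<noteq> ((\<not> par c) \<noteq> v))"
        unfolding epar_def by argo
      show ?thesis unfolding e by (rule part_tens_hom) fact+
    qed
    moreover have "(\<Sum>c\<in>UNIV. if Q then f c else 0) = (if Q then (\<Sum>c\<in>UNIV. f c) else 0)"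
      for Q and f :: "'n idx \<Rightarrow> (('s, 'n) abar, ('l, 'n) abar) tensor"
      by simp
    ultimately have "part p (app (braid_op b \<beta>) (x \<otimes> y))
        = (if p = ((u \<noteq> v) \<noteq> (\<not> par b)) then app (braid_op b \<beta>) (x \<otimes> y) else 0)"
      by (simp only: braid_op_tens part_sum)
    moreover have "part (p \<noteq> (\<not> par b)) (x \<otimes> y) = (if p = ((u \<noteq> v) \<noteq> (\<not> par b)) then x \<otimes> y else 0)"
      unfolding part_tens_hom[OF tens] by (rule if_cong) auto
    moreover have "app (braid_op b \<beta>) (if Q then x \<otimes> y else 0) = (if Q then app (braid_op b \<beta>) (x \<otimes> y) else 0)" for Q
      by (simp add: app_simps)
    ultimately show ?case by (simp only:)
  qed (simp_all only: app_simps part_simps)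
  then show "part ((\<not> par b) \<noteq> r) (app (braid_op b \<beta>) (part r z)) = app (braid_op b \<beta>) (part r z)"
    by (cases r; cases "par b"; simp add: part_part)
qed

lemma qlinear_eqI_tensor:
  assumes "qlinear f" "qlinear g" "\<And>x y. f (x \<otimes> y) = g (x \<otimes> y)"
  shows "f z = g z"
  by (induction z rule: tensor_induct) (simp_all add: assms qlinear_simps[OF assms(1)] qlinear_simps[OF assms(2)])

lemma qend_eqI_tensor:
  assumes "\<And>x y. app f (x \<otimes> y) = app g (x \<otimes> y)"
  shows "f = g"
proof -
  have "app f z = app g z" for z
    by (rule qlinear_eqI_tensor[OF app_linear app_linear assms])
  then show ?thesis by (simp add: app_inject[symmetric] fun_eq_iff)
qed

text \<open>A crossing of the two strands is moved past \<open>x\<close> by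
  \<open>strand_crossing\<close>, then to the second tensor factor by
  \<open>crossing_adjoint\<close>. There it acts on a product of two generators and is evaluated by
  \<open>t_gen_relation\<close>.\<close>

lemma braid_op_relation:
  fixes i k :: "'n::finite idx" and \<alpha> \<beta> :: "'l::finite idx"
  assumes "par \<alpha>" "par \<beta>"
  shows "q powi phi \<beta> \<alpha> *\<^sub>q (braid_op i \<beta> * braid_op k \<alpha>) - (of_bool (\<beta> < \<alpha>) * \<xi>) *\<^sub>q (braid_op i \<alpha> * braid_op k \<beta>)
    = crossing True (\<lambda>i k. braid_op i \<alpha> * braid_op k \<beta> :: (('s::finite, 'n) abar, ('l, 'n) abar) tensor qend) i k"
proof (rule qend_eqI_tensor)
  fix x :: "('s, 'n) abar" and y :: "('l, 'n) abar"
  let ?g = "\<lambda>\<alpha> \<beta> i' k'. t_gen \<alpha> i' * t_gen \<beta> k' * y"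
  have mult: "app (braid_op i \<alpha> * braid_op k \<beta>) (x \<otimes> y)
      = (\<Sum>i'\<in>UNIV. \<Sum>k'\<in>UNIV. strand True i i' (strand True k k' x) \<otimes> ?g \<alpha> \<beta> i' k')" for \<alpha> \<beta> :: "'l idx" and i k :: "'n idx"
    by (simp add: app_qend braid_op_tens app_simps mult.assoc) (rule sum.swap)
  have "app (crossing True (\<lambda>i k. braid_op i \<alpha> * braid_op k \<beta>) i k) (x \<otimes> y)
      = (\<Sum>i'\<in>UNIV. \<Sum>k'\<in>UNIV. crossing True (\<lambda>i k. strand True i i' (strand True k k' x)) i k \<otimes> ?g \<alpha> \<beta> i' k')"
    by (simp only: crossing_linear[OF qlinear_app] mult crossing_sum crossing_linear[OF qlinear_tens_left])
  also have "\<dots> = (\<Sum>i'\<in>UNIV. \<Sum>k'\<in>UNIV. crossing_col True (\<lambda>i' k'. strand True i i' (strand True k k' x)) i' k' \<otimes> ?g \<alpha> \<beta> i' k')"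
    by (simp only: strand_crossing[OF braid])
  also have "\<dots> = (\<Sum>i'\<in>UNIV. \<Sum>k'\<in>UNIV. strand True i i' (strand True k k' x) \<otimes> crossing True (?g \<alpha> \<beta>) i' k')"
    by (rule crossing_adjoint[OF qbilinear_tens])
  also have "\<dots> = (\<Sum>i'\<in>UNIV. \<Sum>k'\<in>UNIV. strand True i i' (strand True k k' x) \<otimes>
      (q powi phi \<beta> \<alpha> *\<^sub>q ?g \<beta> \<alpha> i' k' - (of_bool (\<beta> < \<alpha>) * \<xi>) *\<^sub>q ?g \<alpha> \<beta> i' k'))"
  proof -
    have "crossing True (?g \<alpha> \<beta>) i' k' = q powi phi \<beta> \<alpha> *\<^sub>q ?g \<beta> \<alpha> i' k' - (of_bool (\<beta> < \<alpha>) * \<xi>) *\<^sub>q ?g \<alpha> \<beta> i' k'" for i' k'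
      by (simp only: crossing_linear[OF qlinear_mult_right, symmetric] t_gen_relation[OF assms, symmetric] mult_right_simps)
    then show ?thesis by (simp only:)
  qed
  also have "\<dots> = app (q powi phi \<beta> \<alpha> *\<^sub>q (braid_op i \<beta> * braid_op k \<alpha>)
      - (of_bool (\<beta> < \<alpha>) * \<xi>) *\<^sub>q (braid_op i \<alpha> * braid_op k \<beta>)) (x \<otimes> y)"
    by (simp only: app_qend(2,4) mult tens_right_simps sum_subtractf scale_sum)
  finally show "app (q powi phi \<beta> \<alpha> *\<^sub>q (braid_op i \<beta> * braid_op k \<alpha>)
      - (of_bool (\<beta> < \<alpha>) * \<xi>) *\<^sub>q (braid_op i \<alpha> * braid_op k \<beta>)) (x \<otimes> y)
    = app (crossing True (\<lambda>i k. braid_op i \<alpha> * braid_op k \<beta>) i k) (x \<otimes> y)" ..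
qed

definition braid_hom :: "('l::finite, 'n::finite) abar \<Rightarrow> (('s::finite, 'n) abar, ('l, 'n) abar) tensor qend" where
  "braid_hom = (SOME h. superalg_hom h \<and> (\<forall>b \<beta>. par \<beta> \<longrightarrow> h (t_gen \<beta> b) = braid_op b \<beta>))"

lemma
  shows superalg_hom_braid_hom: "superalg_hom (braid_hom :: ('l::finite, 'n::finite) abar \<Rightarrow> (('s::finite, 'n) abar, ('l, 'n) abar) tensor qend)"
    and braid_hom_t_gen: "par \<beta> \<Longrightarrow> braid_hom (t_gen \<beta> b) = (braid_op b \<beta> :: (('s::finite, 'n) abar, ('l, 'n) abar) tensor qend)"
proof -
  have "\<exists>h :: ('l, 'n) abar \<Rightarrow> (('s, 'n) abar, ('l, 'n) abar) tensor qend.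
      superalg_hom h \<and> (\<forall>b \<beta>. par \<beta> \<longrightarrow> h (t_gen \<beta> b) = braid_op b \<beta>)"
    by (rule abar_hom_exists[OF part_braid_op braid_op_relation]) blast+
  from someI_ex[OF this] show "superalg_hom (braid_hom :: ('l, 'n) abar \<Rightarrow> (('s, 'n) abar, ('l, 'n) abar) tensor qend)"
    "par \<beta> \<Longrightarrow> braid_hom (t_gen \<beta> b) = (braid_op b \<beta> :: (('s, 'n) abar, ('l, 'n) abar) tensor qend)"
    unfolding braid_hom_def by auto
qed

lemmas braid_hom_simps = qlinear_simps[OF superalg_homD(1)[OF superalg_hom_braid_hom]]
  superalg_homD(3,4)[OF superalg_hom_braid_hom]

definition braiding :: "(('l::finite, 'n::finite) abar, ('s::finite, 'n) abar) tensor \<Rightarrow> (('s, 'n) abar, ('l, 'n) abar) tensor" where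
  "braiding = tlift (\<lambda>y x. app (braid_hom y) (x \<otimes> 1))"

lemma braiding_bilinear:
  "qbilinear (\<lambda>(y :: ('l::finite, 'n::finite) abar) (x :: ('s::finite, 'n) abar). app (braid_hom y) (x \<otimes> 1))"
  by (intro qbilinearI qlinear_compose[OF app_linear] qlinear_tens_left
      qlinear_compose[OF qlinear_app superalg_homD(1)[OF superalg_hom_braid_hom]])

lemma braiding_tens: "braiding (y \<otimes> x) = app (braid_hom y) (x \<otimes> 1)"
  unfolding braiding_def by (rule tlift_tens[OF braiding_bilinear])

lemma qlinear_braiding: "qlinear braiding"
  unfolding braiding_def by (rule qlinear_tlift[OF braiding_bilinear])

section \<open>Left multiplications in the braided tensor product\<close>

lemma braid_hom_mult_right: "app (braid_hom y) (w * (1 \<otimes> y')) = app (braid_hom y) w * (1 \<otimes> y')"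
proof (induction y arbitrary: w rule: abar_induct)
  case (gen \<beta> b y)
  have "app (braid_op b \<beta>) (w * (1 \<otimes> y')) = app (braid_op b \<beta>) w * (1 \<otimes> y')" for w
    by (rule qlinear_eqI_tensor[OF qlinear_compose[OF app_linear qlinear_mult_right] qlinear_compose[OF qlinear_mult_right app_linear]])
      (simp add: tens_mult_one braid_op_tens sum_distrib_right mult.assoc)
  then show ?case by (simp add: braid_hom_simps app_qend braid_hom_t_gen[OF gen(1)] gen(2))
qed (simp_all add: braid_hom_simps app_qend distrib_right scale_mult_left)

lemma app_braid_hom: "app (braid_hom y) (x \<otimes> y') = braiding (y \<otimes> x) * (1 \<otimes> y')"
  using braid_hom_mult_right[of y "x \<otimes> 1" y'] by (simp add: braiding_tens tens_mult_one)

text \<open>The product of the braided tensor product, with left factor \<open>w\<close>.\<close>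

definition braid_mult :: "(('s::finite, 'n::finite) abar, ('l::finite, 'n) abar) tensor
    \<Rightarrow> (('s, 'n) abar, ('l, 'n) abar) tensor \<Rightarrow> (('s, 'n) abar, ('l, 'n) abar) tensor" where
  "braid_mult w t = tlift (\<lambda>x y. (x \<otimes> 1) * app (braid_hom y) t) w"

lemma braid_mult_bilinear:
  "qbilinear (\<lambda>(x :: ('s::finite, 'n::finite) abar) (y :: ('l::finite, 'n) abar). (x \<otimes> 1) * app (braid_hom y) t)"
  by (intro qbilinearI qlinear_compose[OF qlinear_mult_left] qlinear_compose[OF qlinear_mult_right] qlinear_tens_left
      qlinear_compose[OF qlinear_app superalg_homD(1)[OF superalg_hom_braid_hom]])

lemma braid_mult_tens: "braid_mult (x \<otimes> y) t = (x \<otimes> 1) * app (braid_hom y) t"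
  unfolding braid_mult_def by (rule tlift_tens[OF braid_mult_bilinear])

lemma qlinear_braid_mult: "qlinear (\<lambda>w. braid_mult w t)"
  unfolding braid_mult_def by (rule qlinear_tlift[OF braid_mult_bilinear])

lemmas braid_mult_simps = qlinear_simps[OF qlinear_braid_mult]

text \<open>Associativity with a generator on the left. It rests on \<open>strand_mult\<close>: a
  strand passes \<open>x * x'\<close> by passing first \<open>x\<close> and then
  \<open>x'\<close>.\<close>

lemma braid_op_braid_mult:
  assumes "par \<beta>"
  shows "app (braid_op b \<beta>) (braid_mult w t) = braid_mult (app (braid_op b \<beta>) w) t"
proof -
  have gen: "app (braid_op b \<beta>) ((x \<otimes> 1) * t) = (\<Sum>c\<in>UNIV. (strand True b c x \<otimes> 1) * app (braid_op c \<beta>) t)" for x t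
    by (rule qlinear_eqI_tensor[OF qlinear_compose[OF app_linear qlinear_mult_left]
          qlinear_sum[OF qlinear_compose[OF qlinear_mult_left app_linear]]])
      (simp add: tens_one_mult braid_op_tens strand_mult sum_distrib_left tens_left_simps, rule sum.swap)
  show ?thesis
    by (rule qlinear_eqI_tensor[OF qlinear_compose[OF app_linear qlinear_braid_mult] qlinear_compose[OF qlinear_braid_mult app_linear]])
      (simp add: braid_mult_tens gen braid_op_tens braid_mult_simps braid_hom_simps app_qend braid_hom_t_gen[OF assms])
qed

lemma braid_hom_mult_left: "app (braid_hom y) ((x \<otimes> 1) * t) = braid_mult (braiding (y \<otimes> x)) t"
proof (induction y arbitrary: x t rule: abar_induct)
  case (gen \<beta> b y)
  then show ?case
    by (simp add: braid_hom_simps app_qend braid_hom_t_gen braiding_tens braid_op_braid_mult)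
qed (simp_all add: braiding_tens braid_hom_simps app_qend braid_mult_tens braid_mult_simps)

lemma braiding_one_left: "braiding (1 \<otimes> x) = x \<otimes> 1"
  by (simp add: braiding_tens braid_hom_simps app_qend)

lemma braiding_one_right: "braiding (y \<otimes> (1 :: ('s::finite, 'n::finite) abar)) = 1 \<otimes> (y :: ('l::finite, 'n) abar)"
proof -
  have "app (braid_hom y) (1 \<otimes> 1) = (1 :: ('s, 'n) abar) \<otimes> y"
  proof (induction y rule: abar_induct)
    case (gen \<beta> b y)
    have "strand True b c (1 :: ('s, 'n) abar) \<otimes> (t_gen \<beta> c * y) = (if c = b then 1 \<otimes> (t_gen \<beta> b * y) else 0)" for c
      by (simp add: strand_one)
    then show ?case
      using gen by (simp add: braid_hom_simps app_qend braid_hom_t_gen braid_op_tens)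
  qed (simp_all add: braid_hom_simps app_qend tens_simps)
  then show ?thesis by (simp add: braiding_tens)
qed

lemma braiding_gen:
  assumes "par \<alpha>" "par \<beta>"
  shows "braiding (t_gen \<beta> b \<otimes> t_gen \<alpha> a) = crossing True (\<lambda>a b. t_gen \<alpha> a \<otimes> t_gen \<beta> b) b a"
  by (simp add: braiding_tens braid_hom_t_gen[OF assms(2)] braid_op_tens strand_gen_contract[OF assms(1) qbilinear_tens])

section \<open>Parity and equivariance of the braiding\<close>

lemma even_braiding: "even_map (braiding :: (('l::finite, 'n::finite) abar, ('s::finite, 'n) abar) tensor \<Rightarrow> _)"
proof -
  have "\<forall>p. braiding (part p z) = part p (braiding z)" for z :: "(('l, 'n) abar, ('s, 'n) abar) tensor"
  proof (induction z rule: tensor_induct_hom)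
    case (tens u v y x)
    have "part u (braid_hom y) = (braid_hom y :: (('s, 'n) abar, ('l, 'n) abar) tensor qend)"
      by (simp add: tens(1) flip: even_mapD[OF superalg_homD(2)[OF superalg_hom_braid_hom]])
    moreover have "part v (x \<otimes> (1 :: ('l, 'n) abar)) = x \<otimes> 1"
      using part_tens_hom[OF tens(2) part_one, of v] by simp
    ultimately have "part (u \<noteq> v) (app (braid_hom y) (x \<otimes> 1)) = app (braid_hom y) (x \<otimes> 1)"
      by (rule part_app)
    then have "part (u \<noteq> v) (braiding (y \<otimes> x)) = braiding (y \<otimes> x)" by (simp only: braiding_tens)
    then show ?case
      unfolding part_tens_hom[OF tens] by (auto simp: part_hom qlinear_simps[OF qlinear_braiding])
  qed (simp_all add: part_simps qlinear_simps[OF qlinear_braiding])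
  then show ?thesis by (simp add: even_map_def)
qed

text \<open>Equivariance in the form needed for an induction on \<open>y\<close>: moving the inverse
  strand past the result of the action is moving it past \<open>y\<close> and then past
  \<open>w\<close>.\<close>

lemma tensor_strand_braid_hom:
  "tensor_strand i j (app (braid_hom y) w) = (\<Sum>k\<in>UNIV. app (braid_hom (strand False i k y)) (tensor_strand k j w))"
proof (induction y arbitrary: i j w rule: abar_induct)
  case one
  have "app (braid_hom (strand False i k 1)) (tensor_strand k j w) = (if k = i then tensor_strand i j w else 0)" for k
    by (simp add: strand_one braid_hom_simps app_qend)
  then show ?case by (simp add: braid_hom_simps app_qend)
next
  case (gen \<beta> b y)
  have *: "tensor_strand i j (app (braid_op b \<beta>) w) = (\<Sum>k\<in>UNIV. app (braid_hom (strand False i k (t_gen \<beta> b))) (tensor_strand k j w))"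
    for i j w
  proof (rule qlinear_eqI_tensor[where z = w])
    show "qlinear (\<lambda>w. tensor_strand i j (app (braid_op b \<beta>) w))"
      by (rule qlinear_compose[OF qlinear_tensor_strand app_linear])
    show "qlinear (\<lambda>w. \<Sum>k\<in>UNIV. app (braid_hom (strand False i k (t_gen \<beta> b))) (tensor_strand k j w))"
      by (rule qlinear_sum[OF qlinear_compose[OF app_linear qlinear_tensor_strand]])
    fix x y
    let ?f = "\<lambda>a m. t_gen \<beta> a * strand False m j y"
    have "tensor_strand i j (app (braid_op b \<beta>) (x \<otimes> y))
      = (\<Sum>c\<in>UNIV. \<Sum>k\<in>UNIV. strand False i k (strand True b c x) \<otimes> crossing False ?f k c)"
      by (simp add: braid_op_tens qlinear_simps[OF qlinear_tensor_strand] tensor_strand_tens strand_gen_mult[OF gen(1)])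
    also have "\<dots> = (\<Sum>k\<in>UNIV. \<Sum>c\<in>UNIV. strand False i k (strand True b c x) \<otimes> crossing False ?f k c)"
      by (rule sum.swap)
    also have "\<dots> = (\<Sum>k\<in>UNIV. \<Sum>c\<in>UNIV. crossing_col False (\<lambda>k c. strand False i k (strand True b c x)) k c \<otimes> ?f k c)"
      by (rule crossing_adjoint[OF qbilinear_tens, symmetric])
    \<comment> \<open>The strand of the braiding and the inverse strand of the action are exchanged
      by an inverse crossing; the second relation in \<open>braid_inverse\<close> is the one that
      fits.\<close>
    also have "\<dots> = (\<Sum>c\<in>UNIV. \<Sum>m\<in>UNIV. crossing False (\<lambda>a k. strand True a c (strand False k m x)) i b \<otimes> ?f c m)"
      by (simp only: strand_crossing[OF braid_inverse(2)])
    also have "\<dots> = (\<Sum>m\<in>UNIV. \<Sum>c\<in>UNIV. crossing False (\<lambda>a k. strand True a c (strand False k m x)) i b \<otimes> ?f c m)"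
      by (rule sum.swap)
    also have "\<dots> = crossing False (\<lambda>a k. app (braid_hom (t_gen \<beta> a)) (tensor_strand k j (x \<otimes> y))) i b"
      by (simp add: braid_hom_t_gen[OF gen(1)] tensor_strand_tens app_simps braid_op_tens crossing_sum crossing_linear[OF qlinear_tens_left])
    also have "\<dots> = (\<Sum>k\<in>UNIV. app (braid_hom (strand False i k (t_gen \<beta> b))) (tensor_strand k j (x \<otimes> y)))"
      by (rule strand_gen_contract[OF gen(1), symmetric])
        (intro qbilinearI app_linear qlinear_compose[OF qlinear_app superalg_homD(1)[OF superalg_hom_braid_hom]])
    finally show "tensor_strand i j (app (braid_op b \<beta>) (x \<otimes> y))
      = (\<Sum>k\<in>UNIV. app (braid_hom (strand False i k (t_gen \<beta> b))) (tensor_strand k j (x \<otimes> y)))" .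
  qed
  have "tensor_strand i j (app (braid_hom (t_gen \<beta> b * y)) w)
    = (\<Sum>k\<in>UNIV. \<Sum>m\<in>UNIV. app (braid_hom (strand False i k (t_gen \<beta> b) * strand False k m y)) (tensor_strand m j w))"
    by (simp add: braid_hom_simps app_qend braid_hom_t_gen[OF gen(1)] * gen(2) app_simps)
  also have "\<dots> = (\<Sum>m\<in>UNIV. app (braid_hom (strand False i m (t_gen \<beta> b * y))) (tensor_strand m j w))"
    by (subst sum.swap) (simp add: strand_mult braid_hom_simps qlinear_simps[OF qlinear_app])
  finally show ?case .
qed (simp_all add: strand_simps braid_hom_simps app_qend qlinear_simps[OF qlinear_tensor_strand] sum.distrib scale_sum)

lemma braiding_tensor_strand:
  fixes z :: "(('l::finite, 'n::finite) abar, ('s::finite, 'n) abar) tensor"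
  shows "braiding (tensor_strand i j z) = tensor_strand i j (braiding z)"
proof (rule qlinear_eqI_tensor[OF qlinear_compose[OF qlinear_braiding qlinear_tensor_strand] qlinear_compose[OF qlinear_tensor_strand qlinear_braiding]])
  fix y :: "('l, 'n) abar" and x :: "('s, 'n) abar"
  have "strand False k m x \<otimes> strand False m j (1 :: ('l, 'n) abar) = (if m = j then strand False k j x \<otimes> 1 else 0)" for k m
    by (simp add: strand_one)
  then have "tensor_strand k j (x \<otimes> (1 :: ('l, 'n) abar)) = strand False k j x \<otimes> 1" for k
    by (simp add: tensor_strand_tens)
  then show "braiding (tensor_strand i j (y \<otimes> x)) = tensor_strand i j (braiding (y \<otimes> x))"
    by (simp add: tensor_strand_tens qlinear_simps[OF qlinear_braiding] braiding_tens tensor_strand_braid_hom)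
qed

lemma supermodule_hom_braiding:
  "supermodule_hom (uq_tensor Phi_bar Phi_bar) (uq_tensor Phi_bar Phi_bar)
    (braiding :: (('l::finite, 'n::finite) abar, ('s::finite, 'n) abar) tensor \<Rightarrow> _)"
proof -
  note sm = supermodule_app[OF superalg_hom_L_hom]
  note lin = qlinear_simps[OF qlinear_uq_tensor_left[OF sm sm]] qlinear_simps[OF qlinear_braiding]
  have "braiding (uq_tensor (\<lambda>u. app (L_hom u)) (\<lambda>u. app (L_hom u)) u z)
    = uq_tensor (\<lambda>u. app (L_hom u)) (\<lambda>u. app (L_hom u)) u (braiding z)" for u and z :: "(('l, 'n) abar, ('s, 'n) abar) tensor"
  proof (induction u arbitrary: z rule: uq_induct)
    case (gen i j u)
    have "braiding (uq_tensor (\<lambda>u. app (L_hom u)) (\<lambda>u. app (L_hom u)) (L_gen i j) z)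
      = uq_tensor (\<lambda>u. app (L_hom u)) (\<lambda>u. app (L_hom u)) (L_gen i j) (braiding z)" for z :: "(('l, 'n) abar, ('s, 'n) abar) tensor"
      by (simp add: uq_tensor_L_hom lin even_map_twist[OF even_braiding qlinear_braiding] braiding_tensor_strand)
    then show ?case by (simp add: uq_tensor_mult[OF sm sm] gen)
  qed (simp_all add: uq_tensor_one[OF sm sm] lin)
  then show ?thesis
    unfolding supermodule_hom_def Phi_bar_eq by (simp add: qlinear_braiding even_braiding)
qed

section \<open>The hexagon identities\<close>

context
  fixes f :: "'a::qspace \<Rightarrow> 'c::qspace" and g :: "'b::qspace \<Rightarrow> 'd::qspace"
  assumes lin: "qlinear f" "qlinear g"
begin

private lemma tmap_bilinear: "qbilinear (\<lambda>a b. f a \<otimes> g b)"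
  by (intro qbilinearI qlinear_compose[OF qlinear_tens_right] qlinear_compose[OF qlinear_tens_left] lin)

lemma tmap_tens: "tmap f g (a \<otimes> b) = f a \<otimes> g b"
  unfolding tmap_def by (rule tlift_tens[OF tmap_bilinear])

lemma qlinear_tmap: "qlinear (tmap f g)"
  unfolding tmap_def by (rule qlinear_tlift[OF tmap_bilinear])

end

lemma tassoc_inner: "qbilinear (\<lambda>a b. a \<otimes> (b \<otimes> c))"
  by (intro qbilinearI qlinear_compose[OF qlinear_tens_right] qlinear_tens_left)

lemma tassoc_bilinear: "qbilinear (\<lambda>z c. tlift (\<lambda>a b. a \<otimes> (b \<otimes> c)) z)"
proof (intro qbilinearI qlinear_tlift[OF tassoc_inner] qlinearI)
  fix z c c' e
  show "tlift (\<lambda>a b. a \<otimes> (b \<otimes> (c + c'))) z = tlift (\<lambda>a b. a \<otimes> (b \<otimes> c)) z + tlift (\<lambda>a b. a \<otimes> (b \<otimes> c')) z"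
    by (induction z rule: tensor_induct)
      (simp_all only: tlift_add[OF tassoc_inner] tlift_scale[OF tassoc_inner] tlift_tens[OF tassoc_inner],
        simp_all add: tens_simps scale_right_distrib add_ac)
  show "tlift (\<lambda>a b. a \<otimes> (b \<otimes> (e *\<^sub>q c))) z = e *\<^sub>q tlift (\<lambda>a b. a \<otimes> (b \<otimes> c)) z"
    by (induction z rule: tensor_induct)
      (simp_all only: tlift_add[OF tassoc_inner] tlift_scale[OF tassoc_inner] tlift_tens[OF tassoc_inner],
        simp_all add: tens_simps scale_right_distrib scale_scale mult.commute)
qed

lemma tassoc_tens: "tassoc ((a \<otimes> b) \<otimes> c) = a \<otimes> (b \<otimes> c)"
  unfolding tassoc_def tlift_tens[OF tassoc_bilinear] by (rule tlift_tens[OF tassoc_inner])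

lemma qlinear_tassoc: "qlinear tassoc"
  unfolding tassoc_def by (rule qlinear_tlift[OF tassoc_bilinear])

lemma tassoc_inv_inner: "qbilinear (\<lambda>b c. (a \<otimes> b) \<otimes> c)"
  by (intro qbilinearI qlinear_compose[OF qlinear_tens_left] qlinear_tens_right)

lemma tassoc_inv_bilinear: "qbilinear (\<lambda>a z. tlift (\<lambda>b c. (a \<otimes> b) \<otimes> c) z)"
proof (intro qbilinearI qlinear_tlift[OF tassoc_inv_inner] qlinearI)
  fix z a a' e
  show "tlift (\<lambda>b c. ((a + a') \<otimes> b) \<otimes> c) z = tlift (\<lambda>b c. (a \<otimes> b) \<otimes> c) z + tlift (\<lambda>b c. (a' \<otimes> b) \<otimes> c) z"
    by (induction z rule: tensor_induct)
      (simp_all only: tlift_add[OF tassoc_inv_inner] tlift_scale[OF tassoc_inv_inner] tlift_tens[OF tassoc_inv_inner],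
        simp_all add: tens_simps scale_right_distrib add_ac)
  show "tlift (\<lambda>b c. ((e *\<^sub>q a) \<otimes> b) \<otimes> c) z = e *\<^sub>q tlift (\<lambda>b c. (a \<otimes> b) \<otimes> c) z"
    by (induction z rule: tensor_induct)
      (simp_all only: tlift_add[OF tassoc_inv_inner] tlift_scale[OF tassoc_inv_inner] tlift_tens[OF tassoc_inv_inner],
        simp_all add: tens_simps scale_right_distrib scale_scale mult.commute)
qed

lemma tassoc_inv_tens: "tassoc_inv (a \<otimes> (b \<otimes> c)) = (a \<otimes> b) \<otimes> c"
  unfolding tassoc_inv_def tlift_tens[OF tassoc_inv_bilinear] by (rule tlift_tens[OF tassoc_inv_inner])

lemma qlinear_tassoc_inv: "qlinear tassoc_inv"
  unfolding tassoc_inv_def by (rule qlinear_tlift[OF tassoc_inv_bilinear])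

lemma tmap_tmul_right: "tmap id tmul (tassoc (t \<otimes> y)) = t * (1 \<otimes> y)"
proof (rule qlinear_eqI_tensor[of _ "\<lambda>t. t * (1 \<otimes> y)"])
  show "qlinear (\<lambda>t. tmap id tmul (tassoc (t \<otimes> y)))"
    by (rule qlinear_compose[OF qlinear_tmap[OF qlinear_id(2) qlinear_tmul] qlinear_compose[OF qlinear_tassoc qlinear_tens_left]])
qed (simp_all only: qlinear_mult_right tassoc_tens tmap_tens[OF qlinear_id(1) qlinear_tmul] tmap_tens[OF qlinear_id(2) qlinear_tmul] tmul_tens tens_mult_one id_apply)

lemma tmap_tmul_left: "tmap tmul id (tassoc_inv (x \<otimes> t)) = (x \<otimes> 1) * t"
proof (rule qlinear_eqI_tensor[of _ "\<lambda>t. (x \<otimes> 1) * t"])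
  show "qlinear (\<lambda>t. tmap tmul id (tassoc_inv (x \<otimes> t)))"
    by (rule qlinear_compose[OF qlinear_tmap[OF qlinear_tmul qlinear_id(2)] qlinear_compose[OF qlinear_tassoc_inv qlinear_tens_right]])
qed (simp_all only: qlinear_mult_left tassoc_inv_tens tmap_tens[OF qlinear_tmul qlinear_id(1)] tmap_tens[OF qlinear_tmul qlinear_id(2)] tmul_tens tens_one_mult id_apply)

context
  fixes \<Theta> :: "('a::superalgebra, 'b::superalgebra) tensor \<Rightarrow> ('b, 'a) tensor"
  assumes \<Theta>: "qlinear \<Theta>"
begin

private lemma left_bilinear: "qbilinear (\<lambda>x y. (x \<otimes> 1) * \<Theta> (y \<otimes> x'))"
  by (intro qbilinearI qlinear_compose[OF qlinear_mult_left] qlinear_compose[OF qlinear_mult_right]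
      qlinear_compose[OF \<Theta>] qlinear_tens_left)

private lemma right_bilinear: "qbilinear (\<lambda>x y. \<Theta> (y' \<otimes> x) * (1 \<otimes> y))"
  by (intro qbilinearI qlinear_compose[OF qlinear_mult_left] qlinear_compose[OF qlinear_mult_right]
      qlinear_compose[OF \<Theta>] qlinear_tens_right)

text \<open>All maps involved are linear, so pure tensors suffice; the associators then disappear.
  The right side is the braided product of \<open>\<Theta> (y \<otimes> x)\<close> and
  \<open>x' \<otimes> 1\<close>.\<close>

lemma hexagon_left_iff:
  "(\<forall>z. \<Theta> (tmap id tmul z) = tmap tmul id (tassoc_inv (tmap id \<Theta> (tassoc (tmap \<Theta> id (tassoc_inv z))))))
    \<longleftrightarrow> (\<forall>y x x'. \<Theta> (y \<otimes> (x * x')) = tlift (\<lambda>x y. (x \<otimes> 1) * \<Theta> (y \<otimes> x')) (\<Theta> (y \<otimes> x)))"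
    (is "(\<forall>z. ?l z = ?r z) \<longleftrightarrow> _")
proof -
  note inner = qlinear_compose[OF qlinear_tmap[OF qlinear_tmul qlinear_id(2)]
    qlinear_compose[OF qlinear_tassoc_inv qlinear_compose[OF qlinear_tmap[OF qlinear_id(2) \<Theta>] qlinear_tassoc]]]
  note l = qlinear_compose[OF \<Theta> qlinear_tmap[OF qlinear_id(2) qlinear_tmul]]
  note r = qlinear_compose[OF inner qlinear_compose[OF qlinear_tmap[OF \<Theta> qlinear_id(2)] qlinear_tassoc_inv]]
  have r_tens: "?r (y \<otimes> (x \<otimes> x')) = tlift (\<lambda>x y. (x \<otimes> 1) * \<Theta> (y \<otimes> x')) (\<Theta> (y \<otimes> x))" for y x x'
  proof -
    have "tmap tmul id (tassoc_inv (tmap id \<Theta> (tassoc (t \<otimes> x')))) = tlift (\<lambda>x y. (x \<otimes> 1) * \<Theta> (y \<otimes> x')) t" for t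
      by (rule qlinear_eqI_tensor[OF qlinear_compose[OF inner qlinear_tens_left] qlinear_tlift[OF left_bilinear]])
        (simp only: id_apply tassoc_tens tmap_tens[OF qlinear_id(2) \<Theta>] tmap_tmul_left tlift_tens[OF left_bilinear])
    then show ?thesis by (simp only: id_apply tassoc_inv_tens tmap_tens[OF \<Theta> qlinear_id(2)])
  qed
  have l_tens: "?l (y \<otimes> (x \<otimes> x')) = \<Theta> (y \<otimes> (x * x'))" for y x x'
    by (simp only: id_apply tmul_tens tmap_tens[OF qlinear_id(2) qlinear_tmul] tmul_tens)
  show ?thesis
  proof (intro iffI allI)
    fix z
    assume *: "\<forall>y x x'. \<Theta> (y \<otimes> (x * x')) = tlift (\<lambda>x y. (x \<otimes> 1) * \<Theta> (y \<otimes> x')) (\<Theta> (y \<otimes> x))"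
    show "?l z = ?r z"
    proof (rule qlinear_eqI_tensor[OF l r])
      fix y w
      show "?l (y \<otimes> w) = ?r (y \<otimes> w)"
        by (rule qlinear_eqI_tensor[OF qlinear_compose[OF l qlinear_tens_right] qlinear_compose[OF r qlinear_tens_right]])
          (simp only: l_tens r_tens *)
    qed
  next
    fix y x x'
    assume "\<forall>z. ?l z = ?r z"
    then have "?l (y \<otimes> (x \<otimes> x')) = ?r (y \<otimes> (x \<otimes> x'))" by (rule spec)
    then show "\<Theta> (y \<otimes> (x * x')) = tlift (\<lambda>x y. (x \<otimes> 1) * \<Theta> (y \<otimes> x')) (\<Theta> (y \<otimes> x))"
      by (simp only: l_tens r_tens)
  qed
qed

lemma hexagon_right_iff:
  "(\<forall>z. \<Theta> (tmap tmul id z) = tmap id tmul (tassoc (tmap \<Theta> id (tassoc_inv (tmap id \<Theta> (tassoc z))))))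
    \<longleftrightarrow> (\<forall>y y' x. \<Theta> ((y * y') \<otimes> x) = tlift (\<lambda>x y'. \<Theta> (y \<otimes> x) * (1 \<otimes> y')) (\<Theta> (y' \<otimes> x)))"
    (is "(\<forall>z. ?l z = ?r z) \<longleftrightarrow> _")
proof -
  note inner = qlinear_compose[OF qlinear_tmap[OF qlinear_id(2) qlinear_tmul]
    qlinear_compose[OF qlinear_tassoc qlinear_compose[OF qlinear_tmap[OF \<Theta> qlinear_id(2)] qlinear_tassoc_inv]]]
  note l = qlinear_compose[OF \<Theta> qlinear_tmap[OF qlinear_tmul qlinear_id(2)]]
  note r = qlinear_compose[OF inner qlinear_compose[OF qlinear_tmap[OF qlinear_id(2) \<Theta>] qlinear_tassoc]]
  have r_tens: "?r ((y \<otimes> y') \<otimes> x) = tlift (\<lambda>x y'. \<Theta> (y \<otimes> x) * (1 \<otimes> y')) (\<Theta> (y' \<otimes> x))" for y y' x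
  proof -
    have "tmap id tmul (tassoc (tmap \<Theta> id (tassoc_inv (y \<otimes> t)))) = tlift (\<lambda>x y'. \<Theta> (y \<otimes> x) * (1 \<otimes> y')) t" for t
      by (rule qlinear_eqI_tensor[OF qlinear_compose[OF inner qlinear_tens_right] qlinear_tlift[OF right_bilinear]])
        (simp only: id_apply tassoc_inv_tens tmap_tens[OF \<Theta> qlinear_id(2)] tmap_tmul_right tlift_tens[OF right_bilinear])
    then show ?thesis by (simp only: id_apply tassoc_tens tmap_tens[OF qlinear_id(2) \<Theta>])
  qed
  have l_tens: "?l ((y \<otimes> y') \<otimes> x) = \<Theta> ((y * y') \<otimes> x)" for y y' x
    by (simp only: id_apply tmul_tens tmap_tens[OF qlinear_tmul qlinear_id(2)] tmul_tens)
  show ?thesis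
  proof (intro iffI allI)
    fix z
    assume *: "\<forall>y y' x. \<Theta> ((y * y') \<otimes> x) = tlift (\<lambda>x y'. \<Theta> (y \<otimes> x) * (1 \<otimes> y')) (\<Theta> (y' \<otimes> x))"
    show "?l z = ?r z"
    proof (rule qlinear_eqI_tensor[OF l r])
      fix w x
      show "?l (w \<otimes> x) = ?r (w \<otimes> x)"
        by (rule qlinear_eqI_tensor[OF qlinear_compose[OF l qlinear_tens_left] qlinear_compose[OF r qlinear_tens_left]])
          (simp only: l_tens r_tens *)
    qed
  next
    fix y y' x
    assume "\<forall>z. ?l z = ?r z"
    then have "?l ((y \<otimes> y') \<otimes> x) = ?r ((y \<otimes> y') \<otimes> x)" by (rule spec)
    then show "\<Theta> ((y * y') \<otimes> x) = tlift (\<lambda>x y'. \<Theta> (y \<otimes> x) * (1 \<otimes> y')) (\<Theta> (y' \<otimes> x))"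
      by (simp only: l_tens r_tens)
  qed
qed

end

text \<open>The associativity \<open>braid_hom_mult_left\<close>, applied to
  \<open>x' \<otimes> 1\<close>.\<close>

lemma braiding_mult_right:
  "braiding (y \<otimes> (x * x')) = tlift (\<lambda>x y. (x \<otimes> 1) * braiding (y \<otimes> x')) (braiding (y \<otimes> x))"
  using braid_hom_mult_left[of y x "x' \<otimes> 1"] by (simp add: tens_one_mult braiding_tens braid_mult_def)

text \<open>The law that a product acts by the composite of the operators, with the action on a
  general tensor expressed by \<open>app_braid_hom\<close>.\<close>

lemma braiding_mult_left:
  "braiding ((y * y') \<otimes> x) = tlift (\<lambda>x y'. braiding (y \<otimes> x) * (1 \<otimes> y')) (braiding (y' \<otimes> x))"
proof -
  have bil: "qbilinear (\<lambda>x y'. braiding (y \<otimes> x) * (1 \<otimes> y'))"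
    by (intro qbilinearI qlinear_compose[OF qlinear_mult_left] qlinear_compose[OF qlinear_mult_right]
      qlinear_compose[OF qlinear_braiding] qlinear_tens_right)
  have "app (braid_hom y) t = tlift (\<lambda>x y'. braiding (y \<otimes> x) * (1 \<otimes> y')) t" for t
    by (rule qlinear_eqI_tensor[OF app_linear qlinear_tlift[OF bil]]) (simp only: app_braid_hom tlift_tens[OF bil])
  then show ?thesis by (simp add: braiding_tens braid_hom_simps app_qend)
qed

section \<open>The condition on generators, and uniqueness\<close>

lemma scale_sg_eq_iff: "sg p *\<^sub>q x = sg p *\<^sub>q y \<longleftrightarrow> x = (y :: 'v::qspace)"
  by (cases p) (simp_all add: scale_one scale_minus_left)

text \<open>Entries with a positive column vanish on both sides because of \<open>T_neg\<close>. For
  two negative columns both sides carry the same sign, and its removal leaves the component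
  formula.\<close>

lemma generator_condition_iff:
  fixes \<Theta> :: "(('l::finite, 'n::finite) abar, ('s::finite, 'n) abar) tensor \<Rightarrow> (('s, 'n) abar, ('l, 'n) abar) tensor"
  assumes \<Theta>: "qlinear \<Theta>"
  shows "\<Theta> ((fst_mat (\<lambda>b \<beta>. T_neg b \<beta> \<otimes> 1) \<cdot>\<^sub>3 snd_mat (\<lambda>a \<alpha>. 1 \<otimes> T_neg a \<alpha>)) b \<beta> a \<alpha>) =
       (scalar_mat S_mat \<cdot>\<^sub>3 snd_mat (\<lambda>a \<alpha>. T_neg a \<alpha> \<otimes> 1) \<cdot>\<^sub>3 fst_mat (\<lambda>b \<beta>. 1 \<otimes> T_neg b \<beta>)) b \<beta> a \<alpha>
    \<longleftrightarrow> (par \<alpha> \<longrightarrow> par \<beta> \<longrightarrow> \<Theta> (t_gen \<beta> b \<otimes> t_gen \<alpha> a) = crossing True (\<lambda>a b. t_gen \<alpha> a \<otimes> t_gen \<beta> b) b a)"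
proof -
  have part: "part (epar b \<alpha>) (T_neg b \<alpha>) = T_neg b \<alpha>" for b :: "'m::finite idx" and \<alpha> :: "'r::finite idx"
  proof -
    have "epar b \<alpha> = epar \<alpha> b" by (auto simp: epar_def)
    then show ?thesis by (simp add: T_neg_def part_t_gen)
  qed
  have part1: "part (epar b \<beta>) (T_neg b \<beta> \<otimes> (1 :: 'x::superalgebra)) = T_neg b \<beta> \<otimes> 1"
    for b :: "'m::finite idx" and \<beta> :: "'r::finite idx"
    by (rule trans[OF part_tens_hom[OF part part_one]]) simp
  have l: "(fst_mat (\<lambda>b \<beta>. T_neg b \<beta> \<otimes> 1) \<cdot>\<^sub>3 snd_mat (\<lambda>a \<alpha>. 1 \<otimes> T_neg a \<alpha>)) b \<beta> a \<alpha>
      = sg (epar b \<beta> \<and> epar a \<alpha>) *\<^sub>q (T_neg b \<beta> \<otimes> T_neg a \<alpha> :: (('l, 'n) abar, ('s, 'n) abar) tensor)"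
    by (simp add: fst_snd_mult3[OF part1] tens_mult_one)
  have r: "(scalar_mat S_mat \<cdot>\<^sub>3 snd_mat (\<lambda>a \<alpha>. T_neg a \<alpha> \<otimes> 1) \<cdot>\<^sub>3 fst_mat (\<lambda>b \<beta>. 1 \<otimes> T_neg b \<beta>)) b \<beta> a \<alpha>
      = (\<Sum>b'\<in>UNIV. \<Sum>a'\<in>UNIV. S_mat b b' a a' *\<^sub>q sg (epar a a' \<and> epar b' \<beta>) *\<^sub>q (T_neg a' \<alpha> \<otimes> T_neg b' \<beta>)
          :: (('s, 'n) abar, ('l, 'n) abar) tensor)"
    by (simp add: S_left_mult3[OF part1] S_left_def tens_mult_one)
  show ?thesis
  proof (cases "par \<alpha> \<and> par \<beta>")
    case True
    have "(\<Sum>b'\<in>UNIV. \<Sum>a'\<in>UNIV. S_mat b b' a a' *\<^sub>q sg (epar a a' \<and> epar b' \<beta>) *\<^sub>q (T_neg a' \<alpha> \<otimes> T_neg b' \<beta>))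
      = sg (epar b \<beta> \<and> epar a \<alpha>) *\<^sub>q crossing True (\<lambda>a b. t_gen \<alpha> a \<otimes> t_gen \<beta> b) b a"
      unfolding S_mat_row using True
      by (cases "par a"; cases "par b")
        (simp_all add: T_neg_def epar_def crossing_def cross_def scale_simps scale_one scale_minus_left mult_ac)
    then show ?thesis
      unfolding l r using True
      by (simp add: T_neg_def qlinear_simps[OF \<Theta>] scale_sg_eq_iff)
  next
    case False
    then show ?thesis
      unfolding l r by (auto simp: T_neg_def qlinear_simps[OF \<Theta>])
  qed
qed

lemma braided_map_eqI:
  fixes \<Theta> \<Theta>' :: "(('l::finite, 'n::finite) abar, ('s::finite, 'n) abar) tensor \<Rightarrow> (('s, 'n) abar, ('l, 'n) abar) tensor"
  assumes lin: "qlinear \<Theta>" "qlinear \<Theta>'"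
    and left: "\<And>y x x'. \<Theta> (y \<otimes> (x * x')) = tlift (\<lambda>x y. (x \<otimes> 1) * \<Theta> (y \<otimes> x')) (\<Theta> (y \<otimes> x))"
      "\<And>y x x'. \<Theta>' (y \<otimes> (x * x')) = tlift (\<lambda>x y. (x \<otimes> 1) * \<Theta>' (y \<otimes> x')) (\<Theta>' (y \<otimes> x))"
    and right: "\<And>y y' x. \<Theta> ((y * y') \<otimes> x) = tlift (\<lambda>x y'. \<Theta> (y \<otimes> x) * (1 \<otimes> y')) (\<Theta> (y' \<otimes> x))"
      "\<And>y y' x. \<Theta>' ((y * y') \<otimes> x) = tlift (\<lambda>x y'. \<Theta>' (y \<otimes> x) * (1 \<otimes> y')) (\<Theta>' (y' \<otimes> x))"
    and one: "\<And>x. \<Theta> (1 \<otimes> x) = x \<otimes> 1" "\<And>x. \<Theta>' (1 \<otimes> x) = x \<otimes> 1"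
      "\<And>y. \<Theta> (y \<otimes> 1) = 1 \<otimes> y" "\<And>y. \<Theta>' (y \<otimes> 1) = 1 \<otimes> y"
    and gen: "\<And>\<alpha> \<beta> a b. par \<alpha> \<Longrightarrow> par \<beta> \<Longrightarrow> \<Theta> (t_gen \<beta> b \<otimes> t_gen \<alpha> a) = crossing True (\<lambda>a b. t_gen \<alpha> a \<otimes> t_gen \<beta> b) b a"
      "\<And>\<alpha> \<beta> a b. par \<alpha> \<Longrightarrow> par \<beta> \<Longrightarrow> \<Theta>' (t_gen \<beta> b \<otimes> t_gen \<alpha> a) = crossing True (\<lambda>a b. t_gen \<alpha> a \<otimes> t_gen \<beta> b) b a"
  shows "\<Theta> = \<Theta>'"
proof -
  note simps = qlinear_simps[OF lin(1)] qlinear_simps[OF lin(2)]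
  have 1: "\<Theta> (t_gen \<beta> b \<otimes> x) = \<Theta>' (t_gen \<beta> b \<otimes> x)" if \<beta>: "par \<beta>" for \<beta> b x
  \<comment> \<open>The crossing changes the second index of the generator but keeps \<beta>, so the
    induction hypothesis is needed for all \<open>b\<close>.\<close>
  proof (induction x arbitrary: b rule: abar_induct)
    case (gen \<alpha> a x)
    have "tlift (\<lambda>x' y. (x' \<otimes> 1) * \<Phi> (y \<otimes> x)) (crossing True (\<lambda>a b. t_gen \<alpha> a \<otimes> t_gen \<beta> b) b a)
      = crossing True (\<lambda>a b. (t_gen \<alpha> a \<otimes> 1) * \<Phi> (t_gen \<beta> b \<otimes> x)) b a" if \<Phi>: "qlinear \<Phi>"
      for \<Phi> :: "(('l, 'n) abar, ('s, 'n) abar) tensor \<Rightarrow> (('s, 'n) abar, ('l, 'n) abar) tensor"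
    proof -
      have bil: "qbilinear (\<lambda>x' y. (x' \<otimes> 1) * \<Phi> (y \<otimes> x))"
        by (intro qbilinearI qlinear_compose[OF qlinear_mult_left] qlinear_compose[OF qlinear_mult_right]
          qlinear_compose[OF \<Phi>] qlinear_tens_left)
      show ?thesis
        by (simp only: crossing_linear[OF qlinear_tlift[OF bil]] tlift_tens[OF bil])
    qed
    from this[OF lin(1)] this[OF lin(2)] show ?case
      by (simp only: left assms(11,12)[OF gen(1) \<beta>] gen(2))
  qed (simp_all add: one simps tens_simps)
  have "\<Theta> (y \<otimes> x) = \<Theta>' (y \<otimes> x)" for y x
  \<comment> \<open>The other hexagon splits off a generator from \<open>y\<close>; the induction
    hypothesis applies to the remaining word, and the case of a single generator to what is
    left.\<close>
  proof (induction y arbitrary: x rule: abar_induct)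
    case (gen \<beta> b y)
    then show ?case by (simp only: right 1[OF gen(1)] gen(2))
  qed (simp_all add: one simps tens_simps)
  then have "\<Theta> z = \<Theta>' z" for z by (rule qlinear_eqI_tensor[OF lin])
  then show ?thesis by (rule ext)
qed

theorem proposition4p4:
  shows "\<exists>!\<Theta> :: (('l::finite, 'n::finite) abar, ('s::finite, 'n) abar) tensor
              \<Rightarrow> (('s, 'n) abar, ('l, 'n) abar) tensor.
    supermodule_hom (uq_tensor Phi_bar Phi_bar) (uq_tensor Phi_bar Phi_bar) \<Theta> \<and>
    (\<forall>z :: (('l, 'n) abar, (('s, 'n) abar, ('s, 'n) abar) tensor) tensor.
       \<Theta> (tmap id tmul z) =
         tmap tmul id (tassoc_inv (tmap id \<Theta> (tassoc (tmap \<Theta> id (tassoc_inv z)))))) \<and>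
    (\<forall>z :: ((('l, 'n) abar, ('l, 'n) abar) tensor, ('s, 'n) abar) tensor.
       \<Theta> (tmap tmul id z) =
         tmap id tmul (tassoc (tmap \<Theta> id (tassoc_inv (tmap id \<Theta> (tassoc z)))))) \<and>
    (\<forall>x. \<Theta> (1 \<otimes> x) = x \<otimes> 1) \<and>
    (\<forall>y. \<Theta> (y \<otimes> 1) = 1 \<otimes> y) \<and>
    (\<forall>i j k l.
       \<Theta> ((fst_mat (\<lambda>b \<beta>. T_neg b \<beta> \<otimes> 1) \<cdot>\<^sub>3 snd_mat (\<lambda>a \<alpha>. 1 \<otimes> T_neg a \<alpha>)) i j k l) =
       (scalar_mat S_mat \<cdot>\<^sub>3 snd_mat (\<lambda>a \<alpha>. T_neg a \<alpha> \<otimes> 1)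
          \<cdot>\<^sub>3 fst_mat (\<lambda>b \<beta>. 1 \<otimes> T_neg b \<beta>)) i j k l)"
    (is "\<exists>!\<Theta>. ?hom \<Theta> \<and> ?left \<Theta> \<and> ?right \<Theta> \<and> ?one1 \<Theta> \<and> ?one2 \<Theta> \<and> ?gen \<Theta>")
proof (rule ex1I[of _ braiding])
  show "?hom braiding \<and> ?left braiding \<and> ?right braiding \<and> ?one1 braiding \<and> ?one2 braiding \<and> ?gen braiding"
    unfolding hexagon_left_iff[OF qlinear_braiding] hexagon_right_iff[OF qlinear_braiding]
      generator_condition_iff[OF qlinear_braiding]
    using supermodule_hom_braiding braiding_mult_right braiding_mult_left braiding_one_left braiding_one_right braiding_gen
    by (intro conjI allI impI) assumption
  fix \<Theta> :: "(('l, 'n) abar, ('s, 'n) abar) tensor \<Rightarrow> (('s, 'n) abar, ('l, 'n) abar) tensor"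
  assume "?hom \<Theta> \<and> ?left \<Theta> \<and> ?right \<Theta> \<and> ?one1 \<Theta> \<and> ?one2 \<Theta> \<and> ?gen \<Theta>"
  then have *: "?hom \<Theta>" "?left \<Theta>" "?right \<Theta>" "?one1 \<Theta>" "?one2 \<Theta>" "?gen \<Theta>" by simp_all
  then have \<Theta>: "qlinear \<Theta>" by (simp add: supermodule_hom_def)
  note left = *(2)[unfolded hexagon_left_iff[OF \<Theta>], rule_format]
    and right = *(3)[unfolded hexagon_right_iff[OF \<Theta>], rule_format]
    and gen = *(6)[unfolded generator_condition_iff[OF \<Theta>], rule_format]
  show "\<Theta> = braiding"
    by (rule braided_map_eqI[OF \<Theta> qlinear_braiding left braiding_mult_right right braiding_mult_left
        *(4)[rule_format] braiding_one_left *(5)[rule_format] braiding_one_right gen braiding_gen])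
qed

end
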